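(* Let $K$ be a field, $\varphi$ a ring endomorphism of $K$, $R=K[t;\varphi]$, and $(M,v)$ a henselian divisible valued $R$-module. Then: (1) $M_{tor}$ embeds (as an $R$-module) in $M_{\ge\theta}/M_{>\theta}$, and for any such embedding the image of $M_{tor}$ is a direct summand of $M_{\ge\theta}/M_{>\theta}$. (2) The $R$-modules $M_{\ge\theta}/(M_{tor}+M_{>\theta})$, $M_{>\theta}$ and $M/M_{\ge\theta}$ are torsion free and divisible. (3) $M$ can be written as a direct sum $M=M_{tor}\oplus M_\theta\oplus M_{>\theta}\oplus M_-$ of submodules, where $M_\theta$ is isomorphic to $M_{\ge\theta}/(M_{tor}+M_{>\theta})$ and $(M_-,v)$ is isomorphic as a valued module to $(M/M_{\ge\theta},v_{M_{\ge\theta}})$; this decomposition is valuation independent, and each of $M_\theta$, $M_{>\theta}$, $M_-$ is a regular valued module and a $D$-vector space.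
   Context: $R=K[t;\varphi]$: finite sums $\sum_it^ia_i$ ($a_i\in K$) with $at=t\varphi(a)$; $R$ is a right Ore domain and $D$ denotes its skew field of fractions (a torsion free divisible $R$-module is a $D$-vector space). Right modules, action $x.r$; divisible: $M.r=M$ for every non-zero $r$; $M_{tor}=\{x: x.r=0$ for some non-zero $r\}$; torsion free: $M_{tor}=0$. Separable: $a_0\ne0$. A $\tau$-chain: linear order $\Delta$ with maximum $\infty$, strictly increasing $\tau$ with $\tau(\infty)=\infty$, and for $\gamma\ne\infty$, $\delta$: $\tau(\gamma)\le\gamma\wedge\delta<\gamma\Rightarrow\tau(\delta)<\delta$. Let $\Delta_+=\{\gamma:\tau(\gamma)>\gamma\}\cup\{\infty\}$, $\Delta_-=\{\gamma:\tau(\gamma)<\gamma\}$; "$v(x)>\theta$" means $v(x)\in\Delta_+$, "$v(x)<\theta$" means $v(x)\in\Delta_-$. $M_{>\theta}=\{x: v(x)\in\Delta_+\}$, $M_{\ge\theta}=\{x: v(x)\notin\Delta_-\}$. A valued $R$-module $(M,v)$: right $R$-module with surjection $v:M\to\Delta$ onto a $\tau$-chain, $v(x)=\infty\iff x=0$, $v(x\pm y)\ge\min\{v(x),v(y)\}$, $x\mapsto x.t$ injective, $v(x.\lambda)=v(x)$ ($\lambda\in K^\times$), $v(x.t)=\tau(v(x))$. Henselian: for every separable $r$ and every $x$ with $v(x)>\theta$ there is $y$ with $v(y)>\theta$, $y.r=x$. The quotient valuation on $M/M_{\ge\theta}$: $v_{M_{\ge\theta}}(x+M_{\ge\theta})=v(x)$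 if $x\notin M_{\ge\theta}$ and $=\infty$ otherwise; this makes $M/M_{\ge\theta}$ a valued module. A valued module (or submodule) is regular if $v(x.r)=\min_i\tau^i(v(x))$ for all $x$ and all non-zero $r=\sum_it^ia_i$ (min over $i$ with $a_i\neq0$). A family of submodules $(A_i)_{i\in I}$ is valuation independent if $v(\sum_{i\in J}x_i)=\min_{i\in J}v(x_i)$ for every finite $J\subseteq I$ and all $x_i\in A_i$. *)

theory Defs
  imports "HOL-Algebra.UnivPoly"
begin

section \<open>Skew polynomials\<close>

text \<open>
  A finitely supported \<open>f\<close> stands for \<open>\<Sum>i. t\<^sup>i (f i)\<close>, with the coefficients on the right.
  As \<open>a t = t \<phi>(a)\<close>, we have \<open>(t\<^sup>i a) (t\<^sup>j b) = t\<^bsup>i+j\<^esup> \<phi>\<^sup>j(a) b\<close>, which gives the product below.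
\<close>

definition skew_poly_ring :: "('k, 'c) ring_scheme \<Rightarrow> ('k \<Rightarrow> 'k) \<Rightarrow> (nat \<Rightarrow> 'k) ring" where
  "skew_poly_ring K \<phi> = \<lparr>
     carrier = up K,
     mult = (\<lambda>f g n. \<Oplus>\<^bsub>K\<^esub>i\<in>{..n}. (\<phi> ^^ (n - i)) (f i) \<otimes>\<^bsub>K\<^esub> g (n - i)),
     one = (\<lambda>i. if i = 0 then \<one>\<^bsub>K\<^esub> else \<zero>\<^bsub>K\<^esub>),
     zero = (\<lambda>i. \<zero>\<^bsub>K\<^esub>),
     add = (\<lambda>f g i. f i \<oplus>\<^bsub>K\<^esub> g i)\<rparr>"

lemma (in abelian_monoid) finsum_triangle:
  fixes n :: nat
  assumes "\<And>i j. F i j \<in> carrier G"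
  shows "(\<Oplus>k\<in>{..n}. \<Oplus>i\<in>{..k}. F i (k - i)) = (\<Oplus>i\<in>{..n}. \<Oplus>j\<in>{..n - i}. F i j)"
proof (induction n)
  case 0
  show ?case using assms by simp
next
  case (Suc n)
  have eq: "(\<Oplus>j\<in>{..Suc n - i}. F i j) = F i (Suc n - i) \<oplus> (\<Oplus>j\<in>{..n - i}. F i j)"
    if "i \<le> n" for i
  proof -
    have "Suc n - i = Suc (n - i)" using that by simp
    then show ?thesis using assms by (simp add: finsum_Suc a_comm)
  qed
  have "(\<Oplus>i\<in>{..n}. \<Oplus>j\<in>{..Suc n - i}. F i j)
      = (\<Oplus>i\<in>{..n}. F i (Suc n - i) \<oplus> (\<Oplus>j\<in>{..n - i}. F i j))"
    using assms eq by (intro finsum_cong') (auto simp del: finsum_Suc)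
  also have "\<dots> = (\<Oplus>i\<in>{..n}. F i (Suc n - i)) \<oplus> (\<Oplus>i\<in>{..n}. \<Oplus>j\<in>{..n - i}. F i j)"
    using assms by (intro finsum_addf) auto
  finally show ?case
    using Suc assms by (simp add: a_ac)
qed

lemma skew_poly_ring_is_ring:
  assumes K: "field K" and \<phi>: "\<phi> \<in> ring_hom K K"
  shows "ring (skew_poly_ring K \<phi>)"
proof -
  interpret K: field K by fact
  have hom: "\<phi> ^^ n \<in> ring_hom K K" for n
    by (induction n) (use \<phi> in \<open>auto intro!: ring_hom_memI simp: ring_hom_closed ring_hom_mult ring_hom_add ring_hom_one\<close>)
  have cl: "(\<phi> ^^ n) a \<in> carrier K" if "a \<in> carrier K" for n a
    using ring_hom_closed[OF hom that] .
  have hz: "(\<phi> ^^ n) \<zero>\<^bsub>K\<^esub> = \<zero>\<^bsub>K\<^esub>" for n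
    using ring_hom_zero[OF hom K.ring_axioms K.ring_axioms] .
  have h1: "(\<phi> ^^ n) \<one>\<^bsub>K\<^esub> = \<one>\<^bsub>K\<^esub>" for n
    using ring_hom_one[OF hom] .
  have hsum: "(\<phi> ^^ n) (\<Oplus>\<^bsub>K\<^esub>i\<in>{..m::nat}. g i) = (\<Oplus>\<^bsub>K\<^esub>i\<in>{..m}. (\<phi> ^^ n) (g i))"
    if "\<And>i. g i \<in> carrier K" for n m g
  proof (induction m)
    case 0
    then show ?case using that cl by simp
  next
    case (Suc m)
    then show ?case using that cl
      by (simp add: ring_hom_add[OF hom] K.finsum_closed Pi_def)
  qed
  have mem: "f n \<in> carrier K" if "f \<in> up K" for f n
    using that by (rule mem_upD)
  have mult_closed: "(\<lambda>n. \<Oplus>\<^bsub>K\<^esub>i\<in>{..n}. (\<phi> ^^ (n - i)) (f i) \<otimes>\<^bsub>K\<^esub> g (n - i)) \<in> up K"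
    if "f \<in> up K" "g \<in> up K" for f g
  proof (rule mem_upI)
    show "(\<Oplus>\<^bsub>K\<^esub>i\<in>{..n}. (\<phi> ^^ (n - i)) (f i) \<otimes>\<^bsub>K\<^esub> g (n - i)) \<in> carrier K" for n
      using that mem cl by (intro K.finsum_closed) auto
    obtain p q where p: "bound \<zero>\<^bsub>K\<^esub> p f" and q: "bound \<zero>\<^bsub>K\<^esub> q g"
      using K.bound_upD[OF \<open>f \<in> up K\<close>] K.bound_upD[OF \<open>g \<in> up K\<close>] by blast
    have "bound \<zero>\<^bsub>K\<^esub> (p + q) (\<lambda>n. \<Oplus>\<^bsub>K\<^esub>i\<in>{..n}. (\<phi> ^^ (n - i)) (f i) \<otimes>\<^bsub>K\<^esub> g (n - i))"
    proof
      fix n assume n: "p + q < n"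
      have "(\<phi> ^^ (n - i)) (f i) \<otimes>\<^bsub>K\<^esub> g (n - i) = \<zero>\<^bsub>K\<^esub>" for i
      proof (cases "p < i")
        case True
        then show ?thesis using bound.bound[OF p] hz mem[OF that(2)] by simp
      next
        case False
        then have "q < n - i" using n by linarith
        then show ?thesis using bound.bound[OF q] cl mem[OF that(1)] by simp
      qed
      then show "(\<Oplus>\<^bsub>K\<^esub>i\<in>{..n}. (\<phi> ^^ (n - i)) (f i) \<otimes>\<^bsub>K\<^esub> g (n - i)) = \<zero>\<^bsub>K\<^esub>"
        by simp
    qed
    then show "\<exists>n. bound \<zero>\<^bsub>K\<^esub> n (\<lambda>n. \<Oplus>\<^bsub>K\<^esub>i\<in>{..n}. (\<phi> ^^ (n - i)) (f i) \<otimes>\<^bsub>K\<^esub> g (n - i))" ..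
  qed
  have assoc: "(\<Oplus>\<^bsub>K\<^esub>k\<in>{..n}. (\<phi> ^^ (n - k)) (\<Oplus>\<^bsub>K\<^esub>i\<in>{..k}. (\<phi> ^^ (k - i)) (f i) \<otimes>\<^bsub>K\<^esub> g (k - i)) \<otimes>\<^bsub>K\<^esub> h (n - k))
      = (\<Oplus>\<^bsub>K\<^esub>i\<in>{..n}. (\<phi> ^^ (n - i)) (f i) \<otimes>\<^bsub>K\<^esub>
           (\<Oplus>\<^bsub>K\<^esub>j\<in>{..n - i}. (\<phi> ^^ (n - i - j)) (g j) \<otimes>\<^bsub>K\<^esub> h (n - i - j)))"
    (is "?L = ?R") if "f \<in> up K" "g \<in> up K" "h \<in> up K" for f g h n
  proof -
    define F where "F i j = (\<phi> ^^ (n - i)) (f i) \<otimes>\<^bsub>K\<^esub> ((\<phi> ^^ (n - i - j)) (g j) \<otimes>\<^bsub>K\<^esub> h (n - i - j))" for i j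
    have F: "F i j \<in> carrier K" for i j
      unfolding F_def using that mem cl by auto
    have "(\<phi> ^^ (n - k)) (\<Oplus>\<^bsub>K\<^esub>i\<in>{..k}. (\<phi> ^^ (k - i)) (f i) \<otimes>\<^bsub>K\<^esub> g (k - i)) \<otimes>\<^bsub>K\<^esub> h (n - k)
        = (\<Oplus>\<^bsub>K\<^esub>i\<in>{..k}. F i (k - i))" if k: "k \<le> n" for k
    proof -
      have "(\<phi> ^^ (n - k)) (\<Oplus>\<^bsub>K\<^esub>i\<in>{..k}. (\<phi> ^^ (k - i)) (f i) \<otimes>\<^bsub>K\<^esub> g (k - i)) \<otimes>\<^bsub>K\<^esub> h (n - k)
          = (\<Oplus>\<^bsub>K\<^esub>i\<in>{..k}. (\<phi> ^^ (n - k)) ((\<phi> ^^ (k - i)) (f i) \<otimes>\<^bsub>K\<^esub> g (k - i)) \<otimes>\<^bsub>K\<^esub> h (n - k))"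
        using \<open>f \<in> up K\<close> \<open>g \<in> up K\<close> \<open>h \<in> up K\<close> mem cl
        by (subst hsum) (auto intro!: K.finsum_ldistr)
      also have "\<dots> = (\<Oplus>\<^bsub>K\<^esub>i\<in>{..k}. F i (k - i))"
      proof (intro K.finsum_cong')
        fix i assume "i \<in> {..k}"
        then have e: "n - i = (n - k) + (k - i)" "n - i - (k - i) = n - k" using k by auto
        have "(\<phi> ^^ (n - i)) (f i) = (\<phi> ^^ (n - k)) ((\<phi> ^^ (k - i)) (f i))"
          by (subst e(1)) (simp add: funpow_add)
        then show "(\<phi> ^^ (n - k)) ((\<phi> ^^ (k - i)) (f i) \<otimes>\<^bsub>K\<^esub> g (k - i)) \<otimes>\<^bsub>K\<^esub> h (n - k) = F i (k - i)"
          unfolding F_def e(2)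
          using \<open>f \<in> up K\<close> \<open>g \<in> up K\<close> \<open>h \<in> up K\<close> mem cl
          by (simp add: ring_hom_mult[OF hom] K.m_assoc)
      qed (use F in auto)
      finally show ?thesis .
    qed
    then have "?L = (\<Oplus>\<^bsub>K\<^esub>k\<in>{..n}. \<Oplus>\<^bsub>K\<^esub>i\<in>{..k}. F i (k - i))"
      using F by (intro K.finsum_cong') auto
    also have "\<dots> = (\<Oplus>\<^bsub>K\<^esub>i\<in>{..n}. \<Oplus>\<^bsub>K\<^esub>j\<in>{..n - i}. F i j)"
      using F by (rule K.finsum_triangle)
    also have "\<dots> = ?R"
      unfolding F_def using that mem cl
      by (intro K.finsum_cong' K.finsum_rdistr[symmetric]) auto
    finally show ?thesis .
  qed
  have one_l: "(\<Oplus>\<^bsub>K\<^esub>i\<in>{..n}. (\<phi> ^^ (n - i)) (if i = 0 then \<one>\<^bsub>K\<^esub> else \<zero>\<^bsub>K\<^esub>) \<otimes>\<^bsub>K\<^esub> f (n - i)) = f n"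
    if "f \<in> up K" for f n
  proof -
    have "(\<Oplus>\<^bsub>K\<^esub>i\<in>{..n}. (\<phi> ^^ (n - i)) (if i = 0 then \<one>\<^bsub>K\<^esub> else \<zero>\<^bsub>K\<^esub>) \<otimes>\<^bsub>K\<^esub> f (n - i))
       = (\<Oplus>\<^bsub>K\<^esub>i\<in>{..n}. if 0 = i then f (n - i) else \<zero>\<^bsub>K\<^esub>)"
      using that mem by (intro K.finsum_cong') (auto simp: hz h1)
    also have "\<dots> = f n" using that mem by (subst K.finsum_singleton) auto
    finally show ?thesis .
  qed
  have one_r: "(\<Oplus>\<^bsub>K\<^esub>i\<in>{..n}. (\<phi> ^^ (n - i)) (f i) \<otimes>\<^bsub>K\<^esub> (if n - i = 0 then \<one>\<^bsub>K\<^esub> else \<zero>\<^bsub>K\<^esub>)) = f n"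
    if "f \<in> up K" for f n
  proof -
    have "(\<Oplus>\<^bsub>K\<^esub>i\<in>{..n}. (\<phi> ^^ (n - i)) (f i) \<otimes>\<^bsub>K\<^esub> (if n - i = 0 then \<one>\<^bsub>K\<^esub> else \<zero>\<^bsub>K\<^esub>))
       = (\<Oplus>\<^bsub>K\<^esub>i\<in>{..n}. if n = i then f i else \<zero>\<^bsub>K\<^esub>)"
      using that mem cl by (intro K.finsum_cong') auto
    also have "\<dots> = f n" using that mem by (subst K.finsum_singleton) auto
    finally show ?thesis .
  qed
  show ?thesis
  proof (rule ringI)
    show "abelian_group (skew_poly_ring K \<phi>)"
    proof (rule abelian_groupI)
      fix f assume "f \<in> carrier (skew_poly_ring K \<phi>)"
      then show "\<exists>g\<in>carrier (skew_poly_ring K \<phi>). g \<oplus>\<^bsub>skew_poly_ring K \<phi>\<^esub> f = \<zero>\<^bsub>skew_poly_ring K \<phi>\<^esub>"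
        using K.up_a_inv_closed mem
        by (intro bexI[of _ "\<lambda>i. \<ominus>\<^bsub>K\<^esub> f i"]) (auto simp: skew_poly_ring_def K.l_neg)
    qed (use mem K.up_add_closed in \<open>auto simp: skew_poly_ring_def K.a_ac fun_eq_iff\<close>)
    show "monoid (skew_poly_ring K \<phi>)"
      by (rule monoidI)
        (use mult_closed K.up_one_closed in \<open>auto simp: skew_poly_ring_def assoc one_l one_r fun_eq_iff simp del: diff_is_0_eq\<close>)
  next
    fix f g h assume *: "f \<in> carrier (skew_poly_ring K \<phi>)" "g \<in> carrier (skew_poly_ring K \<phi>)" "h \<in> carrier (skew_poly_ring K \<phi>)"
    then have up: "f \<in> up K" "g \<in> up K" "h \<in> up K" by (auto simp: skew_poly_ring_def)
    show "(f \<oplus>\<^bsub>skew_poly_ring K \<phi>\<^esub> g) \<otimes>\<^bsub>skew_poly_ring K \<phi>\<^esub> h =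
        f \<otimes>\<^bsub>skew_poly_ring K \<phi>\<^esub> h \<oplus>\<^bsub>skew_poly_ring K \<phi>\<^esub> g \<otimes>\<^bsub>skew_poly_ring K \<phi>\<^esub> h"
      using up mem cl
      by (auto simp: skew_poly_ring_def fun_eq_iff ring_hom_add[OF hom] K.l_distr Pi_def
          simp flip: K.finsum_addf intro!: K.finsum_cong')
    show "h \<otimes>\<^bsub>skew_poly_ring K \<phi>\<^esub> (f \<oplus>\<^bsub>skew_poly_ring K \<phi>\<^esub> g) =
        h \<otimes>\<^bsub>skew_poly_ring K \<phi>\<^esub> f \<oplus>\<^bsub>skew_poly_ring K \<phi>\<^esub> h \<otimes>\<^bsub>skew_poly_ring K \<phi>\<^esub> g"
      using up mem cl
      by (auto simp: skew_poly_ring_def fun_eq_iff K.r_distr Pi_def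
          simp flip: K.finsum_addf intro!: K.finsum_cong')
  qed
qed

text \<open>\<open>skew_monom K a n\<close> is \<open>t\<^sup>n a\<close>.\<close>

definition skew_monom :: "('k, 'c) ring_scheme \<Rightarrow> 'k \<Rightarrow> nat \<Rightarrow> (nat \<Rightarrow> 'k)" where
  "skew_monom K a n = (\<lambda>i. if i = n then a else \<zero>\<^bsub>K\<^esub>)"

definition separable :: "('k, 'c) ring_scheme \<Rightarrow> (nat \<Rightarrow> 'k) \<Rightarrow> bool" where
  "separable K r \<longleftrightarrow> r \<in> up K \<and> r 0 \<noteq> \<zero>\<^bsub>K\<^esub>"


section \<open>Right modules over a ring that need not be commutative\<close>

text \<open>
  We use the library's record \<open>module\<close>, but \<open>r \<odot>\<^bsub>M\<^esub> x\<close> is read as the right action \<open>x.r\<close>;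
  hence \<open>smult_assoc\<close> says \<open>x.(rs) = (x.r).s\<close>.  The library's locale \<open>module\<close> needs a
  commutative ring; its locale \<open>submodule\<close> does not and is used as it stands.
  The fields \<open>mult\<close> and \<open>one\<close> of a module record play no role.
\<close>

locale right_module = R?: ring R + M?: abelian_group M
  for R :: "('r, 'c) ring_scheme" (structure) and M :: "('r, 'm, 'e) module_scheme" (structure) +
  assumes smult_closed:
      "\<lbrakk>r \<in> carrier R; x \<in> carrier M\<rbrakk> \<Longrightarrow> r \<odot>\<^bsub>M\<^esub> x \<in> carrier M"
    and smult_add_scalar:
      "\<lbrakk>r \<in> carrier R; s \<in> carrier R; x \<in> carrier M\<rbrakk> \<Longrightarrow>
        (r \<oplus>\<^bsub>R\<^esub> s) \<odot>\<^bsub>M\<^esub> x = r \<odot>\<^bsub>M\<^esub> x \<oplus>\<^bsub>M\<^esub> s \<odot>\<^bsub>M\<^esub> x"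
    and smult_add_vector:
      "\<lbrakk>r \<in> carrier R; x \<in> carrier M; y \<in> carrier M\<rbrakk> \<Longrightarrow>
        r \<odot>\<^bsub>M\<^esub> (x \<oplus>\<^bsub>M\<^esub> y) = r \<odot>\<^bsub>M\<^esub> x \<oplus>\<^bsub>M\<^esub> r \<odot>\<^bsub>M\<^esub> y"
    and smult_assoc:
      "\<lbrakk>r \<in> carrier R; s \<in> carrier R; x \<in> carrier M\<rbrakk> \<Longrightarrow>
        (r \<otimes>\<^bsub>R\<^esub> s) \<odot>\<^bsub>M\<^esub> x = s \<odot>\<^bsub>M\<^esub> (r \<odot>\<^bsub>M\<^esub> x)"
    and smult_one:
      "x \<in> carrier M \<Longrightarrow> \<one>\<^bsub>R\<^esub> \<odot>\<^bsub>M\<^esub> x = x"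

definition restrict_module :: "('r, 'm, 'e) module_scheme \<Rightarrow> 'm set \<Rightarrow> ('r, 'm, 'e) module_scheme" where
  "restrict_module M N = M\<lparr>carrier := N\<rparr>"

definition quotient_module :: "('r, 'm, 'e) module_scheme \<Rightarrow> 'm set \<Rightarrow> ('r, 'm set) module" where
  "quotient_module M N = \<lparr>
     carrier = a_rcosets\<^bsub>M\<^esub> N,
     mult = undefined,
     one = undefined,
     zero = N,
     add = (\<lambda>X Y. X <+>\<^bsub>M\<^esub> Y),
     smult = (\<lambda>r X. \<Union>x\<in>X. N +>\<^bsub>M\<^esub> (r \<odot>\<^bsub>M\<^esub> x))\<rparr>"

definition right_module_hom ::
    "('r, 'c) ring_scheme \<Rightarrow> ('r, 'm, 'e) module_scheme \<Rightarrow> ('r, 'n, 'f) module_scheme \<Rightarrow> ('m \<Rightarrow> 'n) set" where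
  "right_module_hom R M N = {f \<in> carrier M \<rightarrow> carrier N.
     (\<forall>x\<in>carrier M. \<forall>y\<in>carrier M. f (x \<oplus>\<^bsub>M\<^esub> y) = f x \<oplus>\<^bsub>N\<^esub> f y) \<and>
     (\<forall>r\<in>carrier R. \<forall>x\<in>carrier M. f (r \<odot>\<^bsub>M\<^esub> x) = r \<odot>\<^bsub>N\<^esub> f x)}"

definition right_module_embedding ::
    "('r, 'c) ring_scheme \<Rightarrow> ('r, 'm, 'e) module_scheme \<Rightarrow> ('r, 'n, 'f) module_scheme \<Rightarrow> ('m \<Rightarrow> 'n) set" where
  "right_module_embedding R M N = {f \<in> right_module_hom R M N. inj_on f (carrier M)}"

definition right_module_iso ::
    "('r, 'c) ring_scheme \<Rightarrow> ('r, 'm, 'e) module_scheme \<Rightarrow> ('r, 'n, 'f) module_scheme \<Rightarrow> ('m \<Rightarrow> 'n) set" where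
  "right_module_iso R M N = {f \<in> right_module_hom R M N. bij_betw f (carrier M) (carrier N)}"

definition torsion :: "('r, 'c) ring_scheme \<Rightarrow> ('r, 'm, 'e) module_scheme \<Rightarrow> 'm set" where
  "torsion R M = {x \<in> carrier M. \<exists>r \<in> carrier R - {\<zero>\<^bsub>R\<^esub>}. r \<odot>\<^bsub>M\<^esub> x = \<zero>\<^bsub>M\<^esub>}"

locale torsion_free_module = right_module +
  assumes torsion_trivial: "torsion R M = {\<zero>\<^bsub>M\<^esub>}"

locale divisible_module = right_module +
  assumes divisible:
    "r \<in> carrier R - {\<zero>\<^bsub>R\<^esub>} \<Longrightarrow> (\<lambda>x. r \<odot>\<^bsub>M\<^esub> x) ` carrier M = carrier M"

definition direct_summand :: "('r, 'c) ring_scheme \<Rightarrow> ('r, 'm, 'e) module_scheme \<Rightarrow> 'm set \<Rightarrow> bool" where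
  "direct_summand R M A \<longleftrightarrow> submodule A R M \<and>
     (\<exists>B. submodule B R M \<and> A <+>\<^bsub>M\<^esub> B = carrier M \<and> A \<inter> B = {\<zero>\<^bsub>M\<^esub>})"

text \<open>Internal direct sum of a finite family of submodules.\<close>

definition internal_direct_sum ::
    "('r, 'c) ring_scheme \<Rightarrow> ('r, 'm, 'e) module_scheme \<Rightarrow> 'i set \<Rightarrow> ('i \<Rightarrow> 'm set) \<Rightarrow> bool" where
  "internal_direct_sum R M I A \<longleftrightarrow> finite I \<and> (\<forall>i\<in>I. submodule (A i) R M) \<and>
     (\<forall>y\<in>carrier M. \<exists>!x. x \<in> (\<Pi>\<^sub>E i\<in>I. A i) \<and> y = (\<Oplus>\<^bsub>M\<^esub>i\<in>I. x i))"


section \<open>The skew field of fractions\<close>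

text \<open>
  \<open>(D, \<iota>)\<close> is a skew field of right fractions of \<open>R\<close>.  For a right Ore domain such a pair
  exists and is unique up to a unique isomorphism over \<open>R\<close>.
\<close>

locale skew_field_of_fractions = R: ring R + D: ring D
  for R :: "('r, 'c) ring_scheme" and D :: "('d, 'e) ring_scheme" and \<iota> :: "'r \<Rightarrow> 'd" +
  assumes one_not_zero: "\<one>\<^bsub>D\<^esub> \<noteq> \<zero>\<^bsub>D\<^esub>"
    and units: "Units D = carrier D - {\<zero>\<^bsub>D\<^esub>}"
    and hom: "\<iota> \<in> ring_hom R D"
    and inj: "inj_on \<iota> (carrier R)"
    and fractions:
      "d \<in> carrier D \<Longrightarrow> \<exists>r\<in>carrier R. \<exists>s\<in>carrier R - {\<zero>\<^bsub>R\<^esub>}. d = \<iota> r \<otimes>\<^bsub>D\<^esub> inv\<^bsub>D\<^esub> (\<iota> s)"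

text \<open>The \<open>R\<close>-module \<open>M\<close> is a \<open>D\<close>-vector space: its \<open>R\<close>-action extends to \<open>D\<close> along \<open>\<iota>\<close>.\<close>

definition is_vector_space_over ::
    "('d, 'c) ring_scheme \<Rightarrow> ('r \<Rightarrow> 'd) \<Rightarrow> ('r, 'e) ring_scheme \<Rightarrow> ('r, 'm, 'f) module_scheme \<Rightarrow> bool" where
  "is_vector_space_over D \<iota> R M \<longleftrightarrow> (\<exists>V :: ('d, 'm) module.
     right_module D V \<and> carrier V = carrier M \<and> zero V = zero M \<and> add V = add M \<and>
     (\<forall>r\<in>carrier R. \<forall>x\<in>carrier M. \<iota> r \<odot>\<^bsub>V\<^esub> x = r \<odot>\<^bsub>M\<^esub> x))"


section \<open>Valued modules\<close>

text \<open>The chain is a subset of a linearly ordered type; \<open>\<omega>\<close> is its maximum, written \<open>\<infinity>\<close> on paper.\<close>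

locale tau_chain =
  fixes \<Delta> :: "'v::linorder set" and \<omega> :: 'v and \<tau> :: "'v \<Rightarrow> 'v"
  assumes omega_mem: "\<omega> \<in> \<Delta>"
    and le_omega: "\<gamma> \<in> \<Delta> \<Longrightarrow> \<gamma> \<le> \<omega>"
    and tau_closed: "\<tau> \<in> \<Delta> \<rightarrow> \<Delta>"
    and tau_strict_mono: "strict_mono_on \<Delta> \<tau>"
    and tau_omega: "\<tau> \<omega> = \<omega>"
    and tau_below:
      "\<lbrakk>\<gamma> \<in> \<Delta>; \<gamma> \<noteq> \<omega>; \<delta> \<in> \<Delta>; \<tau> \<gamma> \<le> \<gamma>; \<delta> < \<gamma>\<rbrakk> \<Longrightarrow> \<tau> \<delta> < \<delta>"

definition chain_pos :: "'v::linorder set \<Rightarrow> 'v \<Rightarrow> ('v \<Rightarrow> 'v) \<Rightarrow> 'v set" where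
  "chain_pos \<Delta> \<omega> \<tau> = {\<gamma> \<in> \<Delta>. \<tau> \<gamma> > \<gamma>} \<union> {\<omega>}"

definition chain_neg :: "'v::linorder set \<Rightarrow> ('v \<Rightarrow> 'v) \<Rightarrow> 'v set" where
  "chain_neg \<Delta> \<tau> = {\<gamma> \<in> \<Delta>. \<tau> \<gamma> < \<gamma>}"

locale valued_module =
  right_module "skew_poly_ring K \<phi>" M + tau_chain \<Delta> \<omega> \<tau>
  for K :: "('k, 'c) ring_scheme" and \<phi> :: "'k \<Rightarrow> 'k"
    and M :: "(nat \<Rightarrow> 'k, 'm, 'e) module_scheme" (structure)
    and \<Delta> :: "'v::linorder set" and \<omega> :: 'v and \<tau> :: "'v \<Rightarrow> 'v" +
  fixes v :: "'m \<Rightarrow> 'v"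
  assumes v_surj: "v ` carrier M = \<Delta>"
    and v_eq_omega: "x \<in> carrier M \<Longrightarrow> v x = \<omega> \<longleftrightarrow> x = \<zero>\<^bsub>M\<^esub>"
    and v_add: "\<lbrakk>x \<in> carrier M; y \<in> carrier M\<rbrakk> \<Longrightarrow> v (x \<oplus>\<^bsub>M\<^esub> y) \<ge> min (v x) (v y)"
    and v_diff: "\<lbrakk>x \<in> carrier M; y \<in> carrier M\<rbrakk> \<Longrightarrow> v (x \<ominus>\<^bsub>M\<^esub> y) \<ge> min (v x) (v y)"
    and t_inj: "inj_on (\<lambda>x. skew_monom K \<one>\<^bsub>K\<^esub> 1 \<odot>\<^bsub>M\<^esub> x) (carrier M)"
    and v_scalar:
      "\<lbrakk>x \<in> carrier M; a \<in> carrier K - {\<zero>\<^bsub>K\<^esub>}\<rbrakk> \<Longrightarrow> v (skew_monom K a 0 \<odot>\<^bsub>M\<^esub> x) = v x"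
    and v_t: "x \<in> carrier M \<Longrightarrow> v (skew_monom K \<one>\<^bsub>K\<^esub> 1 \<odot>\<^bsub>M\<^esub> x) = \<tau> (v x)"

text \<open>The submodules of elements of value \<open>> \<theta>\<close> and \<open>\<ge> \<theta>\<close>.\<close>

definition val_gt :: "('r, 'm, 'e) module_scheme \<Rightarrow> 'v::linorder set \<Rightarrow> 'v \<Rightarrow> ('v \<Rightarrow> 'v) \<Rightarrow> ('m \<Rightarrow> 'v) \<Rightarrow> 'm set" where
  "val_gt M \<Delta> \<omega> \<tau> v = {x \<in> carrier M. v x \<in> chain_pos \<Delta> \<omega> \<tau>}"

definition val_ge :: "('r, 'm, 'e) module_scheme \<Rightarrow> 'v::linorder set \<Rightarrow> ('v \<Rightarrow> 'v) \<Rightarrow> ('m \<Rightarrow> 'v) \<Rightarrow> 'm set" where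
  "val_ge M \<Delta> \<tau> v = {x \<in> carrier M. v x \<notin> chain_neg \<Delta> \<tau>}"

locale henselian_valued_module = valued_module +
  assumes henselian:
    "\<lbrakk>separable K r; x \<in> val_gt M \<Delta> \<omega> \<tau> v\<rbrakk> \<Longrightarrow> \<exists>y\<in>val_gt M \<Delta> \<omega> \<tau> v. r \<odot>\<^bsub>M\<^esub> y = x"

locale regular_valued_module = valued_module +
  assumes regular:
    "\<lbrakk>x \<in> carrier M; r \<in> carrier (skew_poly_ring K \<phi>) - {\<zero>\<^bsub>skew_poly_ring K \<phi>\<^esub>}\<rbrakk> \<Longrightarrow>
      v (r \<odot>\<^bsub>M\<^esub> x) = Min ((\<lambda>i. (\<tau> ^^ i) (v x)) ` {i. r i \<noteq> \<zero>\<^bsub>K\<^esub>})"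

text \<open>
  A submodule carries the restricted valuation, whose chain is the set of values it takes.
\<close>

definition regular_submodule ::
    "('k, 'c) ring_scheme \<Rightarrow> ('k \<Rightarrow> 'k) \<Rightarrow> (nat \<Rightarrow> 'k, 'm, 'e) module_scheme \<Rightarrow>
     'v::linorder \<Rightarrow> ('v \<Rightarrow> 'v) \<Rightarrow> ('m \<Rightarrow> 'v) \<Rightarrow> 'm set \<Rightarrow> bool" where
  "regular_submodule K \<phi> M \<omega> \<tau> v N \<longleftrightarrow>
     submodule N (skew_poly_ring K \<phi>) M \<and>
     regular_valued_module K \<phi> (restrict_module M N) (v ` N) \<omega> \<tau> v"

text \<open>
  The quotient valuation on \<open>M / N\<close> for \<open>N = M\<^bsub>\<ge>\<theta>\<^esub>\<close>: the valuation is constant on every coset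
  other than \<open>N\<close> itself.
\<close>

definition quotient_val :: "'m set \<Rightarrow> 'v \<Rightarrow> ('m \<Rightarrow> 'v) \<Rightarrow> 'm set \<Rightarrow> 'v" where
  "quotient_val N \<omega> v X = (if X = N then \<omega> else the_elem (v ` X))"

text \<open>
  Isomorphisms of valued modules whose chains lie in a common chain; they preserve values.
\<close>

definition valued_module_iso ::
    "('r, 'c) ring_scheme \<Rightarrow> ('r, 'm, 'e) module_scheme \<Rightarrow> ('m \<Rightarrow> 'v) \<Rightarrow>
     ('r, 'n, 'f) module_scheme \<Rightarrow> ('n \<Rightarrow> 'v) \<Rightarrow> ('m \<Rightarrow> 'n) set" where
  "valued_module_iso R M v N w = {f \<in> right_module_iso R M N. \<forall>x\<in>carrier M. w (f x) = v x}"

text \<open>For \<open>J = {}\<close> the condition would read \<open>v 0 = \<infinity>\<close>, which always holds.\<close>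

definition valuation_independent ::
    "('r, 'm, 'e) module_scheme \<Rightarrow> ('m \<Rightarrow> 'v::linorder) \<Rightarrow> 'i set \<Rightarrow> ('i \<Rightarrow> 'm set) \<Rightarrow> bool" where
  "valuation_independent M v I A \<longleftrightarrow>
     (\<forall>J x. finite J \<and> J \<noteq> {} \<and> J \<subseteq> I \<and> (\<forall>i\<in>J. x i \<in> A i) \<longrightarrow>
        v (\<Oplus>\<^bsub>M\<^esub>i\<in>J. x i) = Min ((\<lambda>i. v (x i)) ` J))"

end

(*
  K[t;phi] is a right principal ideal domain, because one can divide with remainder on the right.
  Hence divisible modules are injective (Baer), so that a divisible submodule is a direct summand.
  Away from the unique fixed point theta of tau, the values tau^i(v(x)) are pairwise distinct, which
  gives v(x.r) = min_i tau^i(v(x)); therefore M_{>theta} and M/M_{>=theta} are torsion free.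
  The henselian property makes M_{>theta} divisible: the separable scalars are handled by the
  hypothesis, and powers of t are divided out in M.  M_{>=theta} and M_tor are divisible as well, so
  M_tor + M_{>theta} splits off from M_{>=theta}, and M_{>=theta} splits off from M.
*)

theory Submission
  imports Defs
begin

section \<open>Skew polynomials form a right principal ideal domain\<close>

text \<open>The one-sidedness is forced by \<phi>, which is injective but not assumed surjective.
  The leading coefficient of g (t^k c) is \<phi>^k(g_m) c, which takes every value as c varies,
  whereas cancelling leading terms by multiplying g from the left would ask for preimages under
  \<phi>. So it is right ideals that are principal, and right modules that Baer's argument reaches.
  The obstacle is \<theta>: there all \<tau>^i(v(x)) coincide, and x.r may jump in value or vanish.
  Every non-zero torsion element has value \<theta>. The remedy is to choose \<open>M_theta\<close>
  as a complement of the torsion and \<open>val_gt\<close> together: it then contains neither, so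
  that its non-zero elements and all their non-zero multiples have value exactly \<theta>, which is
  what regularity means at a fixed point of \<tau>. Valuation independence then comes from the
  position of the values: non-zero elements of \<open>val_gt\<close> lie above \<theta>, those of
  \<open>M_minus\<close> below, and those of the other two summands at \<theta>, where a sum can
  gain value only by falling into \<open>val_gt\<close>, which the choice of \<open>M_theta\<close>
  excludes.\<close>

locale right_pid = ring R for R (structure) +
  assumes one_not_zero: "\<one> \<noteq> \<zero>"
    and integral:
      "\<lbrakk>a \<in> carrier R; b \<in> carrier R; a \<otimes> b = \<zero>\<rbrakk> \<Longrightarrow> a = \<zero> \<or> b = \<zero>"
    and right_principal:
      "\<lbrakk>additive_subgroup I R; \<And>a r. \<lbrakk>a \<in> I; r \<in> carrier R\<rbrakk> \<Longrightarrow> a \<otimes> r \<in> I\<rbrakk> \<Longrightarrow>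
        \<exists>s\<in>carrier R. I = (\<lambda>r. s \<otimes> r) ` carrier R"

text \<open>If \<open>f R \<inter> g R\<close> were \<open>0\<close>, then \<open>f R + g R\<close> would be a direct sum, which no cyclic right ideal is.\<close>

lemma (in right_pid) right_ore:
  assumes f: "f \<in> carrier R" "f \<noteq> \<zero>" and g: "g \<in> carrier R" "g \<noteq> \<zero>"
  obtains a b where "a \<in> carrier R" "b \<in> carrier R" "f \<otimes> a = g \<otimes> b" "a \<noteq> \<zero>" "b \<noteq> \<zero>"
proof -
  have "\<exists>a\<in>carrier R. \<exists>b\<in>carrier R. f \<otimes> a = g \<otimes> b \<and> f \<otimes> a \<noteq> \<zero>"
  proof (rule ccontr)
    assume "\<not> ?thesis"
    then have indep: "f \<otimes> a = \<zero>" if "f \<otimes> a = g \<otimes> b" "a \<in> carrier R" "b \<in> carrier R" for a b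
      using that by blast
    define I where "I = {f \<otimes> a \<oplus> g \<otimes> b | a b. a \<in> carrier R \<and> b \<in> carrier R}"
    have "additive_subgroup I R"
    proof (intro additive_subgroupI add.subgroupI)
      show "I \<subseteq> carrier R" unfolding I_def using f g by auto
      show "I \<noteq> {}" unfolding I_def by blast
    next
      fix x assume "x \<in> I"
      then obtain a b where x: "x = f \<otimes> a \<oplus> g \<otimes> b" "a \<in> carrier R" "b \<in> carrier R"
        unfolding I_def by blast
      then have "\<ominus> x = f \<otimes> (\<ominus> a) \<oplus> g \<otimes> (\<ominus> b)"
        using f g by (simp add: r_minus minus_add)
      then show "\<ominus> x \<in> I" unfolding I_def using x by blast
    next
      fix x y assume "x \<in> I" "y \<in> I"
      then obtain a b c d where x: "x = f \<otimes> a \<oplus> g \<otimes> b" "a \<in> carrier R" "b \<in> carrier R"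
        and y: "y = f \<otimes> c \<oplus> g \<otimes> d" "c \<in> carrier R" "d \<in> carrier R"
        unfolding I_def by blast
      then have "x \<oplus> y = f \<otimes> (a \<oplus> c) \<oplus> g \<otimes> (b \<oplus> d)"
        using f g by (simp add: r_distr a_ac)
      then show "x \<oplus> y \<in> I" unfolding I_def using x y by blast
    qed
    moreover have "x \<otimes> r \<in> I" if "x \<in> I" "r \<in> carrier R" for x r
    proof -
      obtain a b where x: "x = f \<otimes> a \<oplus> g \<otimes> b" "a \<in> carrier R" "b \<in> carrier R"
        using \<open>x \<in> I\<close> unfolding I_def by blast
      then have "x \<otimes> r = f \<otimes> (a \<otimes> r) \<oplus> g \<otimes> (b \<otimes> r)"
        using f g that by (simp add: l_distr m_assoc)
      then show ?thesis unfolding I_def using x that by blast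
    qed
    ultimately obtain d where d: "d \<in> carrier R" "I = (\<lambda>r. d \<otimes> r) ` carrier R"
      using right_principal by blast
    have "f = f \<otimes> \<one> \<oplus> g \<otimes> \<zero>" using f g by simp
    then have "f \<in> I" unfolding I_def by blast
    then obtain c where c: "c \<in> carrier R" "f = d \<otimes> c" using d by auto
    have "g = f \<otimes> \<zero> \<oplus> g \<otimes> \<one>" using f g by simp
    then have "g \<in> I" unfolding I_def by blast
    then obtain e where e: "e \<in> carrier R" "g = d \<otimes> e" using d by auto
    have "d \<in> I" unfolding d(2) using d(1) by (metis image_eqI one_closed r_one)
    then obtain a b where ab: "a \<in> carrier R" "b \<in> carrier R" "d = f \<otimes> a \<oplus> g \<otimes> b"
      unfolding I_def by blast
    \<comment> \<open>From f = d c and d = f a + g b, the element g (b c) lies in f R as well as in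
      g R, so it is 0 and hence b = 0. Then d = f a, so g = d e = f (a e) lies in f R too, which is
      the contradiction.\<close>
    have "g \<otimes> (b \<otimes> c) = f \<otimes> (\<one> \<ominus> a \<otimes> c)"
    proof -
      have fc: "f = f \<otimes> (a \<otimes> c) \<oplus> g \<otimes> (b \<otimes> c)"
      proof -
        have "f = (f \<otimes> a \<oplus> g \<otimes> b) \<otimes> c" using c(2) unfolding ab(3)[symmetric] .
        also have "\<dots> = f \<otimes> (a \<otimes> c) \<oplus> g \<otimes> (b \<otimes> c)"
          using ab(1,2) c(1) f g by (simp add: l_distr m_assoc)
        finally show ?thesis .
      qed
      have "f \<otimes> (\<one> \<ominus> a \<otimes> c) = f \<ominus> f \<otimes> (a \<otimes> c)"
        using f(1) ab(1) c(1) by (simp add: r_minus r_distr minus_eq)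
      also have "\<dots> = (f \<otimes> (a \<otimes> c) \<oplus> g \<otimes> (b \<otimes> c)) \<ominus> f \<otimes> (a \<otimes> c)"
        using arg_cong[OF fc, of "\<lambda>z. z \<ominus> f \<otimes> (a \<otimes> c)"] .
      also have "\<dots> = g \<otimes> (b \<otimes> c)"
        using f(1) g(1) ab(1,2) c(1)
        by (simp add: minus_eq a_assoc r_neg a_comm[of "f \<otimes> (a \<otimes> c)" "g \<otimes> (b \<otimes> c)"])
      finally show ?thesis by simp
    qed
    then have "g \<otimes> (b \<otimes> c) = \<zero>"
      using indep[of "\<one> \<ominus> a \<otimes> c" "b \<otimes> c"] ab(1,2) c(1) by simp
    moreover have "c \<noteq> \<zero>" using c(2) d(1) f(2) by auto
    ultimately have "b = \<zero>"
      using integral[OF g(1) m_closed[OF ab(2) c(1)]] integral[OF ab(2) c(1)] g(2) by blast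
    then have dfa: "d = f \<otimes> a" using ab(1,3) f(1) g(1) by (metis m_closed r_null r_zero)
    have "f \<otimes> (a \<otimes> e) = d \<otimes> e" unfolding dfa by (rule m_assoc[symmetric]) (use e f ab in auto)
    then have "f \<otimes> (a \<otimes> e) = g \<otimes> \<one>" using e(2) g(1) by simp
    then have "f \<otimes> (a \<otimes> e) = \<zero>" using indep[of "a \<otimes> e" \<one>] ab(1) e(1) by simp
    then show False using \<open>f \<otimes> (a \<otimes> e) = g \<otimes> \<one>\<close> g by simp
  qed
  then show thesis using that f g by (metis r_null)
qed

section \<open>Division with remainder for skew polynomials\<close>

locale skew_polynomials = field K for K (structure) +
  fixes \<phi> :: "'a \<Rightarrow> 'a"
  assumes \<phi>_hom: "\<phi> \<in> ring_hom K K"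
begin

abbreviation P :: "(nat \<Rightarrow> 'a) ring" where "P \<equiv> skew_poly_ring K \<phi>"

lemma P_simps:
  "carrier P = up K"
  "f \<oplus>\<^bsub>P\<^esub> g = (\<lambda>i. f i \<oplus> g i)"
  "\<zero>\<^bsub>P\<^esub> = (\<lambda>i. \<zero>)"
  "(f \<otimes>\<^bsub>P\<^esub> g) n = (\<Oplus>i\<in>{..n}. (\<phi> ^^ (n - i)) (f i) \<otimes> g (n - i))"
  by (simp_all add: skew_poly_ring_def)

sublocale P: ring P
  by (rule skew_poly_ring_is_ring[OF field_axioms \<phi>_hom])

lemma funpow_hom: "\<phi> ^^ n \<in> ring_hom K K"
  by (induction n)
    (use \<phi>_hom in \<open>auto intro!: ring_hom_memI simp: ring_hom_closed ring_hom_mult ring_hom_add ring_hom_one\<close>)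

lemma funpow_closed [simp]: "a \<in> carrier K \<Longrightarrow> (\<phi> ^^ n) a \<in> carrier K"
  using ring_hom_closed[OF funpow_hom] .

lemma funpow_zero [simp]: "(\<phi> ^^ n) \<zero> = \<zero>"
  using ring_hom_zero[OF funpow_hom ring_axioms ring_axioms] .

lemma funpow_one [simp]: "(\<phi> ^^ n) \<one> = \<one>"
  using ring_hom_one[OF funpow_hom] .

text \<open>A non-zero a is a unit, and a unital homomorphism sends it to a unit. This injectivity
  keeps leading coefficients of products non-zero.\<close>

lemma funpow_eq_zero_iff: "a \<in> carrier K \<Longrightarrow> (\<phi> ^^ n) a = \<zero> \<longleftrightarrow> a = \<zero>"
proof
  assume a: "a \<in> carrier K" and 0: "(\<phi> ^^ n) a = \<zero>"
  show "a = \<zero>"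
  proof (rule ccontr)
    assume "a \<noteq> \<zero>"
    then have "a \<in> Units K" using a field_Units by blast
    then have "(\<phi> ^^ n) a \<otimes> (\<phi> ^^ n) (inv a) = \<one>"
      using ring_hom_mult[OF funpow_hom, of a "inv a" n] a by simp
    then show False using 0 \<open>a \<in> Units K\<close> by simp
  qed
qed simp

lemma coeff_closed [simp]: "f \<in> up K \<Longrightarrow> f n \<in> carrier K"
  by (rule mem_upD)

lemma upI:
  assumes "\<And>n. f n \<in> carrier K" "\<And>i. i \<ge> n \<Longrightarrow> f i = \<zero>"
  shows "f \<in> up K"
  using assms by (intro mem_upI) (auto intro!: exI[of _ n] bound.intro)

lemma up_obtain_bound:
  assumes "f \<in> up K"
  obtains n where "\<And>i. i \<ge> n \<Longrightarrow> f i = \<zero>"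
  using bound_upD[OF assms] by (metis bound.bound Suc_le_lessD)

lemma up_obtain_degree:
  assumes "f \<in> up K" "f \<noteq> (\<lambda>i. \<zero>)"
  obtains n where "f n \<noteq> \<zero>" "\<And>i. i > n \<Longrightarrow> f i = \<zero>"
proof -
  obtain b where b: "\<And>i. i \<ge> b \<Longrightarrow> f i = \<zero>" using up_obtain_bound[OF assms(1)] by blast
  obtain k where k: "f k \<noteq> \<zero>" using assms(2) by auto
  have "\<exists>n. f n \<noteq> \<zero> \<and> (\<forall>i. f i \<noteq> \<zero> \<longrightarrow> i \<le> n)"
    by (rule ex_has_greatest_nat[of "\<lambda>n. f n \<noteq> \<zero>" k id b, simplified]) (use b k not_less in \<open>auto intro: ccontr\<close>)
  then show thesis using that by (metis not_less)
qed

lemma skew_monom_closed [simp]: "a \<in> carrier K \<Longrightarrow> skew_monom K a n \<in> up K"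
  by (rule upI[of _ "Suc n"]) (auto simp: skew_monom_def)

text \<open>The leading coefficient of f (t^k c) is \<phi>^k(f_m) c and can be given any value
  through c alone. Division with remainder in \<open>P_right_principal\<close> rests on
  this.\<close>

lemma mult_monom:
  assumes "f \<in> up K" "c \<in> carrier K"
  shows "(f \<otimes>\<^bsub>P\<^esub> skew_monom K c k) n = (if k \<le> n then (\<phi> ^^ k) (f (n - k)) \<otimes> c else \<zero>)"
proof (cases "k \<le> n")
  case True
  have "(f \<otimes>\<^bsub>P\<^esub> skew_monom K c k) n =
      (\<Oplus>i\<in>{..n}. if n - k = i then (\<phi> ^^ (n - i)) (f i) \<otimes> c else \<zero>)"
    unfolding P_simps skew_monom_def using assms True by (intro finsum_cong') auto
  also have "\<dots> = (\<phi> ^^ (n - (n - k))) (f (n - k)) \<otimes> c"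
    using assms by (subst finsum_singleton) auto
  finally show ?thesis using True by simp
next
  case False
  then have "(f \<otimes>\<^bsub>P\<^esub> skew_monom K c k) n = (\<Oplus>i\<in>{..n}. \<zero>)"
    unfolding P_simps skew_monom_def using assms by (intro finsum_cong') auto
  then show ?thesis using False by simp
qed

text \<open>Multiplication by t from the left shifts without a twist, because the powers of \<phi>
  are applied only to the coefficient 1 of t.\<close>

lemma t_mult:
  assumes "f \<in> up K"
  shows "skew_monom K \<one> 1 \<otimes>\<^bsub>P\<^esub> f = (\<lambda>n. if n = 0 then \<zero> else f (n - 1))"
proof
  fix n
  show "(skew_monom K \<one> 1 \<otimes>\<^bsub>P\<^esub> f) n = (if n = 0 then \<zero> else f (n - 1))"
  proof (cases "n = 0")
    case True
    then show ?thesis using assms by (simp add: P_simps skew_monom_def)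
  next
    case False
    have "(skew_monom K \<one> 1 \<otimes>\<^bsub>P\<^esub> f) n = (\<Oplus>i\<in>{..n}. if 1 = i then f (n - i) else \<zero>)"
      unfolding P_simps skew_monom_def using assms by (intro finsum_cong') auto
    also have "\<dots> = f (n - 1)"
      using assms False by (subst finsum_singleton) auto
    finally show ?thesis using False by simp
  qed
qed

lemma shift_closed: "f \<in> up K \<Longrightarrow> (\<lambda>n. f (Suc n)) \<in> up K"
  by (metis (mono_tags, lifting) coeff_closed le_SucI upI up_obtain_bound)

text \<open>This is the recursion behind the inductions on scalars: on a right module it becomes x.f
  = x.f_0 + (x.t).g with g the shifted polynomial, see \<open>smult_split\<close>.\<close>

lemma split_constant_coeff:
  assumes "f \<in> up K"
  shows "f = skew_monom K (f 0) 0 \<oplus>\<^bsub>P\<^esub> (skew_monom K \<one> 1 \<otimes>\<^bsub>P\<^esub> (\<lambda>n. f (Suc n)))"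
  unfolding t_mult[OF shift_closed[OF assms]] P_simps
  using assms by (auto simp: fun_eq_iff skew_monom_def)

text \<open>If m and n are the degrees, the coefficient at m + n is \<phi>^n(f_m) g_n, which is
  non-zero because \<phi>^n is injective.\<close>

lemma P_integral:
  assumes f: "f \<in> up K" "f \<noteq> (\<lambda>i. \<zero>)" and g: "g \<in> up K" "g \<noteq> (\<lambda>i. \<zero>)"
  shows "f \<otimes>\<^bsub>P\<^esub> g \<noteq> (\<lambda>i. \<zero>)"
proof -
  obtain m where m: "f m \<noteq> \<zero>" "\<And>i. i > m \<Longrightarrow> f i = \<zero>" using up_obtain_degree[OF f] by blast
  obtain n where n: "g n \<noteq> \<zero>" "\<And>i. i > n \<Longrightarrow> g i = \<zero>" using up_obtain_degree[OF g] by blast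
  have "(f \<otimes>\<^bsub>P\<^esub> g) (m + n) =
      (\<Oplus>i\<in>{..m + n}. if m = i then (\<phi> ^^ (m + n - i)) (f i) \<otimes> g (m + n - i) else \<zero>)"
    unfolding P_simps
  proof (intro finsum_cong')
    fix i assume "i \<in> {..m + n}"
    then consider "i = m" | "i > m" | "m + n - i > n" by fastforce
    then show "(\<phi> ^^ (m + n - i)) (f i) \<otimes> g (m + n - i)
        = (if m = i then (\<phi> ^^ (m + n - i)) (f i) \<otimes> g (m + n - i) else \<zero>)"
      by cases (use f g m n in auto)
  qed (use f g in auto)
  also have "\<dots> = (\<phi> ^^ n) (f m) \<otimes> g n"
    using f g by (subst finsum_singleton) auto
  also have "\<dots> \<noteq> \<zero>"
    using f g m n integral[of "(\<phi> ^^ n) (f m)" "g n"] by (auto simp: funpow_eq_zero_iff)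
  finally show ?thesis by auto
qed

lemma P_right_principal:
  assumes I: "additive_subgroup I P"
    and absorb: "\<And>a r. \<lbrakk>a \<in> I; r \<in> up K\<rbrakk> \<Longrightarrow> a \<otimes>\<^bsub>P\<^esub> r \<in> I"
  shows "\<exists>s\<in>up K. I = (\<lambda>r. s \<otimes>\<^bsub>P\<^esub> r) ` up K"
proof (cases "I \<subseteq> {\<zero>\<^bsub>P\<^esub>}")
  case True
  then have "I = (\<lambda>r. \<zero>\<^bsub>P\<^esub> \<otimes>\<^bsub>P\<^esub> r) ` up K"
    using additive_subgroup.zero_closed[OF I] P.zero_closed by (auto simp: P.l_null[unfolded P_simps(1)] P_simps(1))
  then show ?thesis using P.zero_closed unfolding P_simps(1) by blast
next
  case False
  interpret I: additive_subgroup I P by fact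
  have sub: "f \<in> up K" if "f \<in> I" for f using that I.a_subset by (auto simp: P_simps(1))
  \<comment> \<open>\<open>lo n\<close> bounds the degree by n instead of fixing it; at the least
    such n the degree is exactly n, which \<open>gm\<close> verifies.\<close>
  define lo where "lo n \<longleftrightarrow> (\<exists>g\<in>I. g \<noteq> (\<lambda>i. \<zero>) \<and> (\<forall>i>n. g i = \<zero>))" for n
  obtain f where "f \<in> I" "f \<noteq> (\<lambda>i. \<zero>)" using False by (auto simp: P_simps(3))
  then have "\<exists>n. lo n" unfolding lo_def using up_obtain_degree[OF sub] by metis
  then obtain m where m: "lo m" "\<And>k. k < m \<Longrightarrow> \<not> lo k" by (metis exists_least_iff)
  then obtain g where g: "g \<in> I" "g \<noteq> (\<lambda>i. \<zero>)" "\<And>i. i > m \<Longrightarrow> g i = \<zero>" unfolding lo_def by blast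
  have gm: "g m \<noteq> \<zero>"
  proof
    assume "g m = \<zero>"
    obtain d where d: "g d \<noteq> \<zero>" "\<And>i. i > d \<Longrightarrow> g i = \<zero>" using up_obtain_degree[OF sub[OF g(1)] g(2)] by blast
    then have "d < m" using g \<open>g m = \<zero>\<close> by (metis linorder_neqE_nat)
    moreover have "lo d" unfolding lo_def using g d by blast
    ultimately show False using m by blast
  qed
  note gup = sub[OF g(1)]
  \<comment> \<open>Here n is a strict bound on the support, so that the zero polynomial is the base
    case. For n < m the minimality of m forces f = 0.\<close>
  have gen: "f \<in> (\<lambda>r. g \<otimes>\<^bsub>P\<^esub> r) ` up K" if "f \<in> I" "\<And>i. i \<ge> n \<Longrightarrow> f i = \<zero>" for f n
    using that
  proof (induction n arbitrary: f)
    case 0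
    then have "f = g \<otimes>\<^bsub>P\<^esub> \<zero>\<^bsub>P\<^esub>" using P.r_null[of g] gup by (auto simp: P_simps(1,3))
    then show ?case using P.zero_closed by (auto simp: P_simps(1))
  next
    case (Suc n)
    show ?case
    proof (cases "n < m")
      case True
      have "f = (\<lambda>i. \<zero>)"
        using m(2)[OF True] Suc.prems unfolding lo_def by (metis Suc_leI)
      then have "f = g \<otimes>\<^bsub>P\<^esub> \<zero>\<^bsub>P\<^esub>" using P.r_null[of g] gup by (auto simp: P_simps(1,3))
      then show ?thesis using P.zero_closed by (auto simp: P_simps(1))
    next
      case False
      \<comment> \<open>b is the coefficient of g t^(n-m) at n. Hence g q agrees with f at n, and
        both vanish above n, so h = f - g q has a smaller bound.\<close>
      define b where "b = (\<phi> ^^ (n - m)) (g m)"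
      have b: "b \<in> Units K" unfolding b_def using gup gm by (auto simp: field_Units funpow_eq_zero_iff)
      define q where "q = skew_monom K (inv b \<otimes> f n) (n - m)"
      have fup: "f \<in> up K" using Suc.prems sub by blast
      have q: "q \<in> up K" unfolding q_def using b fup by auto
      define h where "h = f \<ominus>\<^bsub>P\<^esub> g \<otimes>\<^bsub>P\<^esub> q"
      have gq: "g \<otimes>\<^bsub>P\<^esub> q \<in> I" using absorb g q by blast
      then have h: "h \<in> I" unfolding h_def P.minus_eq using Suc.prems by simp
      have gqi: "(g \<otimes>\<^bsub>P\<^esub> q) i = f i" if "i \<ge> n" for i
      proof (cases "i = n")
        case True
        then show ?thesis unfolding q_def using mult_monom[OF gup] b fup False gup
          by (simp add: b_def[symmetric] Units_closed flip: m_assoc)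
      next
        case i: False
        then have "i - (n - m) > m" "f i = \<zero>" using that False Suc.prems by auto
        then show ?thesis unfolding q_def using mult_monom[OF gup] b fup g(3) by auto
      qed
      have fhq: "f = h \<oplus>\<^bsub>P\<^esub> g \<otimes>\<^bsub>P\<^esub> q"
      proof -
        have "f \<in> carrier P" "g \<otimes>\<^bsub>P\<^esub> q \<in> carrier P" using fup sub[OF gq] by (auto simp: P_simps(1))
        then show ?thesis
          unfolding h_def by (simp add: P.minus_eq P.a_assoc P.l_neg)
      qed
      have "h i = \<zero>" if "i \<ge> n" for i
      proof -
        have "f i = h i \<oplus> (g \<otimes>\<^bsub>P\<^esub> q) i" by (subst fhq) (simp add: P_simps(2))
        then have "f i = h i \<oplus> f i" using gqi[OF that] by simp
        then show ?thesis using sub[OF h] fup by (metis add.r_cancel_one coeff_closed)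
      qed
      then obtain r where r: "r \<in> up K" "h = g \<otimes>\<^bsub>P\<^esub> r" using Suc.IH[OF h] by blast
      have "f = g \<otimes>\<^bsub>P\<^esub> (r \<oplus>\<^bsub>P\<^esub> q)"
        using fhq r q gup P.r_distr[of r q g] by (simp add: P_simps(1))
      moreover have "r \<oplus>\<^bsub>P\<^esub> q \<in> up K" using P.a_closed r q by (simp add: P_simps(1))
      ultimately show ?thesis by blast
    qed
  qed
  have "I \<subseteq> (\<lambda>r. g \<otimes>\<^bsub>P\<^esub> r) ` up K"
    using gen sub up_obtain_bound by (metis subsetI)
  moreover have "(\<lambda>r. g \<otimes>\<^bsub>P\<^esub> r) ` up K \<subseteq> I" using absorb g by auto
  ultimately show ?thesis using gup by blast
qed

sublocale P: right_pid P
proof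
  show "\<one>\<^bsub>P\<^esub> \<noteq> \<zero>\<^bsub>P\<^esub>" by (auto simp: skew_poly_ring_def fun_eq_iff)
qed (use P_integral P_right_principal in \<open>auto simp: P_simps(1,3)\<close>)

end

section \<open>Right modules\<close>

text \<open>The rules on nested restrictions, cosets and sums allow results obtained inside
  \<open>restrict_module M ge\<close> to be read as statements about \<open>M\<close>.\<close>

lemma restrict_module_simps [simp]:
  "carrier (restrict_module M N) = N"
  "zero (restrict_module M N) = zero M"
  "add (restrict_module M N) = add M"
  "smult (restrict_module M N) = smult M"
  "restrict_module (restrict_module M B) N = restrict_module M N"
  "N +>\<^bsub>restrict_module M B\<^esub> x = N +>\<^bsub>M\<^esub> x"
  "A <+>\<^bsub>restrict_module M B\<^esub> N = A <+>\<^bsub>M\<^esub> N"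
  by (simp_all add: restrict_module_def a_r_coset_def' set_add_def')

lemma set_add_iff: "x \<in> A <+>\<^bsub>M\<^esub> B \<longleftrightarrow> (\<exists>a\<in>A. \<exists>b\<in>B. x = a \<oplus>\<^bsub>M\<^esub> b)"
  by (auto simp: set_add_def')

context abelian_group
begin

lemma diff_eq_zero_iff:
  assumes "x \<in> carrier G" "y \<in> carrier G"
  shows "x \<ominus> y = \<zero> \<longleftrightarrow> x = y"
proof
  assume "x \<ominus> y = \<zero>"
  then show "x = y"
    using assms unfolding minus_eq by (metis add.inv_closed add.inv_equality add.inv_inv)
qed (use assms in \<open>simp add: minus_eq r_neg\<close>)

lemma diff_add_cancel: "\<lbrakk>x \<in> carrier G; y \<in> carrier G\<rbrakk> \<Longrightarrow> (x \<ominus> y) \<oplus> y = x"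
  by (simp add: minus_eq a_assoc l_neg)

lemma add_diff_cancel: "\<lbrakk>x \<in> carrier G; y \<in> carrier G\<rbrakk> \<Longrightarrow> (x \<oplus> y) \<ominus> y = x"
  by (simp add: minus_eq a_assoc r_neg)

end

context right_module
begin

declare smult_closed [simp, intro] smult_one [simp]

lemma smult_r_null [simp]:
  assumes "r \<in> carrier R"
  shows "r \<odot>\<^bsub>M\<^esub> \<zero>\<^bsub>M\<^esub> = \<zero>\<^bsub>M\<^esub>"
  using smult_add_vector[of r "\<zero>\<^bsub>M\<^esub>" "\<zero>\<^bsub>M\<^esub>"] assms by (simp add: M.add.l_cancel_one')

lemma smult_l_null [simp]:
  assumes "x \<in> carrier M"
  shows "\<zero>\<^bsub>R\<^esub> \<odot>\<^bsub>M\<^esub> x = \<zero>\<^bsub>M\<^esub>"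
  using smult_add_scalar[of "\<zero>\<^bsub>R\<^esub>" "\<zero>\<^bsub>R\<^esub>" x] assms by (simp add: M.add.l_cancel_one')

lemma smult_r_minus:
  assumes "r \<in> carrier R" "x \<in> carrier M"
  shows "r \<odot>\<^bsub>M\<^esub> (\<ominus>\<^bsub>M\<^esub> x) = \<ominus>\<^bsub>M\<^esub> (r \<odot>\<^bsub>M\<^esub> x)"
proof -
  have "r \<odot>\<^bsub>M\<^esub> (\<ominus>\<^bsub>M\<^esub> x) \<oplus>\<^bsub>M\<^esub> r \<odot>\<^bsub>M\<^esub> x = \<zero>\<^bsub>M\<^esub>"
    using assms by (simp add: M.l_neg flip: smult_add_vector)
  then show ?thesis using assms by (metis M.minus_equality M.a_inv_closed smult_closed)
qed

lemma smult_diff: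
  assumes "r \<in> carrier R" "x \<in> carrier M" "y \<in> carrier M"
  shows "r \<odot>\<^bsub>M\<^esub> (x \<ominus>\<^bsub>M\<^esub> y) = r \<odot>\<^bsub>M\<^esub> x \<ominus>\<^bsub>M\<^esub> r \<odot>\<^bsub>M\<^esub> y"
  using assms by (simp add: M.minus_eq smult_add_vector smult_r_minus)

lemma smult_l_minus:
  assumes "r \<in> carrier R" "x \<in> carrier M"
  shows "(\<ominus>\<^bsub>R\<^esub> r) \<odot>\<^bsub>M\<^esub> x = \<ominus>\<^bsub>M\<^esub> (r \<odot>\<^bsub>M\<^esub> x)"
proof -
  have "(\<ominus>\<^bsub>R\<^esub> r) \<odot>\<^bsub>M\<^esub> x \<oplus>\<^bsub>M\<^esub> r \<odot>\<^bsub>M\<^esub> x = \<zero>\<^bsub>M\<^esub>"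
    using assms by (simp add: R.l_neg flip: smult_add_scalar)
  then show ?thesis using assms by (metis M.minus_equality R.a_inv_closed smult_closed)
qed

text \<open>Negatives are multiples by the scalar -1, so closure under them follows.\<close>

lemma submoduleI:
  assumes "N \<subseteq> carrier M" "\<zero>\<^bsub>M\<^esub> \<in> N"
    and "\<And>x y. \<lbrakk>x \<in> N; y \<in> N\<rbrakk> \<Longrightarrow> x \<oplus>\<^bsub>M\<^esub> y \<in> N"
    and "\<And>r x. \<lbrakk>r \<in> carrier R; x \<in> N\<rbrakk> \<Longrightarrow> r \<odot>\<^bsub>M\<^esub> x \<in> N"
  shows "submodule N R M"
proof -
  have "\<ominus>\<^bsub>M\<^esub> x \<in> N" if "x \<in> N" for x
  proof -
    have "(\<ominus>\<^bsub>R\<^esub> \<one>\<^bsub>R\<^esub>) \<odot>\<^bsub>M\<^esub> x = \<ominus>\<^bsub>M\<^esub> x" using that assms(1) smult_l_minus[of "\<one>\<^bsub>R\<^esub>" x] by auto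
    then show ?thesis using assms(4)[of "\<ominus>\<^bsub>R\<^esub> \<one>\<^bsub>R\<^esub>" x] that by simp
  qed
  then have "subgroup N (add_monoid M)"
    using assms by (intro M.add.subgroupI) auto
  then show ?thesis
    using assms(4) by (intro submodule.intro submodule_axioms.intro)
qed

lemma submoduleD:
  assumes "submodule N R M"
  shows "N \<subseteq> carrier M"
    and "x \<in> N \<Longrightarrow> x \<in> carrier M"
    and "\<zero>\<^bsub>M\<^esub> \<in> N"
    and "\<lbrakk>x \<in> N; y \<in> N\<rbrakk> \<Longrightarrow> x \<oplus>\<^bsub>M\<^esub> y \<in> N"
    and "x \<in> N \<Longrightarrow> \<ominus>\<^bsub>M\<^esub> x \<in> N"
    and "\<lbrakk>x \<in> N; y \<in> N\<rbrakk> \<Longrightarrow> x \<ominus>\<^bsub>M\<^esub> y \<in> N"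
    and "\<lbrakk>r \<in> carrier R; x \<in> N\<rbrakk> \<Longrightarrow> r \<odot>\<^bsub>M\<^esub> x \<in> N"
proof -
  interpret N: submodule N R M by fact
  interpret N: additive_subgroup N M by (rule additive_subgroupI) (rule N.subgroup_axioms)
  show "N \<subseteq> carrier M" using N.a_subset .
  show "x \<in> N \<Longrightarrow> x \<in> carrier M" using N.a_subset by blast
  show "\<zero>\<^bsub>M\<^esub> \<in> N" by simp
  show "\<lbrakk>x \<in> N; y \<in> N\<rbrakk> \<Longrightarrow> x \<oplus>\<^bsub>M\<^esub> y \<in> N" by simp
  show "x \<in> N \<Longrightarrow> \<ominus>\<^bsub>M\<^esub> x \<in> N" by simp
  show "\<lbrakk>x \<in> N; y \<in> N\<rbrakk> \<Longrightarrow> x \<ominus>\<^bsub>M\<^esub> y \<in> N" by (simp add: M.minus_eq)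
  show "\<lbrakk>r \<in> carrier R; x \<in> N\<rbrakk> \<Longrightarrow> r \<odot>\<^bsub>M\<^esub> x \<in> N" by (rule N.smult_closed)
qed

lemma submodule_abelian_subgroup:
  assumes "submodule N R M"
  shows "abelian_subgroup N M"
proof -
  interpret N: submodule N R M by fact
  show ?thesis
    by (rule abelian_subgroupI2[OF M.a_comm_group N.subgroup_axioms])
qed

lemma submodule_sum:
  assumes A: "submodule A R M" and B: "submodule B R M"
  shows "submodule (A <+>\<^bsub>M\<^esub> B) R M"
proof (rule submoduleI)
  show "A <+>\<^bsub>M\<^esub> B \<subseteq> carrier M"
    using submoduleD(2)[OF A] submoduleD(2)[OF B] by (auto simp: set_add_iff)
  show "\<zero>\<^bsub>M\<^esub> \<in> A <+>\<^bsub>M\<^esub> B"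
    unfolding set_add_iff using submoduleD(3)[OF A] submoduleD(3)[OF B]
    by (intro bexI[of _ "\<zero>\<^bsub>M\<^esub>"]) auto
next
  fix x y assume "x \<in> A <+>\<^bsub>M\<^esub> B" "y \<in> A <+>\<^bsub>M\<^esub> B"
  then obtain a b c d where ab: "a \<in> A" "b \<in> B" "x = a \<oplus>\<^bsub>M\<^esub> b"
    and cd: "c \<in> A" "d \<in> B" "y = c \<oplus>\<^bsub>M\<^esub> d" by (auto simp: set_add_iff)
  then have "x \<oplus>\<^bsub>M\<^esub> y = (a \<oplus>\<^bsub>M\<^esub> c) \<oplus>\<^bsub>M\<^esub> (b \<oplus>\<^bsub>M\<^esub> d)"
    using submoduleD(2)[OF A] submoduleD(2)[OF B] by (simp add: M.a_ac)
  then show "x \<oplus>\<^bsub>M\<^esub> y \<in> A <+>\<^bsub>M\<^esub> B"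
    unfolding set_add_iff using ab cd submoduleD(4)[OF A] submoduleD(4)[OF B] by blast
next
  fix r x assume r: "r \<in> carrier R" and "x \<in> A <+>\<^bsub>M\<^esub> B"
  then obtain a b where ab: "a \<in> A" "b \<in> B" "x = a \<oplus>\<^bsub>M\<^esub> b" by (auto simp: set_add_iff)
  then have "r \<odot>\<^bsub>M\<^esub> x = r \<odot>\<^bsub>M\<^esub> a \<oplus>\<^bsub>M\<^esub> r \<odot>\<^bsub>M\<^esub> b"
    using r submoduleD(2)[OF A] submoduleD(2)[OF B] by (simp add: smult_add_vector)
  then show "r \<odot>\<^bsub>M\<^esub> x \<in> A <+>\<^bsub>M\<^esub> B"
    unfolding set_add_iff using r ab submoduleD(7)[OF A] submoduleD(7)[OF B] by blast
qed

lemma subset_sum: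
  assumes A: "submodule A R M" and B: "submodule B R M"
  shows "A \<subseteq> A <+>\<^bsub>M\<^esub> B" "B \<subseteq> A <+>\<^bsub>M\<^esub> B"
proof -
  show "A \<subseteq> A <+>\<^bsub>M\<^esub> B"
    using submoduleD(2,3)[OF A] submoduleD(2,3)[OF B] by (force simp: set_add_iff)
  show "B \<subseteq> A <+>\<^bsub>M\<^esub> B"
    using submoduleD(2,3)[OF A] submoduleD(2,3)[OF B] by (force simp: set_add_iff)
qed

lemma cyclic_submodule:
  assumes "x \<in> carrier M"
  shows "submodule ((\<lambda>r. r \<odot>\<^bsub>M\<^esub> x) ` carrier R) R M"
proof (rule submoduleI)
  show "\<zero>\<^bsub>M\<^esub> \<in> (\<lambda>r. r \<odot>\<^bsub>M\<^esub> x) ` carrier R"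
    using assms by (intro image_eqI[of _ _ "\<zero>\<^bsub>R\<^esub>"]) auto
next
  fix y z assume "y \<in> (\<lambda>r. r \<odot>\<^bsub>M\<^esub> x) ` carrier R" "z \<in> (\<lambda>r. r \<odot>\<^bsub>M\<^esub> x) ` carrier R"
  then show "y \<oplus>\<^bsub>M\<^esub> z \<in> (\<lambda>r. r \<odot>\<^bsub>M\<^esub> x) ` carrier R"
    using assms by (auto simp flip: smult_add_scalar)
next
  fix r y assume "r \<in> carrier R" "y \<in> (\<lambda>r. r \<odot>\<^bsub>M\<^esub> x) ` carrier R"
  then show "r \<odot>\<^bsub>M\<^esub> y \<in> (\<lambda>r. r \<odot>\<^bsub>M\<^esub> x) ` carrier R"
    using assms by (auto simp flip: smult_assoc)
qed (use assms in auto)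

lemma restrict_right_module:
  assumes N: "submodule N R M"
  shows "right_module R (restrict_module M N)"
proof -
  note D = submoduleD[OF N]
  have "abelian_group (restrict_module M N)"
  proof (rule abelian_groupI)
    fix x assume "x \<in> carrier (restrict_module M N)"
    then show "\<exists>y\<in>carrier (restrict_module M N). y \<oplus>\<^bsub>restrict_module M N\<^esub> x = \<zero>\<^bsub>restrict_module M N\<^esub>"
      using D by (intro bexI[of _ "\<ominus>\<^bsub>M\<^esub> x"]) (auto simp: M.l_neg)
  qed (use D in \<open>auto simp: M.a_ac\<close>)
  then show ?thesis
    using D R.ring_axioms
    by (intro right_module.intro right_module_axioms.intro)
      (auto simp: smult_add_scalar smult_add_vector smult_assoc)
qed

text \<open>The inverse in a restricted record is sought inside N; it agrees with the one in M
  because N is closed under negation.\<close>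

lemma a_minus_restrict [simp]:
  assumes N: "submodule N R M" and x: "x \<in> N" "y \<in> N"
  shows "x \<ominus>\<^bsub>restrict_module M N\<^esub> y = x \<ominus>\<^bsub>M\<^esub> y"
proof -
  interpret N: right_module R "restrict_module M N" by (rule restrict_right_module) fact
  have "\<ominus>\<^bsub>restrict_module M N\<^esub> y = \<ominus>\<^bsub>M\<^esub> y"
    using submoduleD[OF N] x by (intro N.M.minus_equality) (auto simp: M.l_neg)
  then show ?thesis by (simp add: a_minus_def)
qed

lemma submodule_restrict:
  assumes "submodule N R M" "submodule A R M" "A \<subseteq> N"
  shows "submodule A R (restrict_module M N)"
proof -
  interpret N: right_module R "restrict_module M N" by (rule restrict_right_module) fact
  show ?thesis using assms(3) submoduleD[OF assms(2)] by (intro N.submoduleI) auto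
qed

lemma submodule_of_restrict:
  assumes "submodule N R M" "submodule A R (restrict_module M N)"
  shows "submodule A R M" "A \<subseteq> N"
proof -
  interpret N: right_module R "restrict_module M N" by (rule restrict_right_module) fact
  show "A \<subseteq> N" using N.submoduleD(1)[OF assms(2)] by simp
  then show "submodule A R M"
    using submoduleD[OF assms(1)] N.submoduleD[OF assms(2)] by (intro submoduleI) auto
qed

subsection \<open>Quotients\<close>

lemma carrier_quotient: "carrier (quotient_module M N) = (\<lambda>x. N +>\<^bsub>M\<^esub> x) ` carrier M"
  by (auto simp: quotient_module_def A_RCOSETS_def')

lemma zero_quotient [simp]: "\<zero>\<^bsub>quotient_module M N\<^esub> = N"
  by (simp add: quotient_module_def)

lemma coset_closed [simp]: "x \<in> carrier M \<Longrightarrow> N +>\<^bsub>M\<^esub> x \<in> carrier (quotient_module M N)"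
  by (simp add: carrier_quotient)

lemma coset_eq_iff:
  assumes N: "submodule N R M" and x: "x \<in> carrier M" "y \<in> carrier M"
  shows "N +>\<^bsub>M\<^esub> x = N +>\<^bsub>M\<^esub> y \<longleftrightarrow> x \<ominus>\<^bsub>M\<^esub> y \<in> N"
proof -
  interpret N: abelian_subgroup N M by (rule submodule_abelian_subgroup) fact
  show ?thesis
    using N.a_rcos_module[OF x(2,1)] N.a_repr_independence'[OF _ x(2)] N.a_rcos_self[OF x(1)]
    unfolding M.minus_eq by metis
qed

lemma coset_eq_zero_iff:
  assumes N: "submodule N R M" and x: "x \<in> carrier M"
  shows "N +>\<^bsub>M\<^esub> x = N \<longleftrightarrow> x \<in> N"
  using coset_eq_iff[OF N x M.zero_closed] submoduleD(1)[OF N] x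
  by (simp add: M.minus_eq M.minus_equality[of "\<zero>\<^bsub>M\<^esub>" "\<zero>\<^bsub>M\<^esub>"])

lemma coset_add:
  assumes N: "submodule N R M" and x: "x \<in> carrier M" "y \<in> carrier M"
  shows "(N +>\<^bsub>M\<^esub> x) \<oplus>\<^bsub>quotient_module M N\<^esub> (N +>\<^bsub>M\<^esub> y) = N +>\<^bsub>M\<^esub> (x \<oplus>\<^bsub>M\<^esub> y)"
proof -
  interpret N: abelian_subgroup N M by (rule submodule_abelian_subgroup) fact
  show ?thesis using N.a_rcos_sum[OF x] by (simp add: quotient_module_def)
qed

text \<open>\<open>quotient_module\<close> takes the union over all representatives of a coset. They
  all contribute the same coset, since N is closed under scalars.\<close>

lemma coset_smult:
  assumes N: "submodule N R M" and r: "r \<in> carrier R" and x: "x \<in> carrier M"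
  shows "r \<odot>\<^bsub>quotient_module M N\<^esub> (N +>\<^bsub>M\<^esub> x) = N +>\<^bsub>M\<^esub> (r \<odot>\<^bsub>M\<^esub> x)"
proof -
  interpret N: abelian_subgroup N M by (rule submodule_abelian_subgroup) fact
  have "N +>\<^bsub>M\<^esub> (r \<odot>\<^bsub>M\<^esub> x') = N +>\<^bsub>M\<^esub> (r \<odot>\<^bsub>M\<^esub> x)" if x': "x' \<in> N +>\<^bsub>M\<^esub> x" for x'
  proof -
    have c: "x' \<in> carrier M" using N.a_elemrcos_carrier[OF x x'] .
    then have "x' \<ominus>\<^bsub>M\<^esub> x \<in> N" using N.a_rcos_module[OF x c] x' by (simp add: M.minus_eq)
    then have "r \<odot>\<^bsub>M\<^esub> x' \<ominus>\<^bsub>M\<^esub> r \<odot>\<^bsub>M\<^esub> x \<in> N"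
      using submoduleD(7)[OF N r] smult_diff[OF r c x] by metis
    then show ?thesis using coset_eq_iff[OF N] r c x by simp
  qed
  moreover have "x \<in> N +>\<^bsub>M\<^esub> x" using N.a_rcos_self[OF x] .
  ultimately have "(\<Union>x'\<in>N +>\<^bsub>M\<^esub> x. N +>\<^bsub>M\<^esub> (r \<odot>\<^bsub>M\<^esub> x')) = N +>\<^bsub>M\<^esub> (r \<odot>\<^bsub>M\<^esub> x)"
    by blast
  then show ?thesis by (simp add: quotient_module_def)
qed

lemma quotient_right_module:
  assumes N: "submodule N R M"
  shows "right_module R (quotient_module M N)"
proof -
  note q = coset_add[OF N] coset_smult[OF N]
  have z: "N = N +>\<^bsub>M\<^esub> \<zero>\<^bsub>M\<^esub>" using coset_eq_zero_iff[OF N M.zero_closed] submoduleD(3)[OF N] by simp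
  have "abelian_group (quotient_module M N)"
  proof (rule abelian_groupI)
    show "\<zero>\<^bsub>quotient_module M N\<^esub> \<in> carrier (quotient_module M N)"
      unfolding zero_quotient by (subst z) simp
  next
    fix X assume "X \<in> carrier (quotient_module M N)"
    then obtain x where x: "x \<in> carrier M" "X = N +>\<^bsub>M\<^esub> x" by (auto simp: carrier_quotient)
    show "\<zero>\<^bsub>quotient_module M N\<^esub> \<oplus>\<^bsub>quotient_module M N\<^esub> X = X"
      unfolding zero_quotient by (subst z) (use x in \<open>simp add: q\<close>)
    have "(N +>\<^bsub>M\<^esub> (\<ominus>\<^bsub>M\<^esub> x)) \<oplus>\<^bsub>quotient_module M N\<^esub> X = \<zero>\<^bsub>quotient_module M N\<^esub>"
      unfolding zero_quotient using z x by (simp add: q M.l_neg)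
    then show "\<exists>Y\<in>carrier (quotient_module M N). Y \<oplus>\<^bsub>quotient_module M N\<^esub> X = \<zero>\<^bsub>quotient_module M N\<^esub>"
      using x by (intro bexI[of _ "N +>\<^bsub>M\<^esub> (\<ominus>\<^bsub>M\<^esub> x)"]) auto
  qed (auto simp: carrier_quotient q M.a_ac)
  then show ?thesis
    using R.ring_axioms
    by (intro right_module.intro right_module_axioms.intro)
      (auto simp: carrier_quotient q smult_add_scalar smult_add_vector smult_assoc)
qed

lemma coset_map_hom:
  assumes N: "submodule N R M" and A: "submodule A R M"
  shows "(\<lambda>x. N +>\<^bsub>M\<^esub> x) \<in> right_module_hom R (restrict_module M A) (quotient_module M N)"
  using submoduleD(2)[OF A] coset_add[OF N] coset_smult[OF N] by (auto simp: right_module_hom_def)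

lemma coset_map_embedding:
  assumes N: "submodule N R M" and A: "submodule A R M" and int: "A \<inter> N \<subseteq> {\<zero>\<^bsub>M\<^esub>}"
  shows "(\<lambda>x. N +>\<^bsub>M\<^esub> x) \<in> right_module_embedding R (restrict_module M A) (quotient_module M N)"
proof -
  have "x = y" if "x \<in> A" "y \<in> A" "N +>\<^bsub>M\<^esub> x = N +>\<^bsub>M\<^esub> y" for x y
  proof -
    have c: "x \<in> carrier M" "y \<in> carrier M" using that submoduleD(2)[OF A] by auto
    have "x \<ominus>\<^bsub>M\<^esub> y \<in> N" "x \<ominus>\<^bsub>M\<^esub> y \<in> A"
      using that coset_eq_iff[OF N c] submoduleD(6)[OF A] by auto
    then have "x \<ominus>\<^bsub>M\<^esub> y = \<zero>\<^bsub>M\<^esub>" using int by blast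
    then show ?thesis using c M.diff_eq_zero_iff by blast
  qed
  then show ?thesis
    using coset_map_hom[OF N A] by (auto simp: right_module_embedding_def inj_on_def)
qed

text \<open>As A complements N, every coset of N contains exactly one element of A.\<close>

lemma coset_map_iso:
  assumes N: "submodule N R M" and A: "submodule A R M"
    and sum: "N <+>\<^bsub>M\<^esub> A = carrier M" and int: "N \<inter> A \<subseteq> {\<zero>\<^bsub>M\<^esub>}"
  shows "(\<lambda>x. N +>\<^bsub>M\<^esub> x) \<in> right_module_iso R (restrict_module M A) (quotient_module M N)"
proof -
  have "N +>\<^bsub>M\<^esub> x \<in> (\<lambda>x. N +>\<^bsub>M\<^esub> x) ` A" if "x \<in> carrier M" for x
  proof -
    obtain n a where na: "n \<in> N" "a \<in> A" "x = n \<oplus>\<^bsub>M\<^esub> a"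
    proof -
      have "x \<in> N <+>\<^bsub>M\<^esub> A" using \<open>x \<in> carrier M\<close> sum by simp
      then show thesis using that unfolding set_add_iff by blast
    qed
    then have "x \<ominus>\<^bsub>M\<^esub> a = n"
      using submoduleD(2)[OF N] submoduleD(2)[OF A] by (simp add: M.add_diff_cancel)
    then have "N +>\<^bsub>M\<^esub> x = N +>\<^bsub>M\<^esub> a"
      using coset_eq_iff[OF N that submoduleD(2)[OF A na(2)]] na by simp
    then show ?thesis using na by blast
  qed
  moreover have "(\<lambda>x. N +>\<^bsub>M\<^esub> x) \<in> right_module_embedding R (restrict_module M A) (quotient_module M N)"
    using coset_map_embedding[OF N A] int by blast
  ultimately show ?thesis
    using submoduleD(2)[OF A]
    by (auto simp: right_module_embedding_def right_module_iso_def bij_betw_def carrier_quotient)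
qed

section \<open>Torsion freeness and divisibility of quotients, images and complements\<close>

lemma torsion_freeI:
  assumes "\<And>r x. \<lbrakk>r \<in> carrier R; r \<noteq> \<zero>\<^bsub>R\<^esub>; x \<in> carrier M; r \<odot>\<^bsub>M\<^esub> x = \<zero>\<^bsub>M\<^esub>\<rbrakk> \<Longrightarrow> x = \<zero>\<^bsub>M\<^esub>"
    and "\<one>\<^bsub>R\<^esub> \<noteq> \<zero>\<^bsub>R\<^esub>"
  shows "torsion_free_module R M"
proof -
  have "torsion R M = {\<zero>\<^bsub>M\<^esub>}"
    using assms by (auto simp: torsion_def intro!: bexI[of _ "\<one>\<^bsub>R\<^esub>"])
  then show ?thesis
    using right_module_axioms by (intro torsion_free_module.intro torsion_free_module_axioms.intro)
qed

lemma torsion_free_quotient: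
  assumes N: "submodule N R M"
    and "\<And>r x. \<lbrakk>r \<in> carrier R; r \<noteq> \<zero>\<^bsub>R\<^esub>; x \<in> carrier M; r \<odot>\<^bsub>M\<^esub> x \<in> N\<rbrakk> \<Longrightarrow> x \<in> N"
    and "\<one>\<^bsub>R\<^esub> \<noteq> \<zero>\<^bsub>R\<^esub>"
  shows "torsion_free_module R (quotient_module M N)"
proof -
  interpret Q: right_module R "quotient_module M N" by (rule quotient_right_module) fact
  show ?thesis
  proof (rule Q.torsion_freeI)
    fix r X assume r: "r \<in> carrier R" "r \<noteq> \<zero>\<^bsub>R\<^esub>" and "X \<in> carrier (quotient_module M N)"
      and 0: "r \<odot>\<^bsub>quotient_module M N\<^esub> X = \<zero>\<^bsub>quotient_module M N\<^esub>"
    then obtain x where x: "x \<in> carrier M" "X = N +>\<^bsub>M\<^esub> x" by (auto simp: carrier_quotient)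
    then have "r \<odot>\<^bsub>M\<^esub> x \<in> N" using 0 r coset_eq_zero_iff[OF N] coset_smult[OF N] by simp
    then have "x \<in> N" using assms(2) r x by blast
    then show "X = \<zero>\<^bsub>quotient_module M N\<^esub>" using coset_eq_zero_iff[OF N] x by simp
  qed fact
qed

lemma divisibleI:
  assumes "\<And>r y. \<lbrakk>r \<in> carrier R; r \<noteq> \<zero>\<^bsub>R\<^esub>; y \<in> carrier M\<rbrakk> \<Longrightarrow> \<exists>x\<in>carrier M. r \<odot>\<^bsub>M\<^esub> x = y"
  shows "divisible_module R M"
proof (intro divisible_module.intro divisible_module_axioms.intro right_module_axioms)
  fix r assume r: "r \<in> carrier R - {\<zero>\<^bsub>R\<^esub>}"
  then have "carrier M \<subseteq> (\<lambda>x. r \<odot>\<^bsub>M\<^esub> x) ` carrier M"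
    using assms[of r] by (fastforce simp: image_iff)
  then show "(\<lambda>x. r \<odot>\<^bsub>M\<^esub> x) ` carrier M = carrier M" using r by auto
qed

end

lemma (in divisible_module) divisibleE:
  assumes "r \<in> carrier R" "r \<noteq> \<zero>\<^bsub>R\<^esub>" "y \<in> carrier M"
  obtains x where "x \<in> carrier M" "r \<odot>\<^bsub>M\<^esub> x = y"
  using divisible[of r] assms by (metis (no_types, lifting) DiffI imageE singletonD)

lemma (in divisible_module) divisible_quotient:
  assumes N: "submodule N R M"
  shows "divisible_module R (quotient_module M N)"
proof -
  interpret Q: right_module R "quotient_module M N" by (rule quotient_right_module) fact
  show ?thesis
  proof (rule Q.divisibleI)
    fix r Y assume r: "r \<in> carrier R" "r \<noteq> \<zero>\<^bsub>R\<^esub>" and "Y \<in> carrier (quotient_module M N)"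
    then obtain y where y: "y \<in> carrier M" "Y = N +>\<^bsub>M\<^esub> y" by (auto simp: carrier_quotient)
    obtain x where "x \<in> carrier M" "r \<odot>\<^bsub>M\<^esub> x = y" using divisibleE[OF r y(1)] .
    then show "\<exists>X\<in>carrier (quotient_module M N). r \<odot>\<^bsub>quotient_module M N\<^esub> X = Y"
      using y r coset_smult[OF N] by (intro bexI[of _ "N +>\<^bsub>M\<^esub> x"]) auto
  qed
qed

lemma (in divisible_module) divisible_image:
  assumes "right_module R N" and f: "f \<in> right_module_hom R M N"
  shows "submodule (f ` carrier M) R N" "divisible_module R (restrict_module N (f ` carrier M))"
proof -
  interpret N: right_module R N by fact
  have f: "\<And>x. x \<in> carrier M \<Longrightarrow> f x \<in> carrier N"
    "\<And>x y. \<lbrakk>x \<in> carrier M; y \<in> carrier M\<rbrakk> \<Longrightarrow> f (x \<oplus>\<^bsub>M\<^esub> y) = f x \<oplus>\<^bsub>N\<^esub> f y"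
    "\<And>r x. \<lbrakk>r \<in> carrier R; x \<in> carrier M\<rbrakk> \<Longrightarrow> f (r \<odot>\<^bsub>M\<^esub> x) = r \<odot>\<^bsub>N\<^esub> f x"
    using f by (auto simp: right_module_hom_def)
  have f0: "f \<zero>\<^bsub>M\<^esub> = \<zero>\<^bsub>N\<^esub>"
    using f(1)[of "\<zero>\<^bsub>M\<^esub>"] f(3)[of "\<zero>\<^bsub>R\<^esub>" "\<zero>\<^bsub>M\<^esub>"] by simp
  show sub: "submodule (f ` carrier M) R N"
  proof (rule N.submoduleI)
    show "\<zero>\<^bsub>N\<^esub> \<in> f ` carrier M" using f0 by (metis M.zero_closed image_eqI)
  next
    fix x y assume "x \<in> f ` carrier M" "y \<in> f ` carrier M"
    then show "x \<oplus>\<^bsub>N\<^esub> y \<in> f ` carrier M" by (auto simp: f(2)[symmetric])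
  next
    fix r x assume "r \<in> carrier R" "x \<in> f ` carrier M"
    then show "r \<odot>\<^bsub>N\<^esub> x \<in> f ` carrier M" by (auto simp: f(3)[symmetric])
  qed (use f(1) in auto)
  interpret I: right_module R "restrict_module N (f ` carrier M)"
    by (rule N.restrict_right_module) fact
  show "divisible_module R (restrict_module N (f ` carrier M))"
  proof (rule I.divisibleI)
    fix r y assume r: "r \<in> carrier R" "r \<noteq> \<zero>\<^bsub>R\<^esub>" and "y \<in> carrier (restrict_module N (f ` carrier M))"
    then obtain z where z: "z \<in> carrier M" "y = f z" by auto
    obtain x where "x \<in> carrier M" "r \<odot>\<^bsub>M\<^esub> x = z" using divisibleE[OF r z(1)] .
    then show "\<exists>x\<in>carrier (restrict_module N (f ` carrier M)). r \<odot>\<^bsub>restrict_module N (f ` carrier M)\<^esub> x = y"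
      using z f(3) r by auto
  qed
qed

text \<open>Let x.r = y in B with x = a + b. Then b.r = y as well, because a.r = y - b.r lies in
  both A and B and so is 0.\<close>

lemma (in divisible_module) divisible_complement:
  assumes A: "submodule A R M" and B: "submodule B R M"
    and sum: "A <+>\<^bsub>M\<^esub> B = carrier M" and int: "A \<inter> B \<subseteq> {\<zero>\<^bsub>M\<^esub>}"
  shows "divisible_module R (restrict_module M B)"
proof -
  interpret B: right_module R "restrict_module M B" by (rule restrict_right_module) fact
  show ?thesis
  proof (rule B.divisibleI)
    fix r y assume r: "r \<in> carrier R" "r \<noteq> \<zero>\<^bsub>R\<^esub>" and "y \<in> carrier (restrict_module M B)"
    then have y: "y \<in> B" "y \<in> carrier M" using submoduleD(2)[OF B] by auto
    obtain x where x: "x \<in> carrier M" "r \<odot>\<^bsub>M\<^esub> x = y" using divisibleE[OF r y(2)] .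
    have "x \<in> A <+>\<^bsub>M\<^esub> B" using x sum by simp
    then obtain a b where ab: "a \<in> A" "b \<in> B" "x = a \<oplus>\<^bsub>M\<^esub> b" unfolding set_add_iff by blast
    have c: "a \<in> carrier M" "b \<in> carrier M" using ab submoduleD(2)[OF A] submoduleD(2)[OF B] by auto
    have y_eq: "y = r \<odot>\<^bsub>M\<^esub> a \<oplus>\<^bsub>M\<^esub> r \<odot>\<^bsub>M\<^esub> b"
      using x(2) c r(1) unfolding ab(3) by (simp add: smult_add_vector)
    then have "r \<odot>\<^bsub>M\<^esub> a = y \<ominus>\<^bsub>M\<^esub> r \<odot>\<^bsub>M\<^esub> b" using c r(1) by (simp add: M.add_diff_cancel)
    then have "r \<odot>\<^bsub>M\<^esub> a \<in> B" using submoduleD(6,7)[OF B] y ab r by simp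
    then have "r \<odot>\<^bsub>M\<^esub> a = \<zero>\<^bsub>M\<^esub>" using submoduleD(7)[OF A r(1) ab(1)] int by blast
    then have "r \<odot>\<^bsub>M\<^esub> b = y" using y_eq c r by simp
    then show "\<exists>x\<in>carrier (restrict_module M B). r \<odot>\<^bsub>restrict_module M B\<^esub> x = y" using ab by auto
  qed
qed

section \<open>Modules over a right principal ideal domain\<close>

locale right_pid_module = right_module R M + right_pid R for R (structure) and M (structure)
begin

lemma restrict_right_pid_module:
  assumes "submodule N R M"
  shows "right_pid_module R (restrict_module M N)"
  using restrict_right_module[OF assms] right_pid_axioms by (rule right_pid_module.intro)

lemma quotient_right_pid_module:
  assumes "submodule N R M"
  shows "right_pid_module R (quotient_module M N)"
  using quotient_right_module[OF assms] right_pid_axioms by (rule right_pid_module.intro)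

lemma divisible_submoduleE:
  assumes "divisible_module R (restrict_module M A)" "r \<in> carrier R" "r \<noteq> \<zero>\<^bsub>R\<^esub>" "y \<in> A"
  obtains x where "x \<in> A" "r \<odot>\<^bsub>M\<^esub> x = y"
  using divisible_module.divisibleE[OF assms(1,2,3), of y] assms(4) by auto

lemma divisible_submoduleI:
  assumes "submodule A R M"
    and "\<And>r y. \<lbrakk>r \<in> carrier R; r \<noteq> \<zero>\<^bsub>R\<^esub>; y \<in> A\<rbrakk> \<Longrightarrow> \<exists>x\<in>A. r \<odot>\<^bsub>M\<^esub> x = y"
  shows "divisible_module R (restrict_module M A)"
  using right_module.divisibleI[OF restrict_right_module[OF assms(1)]] assms(2) by simp

lemma divisible_sum:
  assumes A: "submodule A R M" "divisible_module R (restrict_module M A)"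
    and B: "submodule B R M" "divisible_module R (restrict_module M B)"
  shows "divisible_module R (restrict_module M (A <+>\<^bsub>M\<^esub> B))"
proof (rule divisible_submoduleI)
  show "submodule (A <+>\<^bsub>M\<^esub> B) R M" using submodule_sum A B by blast
next
  fix r y assume r: "r \<in> carrier R" "r \<noteq> \<zero>\<^bsub>R\<^esub>" and "y \<in> A <+>\<^bsub>M\<^esub> B"
  then obtain a b where ab: "a \<in> A" "b \<in> B" "y = a \<oplus>\<^bsub>M\<^esub> b" by (auto simp: set_add_iff)
  obtain a' where a': "a' \<in> A" "r \<odot>\<^bsub>M\<^esub> a' = a" using divisible_submoduleE[OF A(2) r ab(1)] .
  obtain b' where b': "b' \<in> B" "r \<odot>\<^bsub>M\<^esub> b' = b" using divisible_submoduleE[OF B(2) r ab(2)] .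
  have "r \<odot>\<^bsub>M\<^esub> (a' \<oplus>\<^bsub>M\<^esub> b') = y"
    using a' b' ab r submoduleD(2)[OF A(1)] submoduleD(2)[OF B(1)] by (simp add: smult_add_vector)
  then show "\<exists>x\<in>A <+>\<^bsub>M\<^esub> B. r \<odot>\<^bsub>M\<^esub> x = y" using a' b' set_add_iff by metis
qed

text \<open>
  A divisible module over a right principal ideal domain is injective; this is Baer's argument,
  applied to a maximal submodule that meets \<open>A\<close> trivially.
\<close>

lemma divisible_direct_summand:
  assumes A: "submodule A R M" and div: "divisible_module R (restrict_module M A)"
  shows "direct_summand R M A"
proof -
  define \<B> where "\<B> = {B. submodule B R M \<and> A \<inter> B \<subseteq> {\<zero>\<^bsub>M\<^esub>}}"
  have "submodule {\<zero>\<^bsub>M\<^esub>} R M" by (rule submoduleI) auto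
  then have "\<B> \<noteq> {}" unfolding \<B>_def by blast
  moreover have "\<Union>C \<in> \<B>" if C: "C \<noteq> {}" "subset.chain \<B> C" for C
  proof -
    have sub: "submodule B R M" "A \<inter> B \<subseteq> {\<zero>\<^bsub>M\<^esub>}" if "B \<in> C" for B
      using that C(2) unfolding \<B>_def subset_chain_def by auto
    have "submodule (\<Union>C) R M"
    proof (rule submoduleI)
      show "\<Union>C \<subseteq> carrier M" using submoduleD(1) sub by blast
      show "\<zero>\<^bsub>M\<^esub> \<in> \<Union>C" using C(1) submoduleD(3) sub by blast
    next
      fix x y assume "x \<in> \<Union>C" "y \<in> \<Union>C"
      then obtain B where "B \<in> C" "x \<in> B" "y \<in> B"
        using C(2) unfolding subset_chain_def by blast
      then show "x \<oplus>\<^bsub>M\<^esub> y \<in> \<Union>C" using submoduleD(4) sub by blast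
    next
      fix r x assume "r \<in> carrier R" "x \<in> \<Union>C"
      then show "r \<odot>\<^bsub>M\<^esub> x \<in> \<Union>C" using submoduleD(7) sub by blast
    qed
    moreover have "A \<inter> \<Union>C \<subseteq> {\<zero>\<^bsub>M\<^esub>}" using sub by blast
    ultimately show ?thesis unfolding \<B>_def by blast
  qed
  ultimately have "\<exists>B\<in>\<B>. \<forall>X\<in>\<B>. B \<subseteq> X \<longrightarrow> X = B" by (rule subset_Zorn_nonempty)
  then obtain B where B_mem: "B \<in> \<B>" and B_max: "\<forall>X\<in>\<B>. B \<subseteq> X \<longrightarrow> X = B" ..
  have B: "submodule B R M" "A \<inter> B \<subseteq> {\<zero>\<^bsub>M\<^esub>}" using B_mem by (simp_all add: \<B>_def)
  have max: "X = B" if "submodule X R M" "A \<inter> X \<subseteq> {\<zero>\<^bsub>M\<^esub>}" "B \<subseteq> X" for X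
    using B_max that by (simp add: \<B>_def)
  define S where "S = A <+>\<^bsub>M\<^esub> B"
  have S: "submodule S R M" unfolding S_def using A B by (intro submodule_sum)
  have AS: "A \<subseteq> S" and BS: "B \<subseteq> S" unfolding S_def using subset_sum A B by blast+
  note DA = submoduleD[OF A] and DB = submoduleD[OF B(1)] and DS = submoduleD[OF S]
  \<comment> \<open>Maximality of \<open>B\<close>: it cannot be enlarged by an element whose multiples in \<open>S\<close> lie in \<open>B\<close>.\<close>
  have enlarge: "x \<in> S" if x: "x \<in> carrier M"
    and mult: "\<And>r. \<lbrakk>r \<in> carrier R; r \<odot>\<^bsub>M\<^esub> x \<in> S\<rbrakk> \<Longrightarrow> r \<odot>\<^bsub>M\<^esub> x \<in> B" for x
  proof -
    define X where "X = B <+>\<^bsub>M\<^esub> ((\<lambda>r. r \<odot>\<^bsub>M\<^esub> x) ` carrier R)"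
    have Xsub: "submodule X R M" and BX: "B \<subseteq> X" and "(\<lambda>r. r \<odot>\<^bsub>M\<^esub> x) ` carrier R \<subseteq> X"
      unfolding X_def using submodule_sum[OF B(1) cyclic_submodule[OF x]]
        subset_sum[OF B(1) cyclic_submodule[OF x]] by auto
    then have xX: "x \<in> X" using x by (metis R.one_closed image_subset_iff smult_one)
    have "z = \<zero>\<^bsub>M\<^esub>" if "z \<in> A" "z \<in> X" for z
    proof -
      obtain b r where br: "b \<in> B" "r \<in> carrier R" "z = b \<oplus>\<^bsub>M\<^esub> r \<odot>\<^bsub>M\<^esub> x"
        using \<open>z \<in> X\<close> unfolding X_def set_add_iff by blast
      then have "r \<odot>\<^bsub>M\<^esub> x = z \<ominus>\<^bsub>M\<^esub> b"
        using x DB(2) by (simp add: M.a_comm[of b] M.add_diff_cancel)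
      then have "r \<odot>\<^bsub>M\<^esub> x \<in> S" using DS(6) AS BS that(1) br(1) by auto
      then have "z \<in> B" using mult br DB(4) by blast
      then show ?thesis using B(2) that(1) by blast
    qed
    then have "X = B" using max[OF Xsub _ BX] by blast
    then show ?thesis using xX BS by blast
  qed
  have "x \<in> S" if x: "x \<in> carrier M" for x
  proof -
    \<comment> \<open>The scalars that carry x into S form a right ideal, so a single generator s
      controls all of them.\<close>
    define I where "I = {r \<in> carrier R. r \<odot>\<^bsub>M\<^esub> x \<in> S}"
    have "additive_subgroup I R"
    proof (intro additive_subgroupI R.add.subgroupI)
      show "I \<noteq> {}" unfolding I_def using x DS(3) by (auto intro!: exI[of _ "\<zero>\<^bsub>R\<^esub>"])
    next
      fix a assume "a \<in> I"
      then show "\<ominus>\<^bsub>R\<^esub> a \<in> I" unfolding I_def using x DS(5) by (auto simp: smult_l_minus)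
    next
      fix a b assume "a \<in> I" "b \<in> I"
      then show "a \<oplus>\<^bsub>R\<^esub> b \<in> I" unfolding I_def using x DS(4) by (auto simp: smult_add_scalar)
    qed (auto simp: I_def)
    moreover have "a \<otimes>\<^bsub>R\<^esub> r \<in> I" if "a \<in> I" "r \<in> carrier R" for a r
      using that x DS(7) unfolding I_def by (auto simp: smult_assoc)
    ultimately obtain s where s: "s \<in> carrier R" "I = (\<lambda>r. s \<otimes>\<^bsub>R\<^esub> r) ` carrier R"
      using right_principal by blast
    show ?thesis
    proof (cases "s = \<zero>\<^bsub>R\<^esub>")
      \<comment> \<open>Only the scalar 0 carries x into S, so \<open>enlarge\<close> applies to x
        itself.\<close>
      case True
      show ?thesis
      proof (rule enlarge[OF x])
        fix r assume "r \<in> carrier R" "r \<odot>\<^bsub>M\<^esub> x \<in> S"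
        then have "r \<in> I" unfolding I_def by blast
        then have "r = \<zero>\<^bsub>R\<^esub>" unfolding s(2) True by auto
        then show "r \<odot>\<^bsub>M\<^esub> x \<in> B" using x DB(3) by simp
      qed
    next
      case False
      have "s \<in> I" unfolding s(2) using s(1) by (metis R.one_closed R.r_one image_eqI)
      then have "s \<odot>\<^bsub>M\<^esub> x \<in> S" unfolding I_def by blast
      then obtain a b where ab: "a \<in> A" "b \<in> B" "s \<odot>\<^bsub>M\<^esub> x = a \<oplus>\<^bsub>M\<^esub> b"
        unfolding S_def set_add_iff by blast
      \<comment> \<open>Divisibility of A enters here: subtracting c removes the A-part of x.s. Then
        \<open>enlarge\<close> applies to x - c, because every r with (x - c).r in S also carries x
        into S, hence has the form s q, and (x - c).(s q) = b.q.\<close>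
      obtain c where c: "c \<in> A" "s \<odot>\<^bsub>M\<^esub> c = a" using divisible_submoduleE[OF div s(1) False ab(1)] .
      have cM: "c \<in> carrier M" using c(1) DA(2) by blast
      have sxc: "s \<odot>\<^bsub>M\<^esub> (x \<ominus>\<^bsub>M\<^esub> c) = b"
        using s(1) x cM ab DA(2) DB(2)
        by (simp add: smult_diff c(2) M.a_comm[of a b] M.add_diff_cancel)
      have "x \<ominus>\<^bsub>M\<^esub> c \<in> S"
      proof (rule enlarge)
        show "x \<ominus>\<^bsub>M\<^esub> c \<in> carrier M" using x cM by simp
      next
        fix r assume r: "r \<in> carrier R" "r \<odot>\<^bsub>M\<^esub> (x \<ominus>\<^bsub>M\<^esub> c) \<in> S"
        have "r \<odot>\<^bsub>M\<^esub> x = r \<odot>\<^bsub>M\<^esub> (x \<ominus>\<^bsub>M\<^esub> c) \<oplus>\<^bsub>M\<^esub> r \<odot>\<^bsub>M\<^esub> c"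
          using r(1) x cM by (simp add: smult_diff M.diff_add_cancel)
        then have "r \<odot>\<^bsub>M\<^esub> x \<in> S" using DS(4)[OF r(2)] AS DA(7)[OF r(1) c(1)] by auto
        then have "r \<in> I" unfolding I_def using r by blast
        then obtain q where q: "q \<in> carrier R" "r = s \<otimes>\<^bsub>R\<^esub> q" unfolding s(2) by blast
        then have "r \<odot>\<^bsub>M\<^esub> (x \<ominus>\<^bsub>M\<^esub> c) = q \<odot>\<^bsub>M\<^esub> b" using s(1) x cM sxc by (simp add: smult_assoc)
        then show "r \<odot>\<^bsub>M\<^esub> (x \<ominus>\<^bsub>M\<^esub> c) \<in> B" using DB(7) q ab by simp
      qed
      then have "(x \<ominus>\<^bsub>M\<^esub> c) \<oplus>\<^bsub>M\<^esub> c \<in> S" using DS(4) AS c(1) by blast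
      then show ?thesis using x cM by (simp add: M.diff_add_cancel)
    qed
  qed
  then have "A <+>\<^bsub>M\<^esub> B = carrier M" using DS(1) unfolding S_def by blast
  moreover have "A \<inter> B = {\<zero>\<^bsub>M\<^esub>}" using B(2) DA(3) DB(3) by blast
  ultimately show ?thesis unfolding direct_summand_def using A B(1) by blast
qed

section \<open>The torsion submodule\<close>

lemma torsion_submodule: "submodule (torsion R M) R M"
proof (rule submoduleI)
  show "torsion R M \<subseteq> carrier M" by (auto simp: torsion_def)
  show "\<zero>\<^bsub>M\<^esub> \<in> torsion R M"
    using one_not_zero by (auto simp: torsion_def intro!: bexI[of _ "\<one>\<^bsub>R\<^esub>"])
next
  fix x y assume "x \<in> torsion R M" "y \<in> torsion R M"
  then obtain r s where x: "x \<in> carrier M" "r \<in> carrier R" "r \<noteq> \<zero>\<^bsub>R\<^esub>" "r \<odot>\<^bsub>M\<^esub> x = \<zero>\<^bsub>M\<^esub>"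
    and y: "y \<in> carrier M" "s \<in> carrier R" "s \<noteq> \<zero>\<^bsub>R\<^esub>" "s \<odot>\<^bsub>M\<^esub> y = \<zero>\<^bsub>M\<^esub>"
    by (auto simp: torsion_def)
  \<comment> \<open>A common right multiple of r and s kills both x and y.\<close>
  obtain a b where ab: "a \<in> carrier R" "b \<in> carrier R" "r \<otimes>\<^bsub>R\<^esub> a = s \<otimes>\<^bsub>R\<^esub> b" "a \<noteq> \<zero>\<^bsub>R\<^esub>"
    using right_ore[OF x(2,3) y(2,3)] by metis
  have "(r \<otimes>\<^bsub>R\<^esub> a) \<odot>\<^bsub>M\<^esub> x = \<zero>\<^bsub>M\<^esub>" using x ab(1) by (simp add: smult_assoc)
  moreover have "(r \<otimes>\<^bsub>R\<^esub> a) \<odot>\<^bsub>M\<^esub> y = \<zero>\<^bsub>M\<^esub>" using y ab(2) unfolding ab(3) by (simp add: smult_assoc)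
  ultimately have "(r \<otimes>\<^bsub>R\<^esub> a) \<odot>\<^bsub>M\<^esub> (x \<oplus>\<^bsub>M\<^esub> y) = \<zero>\<^bsub>M\<^esub>"
    using x y ab(1) by (simp add: smult_add_vector)
  moreover have "r \<otimes>\<^bsub>R\<^esub> a \<noteq> \<zero>\<^bsub>R\<^esub>" using integral[of r a] x ab by blast
  ultimately show "x \<oplus>\<^bsub>M\<^esub> y \<in> torsion R M"
    using x y ab(1) by (auto simp: torsion_def)
next
  fix s x assume s: "s \<in> carrier R" and "x \<in> torsion R M"
  then obtain r where x: "x \<in> carrier M" "r \<in> carrier R" "r \<noteq> \<zero>\<^bsub>R\<^esub>" "r \<odot>\<^bsub>M\<^esub> x = \<zero>\<^bsub>M\<^esub>"
    by (auto simp: torsion_def)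
  show "s \<odot>\<^bsub>M\<^esub> x \<in> torsion R M"
  proof (cases "s = \<zero>\<^bsub>R\<^esub>")
    case True
    then show ?thesis using x one_not_zero by (auto simp: torsion_def)
  next
    case False
    \<comment> \<open>With r a = s b, the scalar b kills x.s, because (x.s).b = x.(r a) = 0.\<close>
    obtain a b where ab: "a \<in> carrier R" "b \<in> carrier R" "r \<otimes>\<^bsub>R\<^esub> a = s \<otimes>\<^bsub>R\<^esub> b" "b \<noteq> \<zero>\<^bsub>R\<^esub>"
      using right_ore[OF x(2,3) s False] by metis
    have "b \<odot>\<^bsub>M\<^esub> (s \<odot>\<^bsub>M\<^esub> x) = (r \<otimes>\<^bsub>R\<^esub> a) \<odot>\<^bsub>M\<^esub> x"
      unfolding ab(3) using ab(2) x s by (simp add: smult_assoc)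
    also have "\<dots> = \<zero>\<^bsub>M\<^esub>" using x ab(1) by (simp add: smult_assoc)
    finally show ?thesis using ab(2,4) x(1) s by (auto simp: torsion_def)
  qed
qed

lemma torsionI:
  "\<lbrakk>x \<in> carrier M; r \<in> carrier R; r \<noteq> \<zero>\<^bsub>R\<^esub>; r \<odot>\<^bsub>M\<^esub> x = \<zero>\<^bsub>M\<^esub>\<rbrakk> \<Longrightarrow> x \<in> torsion R M"
  by (auto simp: torsion_def)

text \<open>Anything that divides a torsion element is itself torsion: if x.r = y and y.s = 0, then
  x.(r s) = 0.\<close>

lemma torsion_divisible:
  assumes "divisible_module R M"
  shows "divisible_module R (restrict_module M (torsion R M))"
proof (rule divisible_submoduleI[OF torsion_submodule])
  fix r y assume r: "r \<in> carrier R" "r \<noteq> \<zero>\<^bsub>R\<^esub>" and "y \<in> torsion R M"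
  then obtain s where s: "y \<in> carrier M" "s \<in> carrier R" "s \<noteq> \<zero>\<^bsub>R\<^esub>" "s \<odot>\<^bsub>M\<^esub> y = \<zero>\<^bsub>M\<^esub>"
    by (auto simp: torsion_def)
  obtain x where x: "x \<in> carrier M" "r \<odot>\<^bsub>M\<^esub> x = y"
    using divisible_module.divisibleE[OF assms r s(1)] .
  have "r \<otimes>\<^bsub>R\<^esub> s \<noteq> \<zero>\<^bsub>R\<^esub>" using integral r s by blast
  then have "x \<in> torsion R M"
    using x r s by (intro torsionI[of x "r \<otimes>\<^bsub>R\<^esub> s"]) (auto simp: smult_assoc)
  then show "\<exists>x\<in>torsion R M. r \<odot>\<^bsub>M\<^esub> x = y" using x by blast
qed

text \<open>If x.r lies in N, then divisibility gives n in N with n.r = x.r; the difference x - n is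
  torsion, hence in N, and so is x.\<close>

lemma torsion_free_quotient_by_divisible:
  assumes N: "submodule N R M" "divisible_module R (restrict_module M N)" "torsion R M \<subseteq> N"
  shows "torsion_free_module R (quotient_module M N)"
proof (rule torsion_free_quotient[OF N(1) _ one_not_zero])
  fix r x assume r: "r \<in> carrier R" "r \<noteq> \<zero>\<^bsub>R\<^esub>" and x: "x \<in> carrier M" "r \<odot>\<^bsub>M\<^esub> x \<in> N"
  obtain n where n: "n \<in> N" "r \<odot>\<^bsub>M\<^esub> n = r \<odot>\<^bsub>M\<^esub> x" using divisible_submoduleE[OF N(2) r x(2)] .
  have nM: "n \<in> carrier M" using n submoduleD(2)[OF N(1)] by blast
  have "r \<odot>\<^bsub>M\<^esub> (x \<ominus>\<^bsub>M\<^esub> n) = \<zero>\<^bsub>M\<^esub>"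
    using r x(1) nM n(2) by (simp add: smult_diff M.diff_eq_zero_iff)
  then have "x \<ominus>\<^bsub>M\<^esub> n \<in> N" using torsionI[of "x \<ominus>\<^bsub>M\<^esub> n" r] r x nM N(3) by auto
  then have "(x \<ominus>\<^bsub>M\<^esub> n) \<oplus>\<^bsub>M\<^esub> n \<in> N" using n submoduleD(4)[OF N(1)] by blast
  then show "x \<in> N" using x(1) nM by (simp add: M.diff_add_cancel)
qed

lemma torsion_free_submodule:
  assumes N: "submodule N R M" "N \<inter> torsion R M \<subseteq> {\<zero>\<^bsub>M\<^esub>}"
  shows "torsion_free_module R (restrict_module M N)"
proof -
  interpret N: right_pid_module R "restrict_module M N" by (rule restrict_right_pid_module) fact
  show ?thesis
    using N(2) submoduleD(2)[OF N(1)] torsionI by (intro N.torsion_freeI one_not_zero) fastforce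
qed

text \<open>
  The fraction \<open>d = r s\<inverse>\<close> sends \<open>x\<close> to the unique \<open>y\<close> with \<open>y.s = x.r\<close>; writing this as \<open>d s = r\<close>
  avoids inverses in \<open>D\<close>.
\<close>

lemma torsion_free_divisible_vector_space:
  assumes tf: "torsion_free_module R M" and div: "divisible_module R M"
    and D: "skew_field_of_fractions R D \<iota>"
  shows "is_vector_space_over D \<iota> R M"
proof -
  interpret F: skew_field_of_fractions R D \<iota> by fact
  have \<iota> [simp]: "\<iota> r \<in> carrier D" if "r \<in> carrier R" for r
    using ring_hom_closed[OF F.hom that] .
  have \<iota>_mult: "\<iota> (r \<otimes>\<^bsub>R\<^esub> s) = \<iota> r \<otimes>\<^bsub>D\<^esub> \<iota> s" if "r \<in> carrier R" "s \<in> carrier R" for r s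
    using ring_hom_mult[OF F.hom that] .
  have \<iota>_add: "\<iota> (r \<oplus>\<^bsub>R\<^esub> s) = \<iota> r \<oplus>\<^bsub>D\<^esub> \<iota> s" if "r \<in> carrier R" "s \<in> carrier R" for r s
    using ring_hom_add[OF F.hom that] .
  have \<iota>_one: "\<iota> \<one>\<^bsub>R\<^esub> = \<one>\<^bsub>D\<^esub>" using ring_hom_one[OF F.hom] .
  have cancel: "x = y"
    if "s \<in> carrier R" "s \<noteq> \<zero>\<^bsub>R\<^esub>" "x \<in> carrier M" "y \<in> carrier M" "s \<odot>\<^bsub>M\<^esub> x = s \<odot>\<^bsub>M\<^esub> y" for s x y
  proof -
    have "s \<odot>\<^bsub>M\<^esub> (x \<ominus>\<^bsub>M\<^esub> y) = \<zero>\<^bsub>M\<^esub>" using that by (simp add: smult_diff M.diff_eq_zero_iff)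
    then have "x \<ominus>\<^bsub>M\<^esub> y \<in> torsion R M" using that by (intro torsionI[of _ s]) auto
    then have "x \<ominus>\<^bsub>M\<^esub> y = \<zero>\<^bsub>M\<^esub>"
      using torsion_free_module.torsion_trivial[OF tf] by simp
    then show ?thesis using that M.diff_eq_zero_iff by blast
  qed
  define rep where "rep d r s \<longleftrightarrow> r \<in> carrier R \<and> s \<in> carrier R \<and> s \<noteq> \<zero>\<^bsub>R\<^esub> \<and> d \<otimes>\<^bsub>D\<^esub> \<iota> s = \<iota> r" for d r s
  have rep_ex: "\<exists>r s. rep d r s" if d: "d \<in> carrier D" for d
  proof -
    obtain r s where rs: "r \<in> carrier R" "s \<in> carrier R" "s \<noteq> \<zero>\<^bsub>R\<^esub>" "d = \<iota> r \<otimes>\<^bsub>D\<^esub> inv\<^bsub>D\<^esub> (\<iota> s)"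
      using F.fractions[OF d] by blast
    have "\<iota> s \<noteq> \<zero>\<^bsub>D\<^esub>"
      using F.inj rs(2,3) ring_hom_zero[OF F.hom R.ring_axioms F.D.ring_axioms]
      by (metis R.zero_closed inj_onD)
    then have "\<iota> s \<in> Units D" using F.units rs by simp
    then have "d \<otimes>\<^bsub>D\<^esub> \<iota> s = \<iota> r" unfolding rs(4) using rs(1,2)
      by (simp add: F.D.m_assoc F.D.Units_l_inv)
    then show ?thesis unfolding rep_def using rs by blast
  qed
  have rep_mult: "rep d (r \<otimes>\<^bsub>R\<^esub> a) (s \<otimes>\<^bsub>R\<^esub> a)"
    if "rep d r s" "d \<in> carrier D" "a \<in> carrier R" "a \<noteq> \<zero>\<^bsub>R\<^esub>" for d r s a
    using that integral[of s a] unfolding rep_def by (auto simp: \<iota>_mult simp flip: F.D.m_assoc)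
  \<comment> \<open>The value at d does not depend on the fraction: over a common denominator the
    numerators agree by injectivity of \<open>\<iota>\<close>, and torsion freeness cancels the
    denominator.\<close>
  have rep_agree: "y = z"
    if d: "d \<in> carrier D" and 1: "rep d r s" and 2: "rep d r' s'"
      and x: "x \<in> carrier M" "y \<in> carrier M" "z \<in> carrier M"
      and y: "s \<odot>\<^bsub>M\<^esub> y = r \<odot>\<^bsub>M\<^esub> x" and z: "s' \<odot>\<^bsub>M\<^esub> z = r' \<odot>\<^bsub>M\<^esub> x" for d r s r' s' x y z
  proof -
    note c = 1[unfolded rep_def] 2[unfolded rep_def]
    obtain a b where ab: "a \<in> carrier R" "b \<in> carrier R" "s \<otimes>\<^bsub>R\<^esub> a = s' \<otimes>\<^bsub>R\<^esub> b"
        "a \<noteq> \<zero>\<^bsub>R\<^esub>" "b \<noteq> \<zero>\<^bsub>R\<^esub>"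
      using right_ore[of s s'] c by metis
    have ra: "r \<otimes>\<^bsub>R\<^esub> a = r' \<otimes>\<^bsub>R\<^esub> b"
      using rep_mult[OF 1 d ab(1,4)] rep_mult[OF 2 d ab(2,5)] F.inj
      unfolding rep_def ab(3) by (metis inj_onD)
    have "(s \<otimes>\<^bsub>R\<^esub> a) \<odot>\<^bsub>M\<^esub> y = (r \<otimes>\<^bsub>R\<^esub> a) \<odot>\<^bsub>M\<^esub> x"
      using c ab(1,2) x y by (simp add: smult_assoc)
    also have "\<dots> = (s \<otimes>\<^bsub>R\<^esub> a) \<odot>\<^bsub>M\<^esub> z"
      unfolding ra ab(3) using c ab(1,2) x z by (simp add: smult_assoc)
    finally show ?thesis
      using cancel[of "s \<otimes>\<^bsub>R\<^esub> a" y z] integral[of s a] c ab x by auto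
  qed
  \<comment> \<open>Divisibility makes the choice possible and \<open>rep_agree\<close> makes it
    unique; \<open>actI\<close> and \<open>actD\<close> then permit any representation of d to be
    used.\<close>
  define act where "act d x = (SOME y. y \<in> carrier M \<and> (\<exists>r s. rep d r s \<and> s \<odot>\<^bsub>M\<^esub> y = r \<odot>\<^bsub>M\<^esub> x))" for d x
  have act: "act d x \<in> carrier M" "\<exists>r s. rep d r s \<and> s \<odot>\<^bsub>M\<^esub> act d x = r \<odot>\<^bsub>M\<^esub> x"
    if "d \<in> carrier D" "x \<in> carrier M" for d x
  proof -
    obtain r s where rs: "rep d r s" using rep_ex \<open>d \<in> carrier D\<close> by blast
    then obtain y where "y \<in> carrier M" "s \<odot>\<^bsub>M\<^esub> y = r \<odot>\<^bsub>M\<^esub> x"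
      using divisible_module.divisibleE[OF div, of s "r \<odot>\<^bsub>M\<^esub> x"] \<open>x \<in> carrier M\<close> unfolding rep_def by blast
    then have "\<exists>y. y \<in> carrier M \<and> (\<exists>r s. rep d r s \<and> s \<odot>\<^bsub>M\<^esub> y = r \<odot>\<^bsub>M\<^esub> x)" using rs by blast
    from someI_ex[OF this] show "act d x \<in> carrier M" "\<exists>r s. rep d r s \<and> s \<odot>\<^bsub>M\<^esub> act d x = r \<odot>\<^bsub>M\<^esub> x"
      unfolding act_def by blast+
  qed
  have actI: "act d x = y"
    if "d \<in> carrier D" "x \<in> carrier M" "y \<in> carrier M" "rep d r s" "s \<odot>\<^bsub>M\<^esub> y = r \<odot>\<^bsub>M\<^esub> x" for d x y r s
    using act[OF that(1,2)] rep_agree[OF that(1) _ that(4)] that by metis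
  have actD: "s \<odot>\<^bsub>M\<^esub> act d x = r \<odot>\<^bsub>M\<^esub> x" if d: "d \<in> carrier D" "x \<in> carrier M" "rep d r s" for d x r s
  proof -
    obtain y where "y \<in> carrier M" "s \<odot>\<^bsub>M\<^esub> y = r \<odot>\<^bsub>M\<^esub> x"
      using divisible_module.divisibleE[OF div, of s "r \<odot>\<^bsub>M\<^esub> x"] d unfolding rep_def by blast
    then show ?thesis using actI[OF d(1,2) _ d(3)] by blast
  qed
  \<comment> \<open>One denominator for two fractions, for additivity of the action in the
    scalar.\<close>
  have common: "\<exists>a b s. rep d a s \<and> rep e b s" if de: "d \<in> carrier D" "e \<in> carrier D" for d e
  proof -
    obtain r s r' s' where 1: "rep d r s" and 2: "rep e r' s'" using rep_ex de by meson
    note c = 1[unfolded rep_def] 2[unfolded rep_def]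
    obtain a b where ab: "a \<in> carrier R" "b \<in> carrier R" "s \<otimes>\<^bsub>R\<^esub> a = s' \<otimes>\<^bsub>R\<^esub> b"
        "a \<noteq> \<zero>\<^bsub>R\<^esub>" "b \<noteq> \<zero>\<^bsub>R\<^esub>"
      using right_ore[of s s'] c by metis
    show ?thesis
      using rep_mult[OF 1 de(1) ab(1,4)] rep_mult[OF 2 de(2) ab(2,5)] unfolding ab(3) by blast
  qed
  define V where "V = \<lparr>carrier = carrier M, mult = add M, one = \<zero>\<^bsub>M\<^esub>,
    zero = \<zero>\<^bsub>M\<^esub>, add = add M, smult = act\<rparr>"
  have V: "carrier V = carrier M" "zero V = zero M" "add V = add M" "smult V = act"
    by (simp_all add: V_def)
  have "abelian_group V"
    by (rule abelian_groupI) (auto simp: V M.a_ac intro: M.l_neg bexI[of _ "\<ominus>\<^bsub>M\<^esub> _"])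
  moreover have "act (d \<oplus>\<^bsub>D\<^esub> e) x = act d x \<oplus>\<^bsub>M\<^esub> act e x"
    if de: "d \<in> carrier D" "e \<in> carrier D" and x: "x \<in> carrier M" for d e x
  proof -
    obtain a b s where "rep d a s" "rep e b s" using common[OF de] by blast
    note r = this
    note c = r[unfolded rep_def]
    have "rep (d \<oplus>\<^bsub>D\<^esub> e) (a \<oplus>\<^bsub>R\<^esub> b) s"
      unfolding rep_def using c de by (simp add: \<iota>_add F.D.l_distr)
    moreover have "s \<odot>\<^bsub>M\<^esub> (act d x \<oplus>\<^bsub>M\<^esub> act e x) = (a \<oplus>\<^bsub>R\<^esub> b) \<odot>\<^bsub>M\<^esub> x"
      using c x act(1) de actD[OF de(1) x r(1)] actD[OF de(2) x r(2)]
      by (simp add: smult_add_vector smult_add_scalar)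
    ultimately show ?thesis using actI de x act(1) by simp
  qed
  moreover have "act d (x \<oplus>\<^bsub>M\<^esub> y) = act d x \<oplus>\<^bsub>M\<^esub> act d y"
    if d: "d \<in> carrier D" and x: "x \<in> carrier M" "y \<in> carrier M" for d x y
  proof -
    obtain r s where rs: "rep d r s" using rep_ex d by blast
    have "s \<odot>\<^bsub>M\<^esub> (act d x \<oplus>\<^bsub>M\<^esub> act d y) = r \<odot>\<^bsub>M\<^esub> (x \<oplus>\<^bsub>M\<^esub> y)"
      using rs[unfolded rep_def] x act(1) d actD[OF d _ rs] by (simp add: smult_add_vector)
    then show ?thesis using actI[OF d _ _ rs] d x act(1) by simp
  qed
  moreover have "act (d \<otimes>\<^bsub>D\<^esub> e) x = act e (act d x)"
    if de: "d \<in> carrier D" "e \<in> carrier D" and x: "x \<in> carrier M" for d e x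
  proof -
    obtain r1 s1 r2 s2 where r: "rep d r1 s1" "rep e r2 s2" using rep_ex de by meson
    note c = r[unfolded rep_def]
    \<comment> \<open>\<open>s\<^sub>1\<inverse> r\<^sub>2 = p q\<inverse>\<close>, so that \<open>d e = (r\<^sub>1 p) (s\<^sub>2 q)\<inverse>\<close>\<close>
    obtain p q where pq: "p \<in> carrier R" "q \<in> carrier R" "q \<noteq> \<zero>\<^bsub>R\<^esub>" "s1 \<otimes>\<^bsub>R\<^esub> p = r2 \<otimes>\<^bsub>R\<^esub> q"
    \<comment> \<open>\<open>right_ore\<close> treats non-zero elements; for r2 = 0 the pair p = 0,
      q = 1 serves.\<close>
    proof (cases "r2 = \<zero>\<^bsub>R\<^esub>")
      case True
      then show ?thesis using that[of "\<zero>\<^bsub>R\<^esub>" "\<one>\<^bsub>R\<^esub>"] c one_not_zero by simp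
    next
      case False
      then show ?thesis using right_ore[of s1 r2] c that by metis
    qed
    have "s2 \<otimes>\<^bsub>R\<^esub> q \<noteq> \<zero>\<^bsub>R\<^esub>" using integral[of s2 q] c pq by blast
    moreover have "(d \<otimes>\<^bsub>D\<^esub> e) \<otimes>\<^bsub>D\<^esub> \<iota> (s2 \<otimes>\<^bsub>R\<^esub> q) = \<iota> (r1 \<otimes>\<^bsub>R\<^esub> p)"
    proof -
      have "(d \<otimes>\<^bsub>D\<^esub> e) \<otimes>\<^bsub>D\<^esub> \<iota> (s2 \<otimes>\<^bsub>R\<^esub> q) = d \<otimes>\<^bsub>D\<^esub> ((e \<otimes>\<^bsub>D\<^esub> \<iota> s2) \<otimes>\<^bsub>D\<^esub> \<iota> q)"
        using conjunct1[OF conjunct2[OF c(2)]] pq(2) de by (simp add: \<iota>_mult F.D.m_assoc)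
      also have "\<dots> = d \<otimes>\<^bsub>D\<^esub> \<iota> (s1 \<otimes>\<^bsub>R\<^esub> p)"
        unfolding pq(4) using c pq(1,2) by (simp add: \<iota>_mult)
      also have "\<dots> = \<iota> (r1 \<otimes>\<^bsub>R\<^esub> p)"
        using c pq(1,2) de by (simp add: \<iota>_mult flip: F.D.m_assoc)
      finally show ?thesis .
    qed
    ultimately have "rep (d \<otimes>\<^bsub>D\<^esub> e) (r1 \<otimes>\<^bsub>R\<^esub> p) (s2 \<otimes>\<^bsub>R\<^esub> q)"
      unfolding rep_def using c pq by simp
    moreover have "(s2 \<otimes>\<^bsub>R\<^esub> q) \<odot>\<^bsub>M\<^esub> act e (act d x) = (r1 \<otimes>\<^bsub>R\<^esub> p) \<odot>\<^bsub>M\<^esub> x"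
    proof -
      have "(s2 \<otimes>\<^bsub>R\<^esub> q) \<odot>\<^bsub>M\<^esub> act e (act d x) = (s1 \<otimes>\<^bsub>R\<^esub> p) \<odot>\<^bsub>M\<^esub> act d x"
        unfolding pq(4) using c pq(1,2) de x act(1) actD[OF de(2) _ r(2), of "act d x"]
        by (simp add: smult_assoc)
      also have "\<dots> = (r1 \<otimes>\<^bsub>R\<^esub> p) \<odot>\<^bsub>M\<^esub> x"
        using c pq(1,2) de x act(1) actD[OF de(1) x r(1)] by (simp add: smult_assoc)
      finally show ?thesis .
    qed
    ultimately show ?thesis using actI de x act(1) by simp
  qed
  moreover have \<iota>_act: "act (\<iota> r) x = r \<odot>\<^bsub>M\<^esub> x" if "r \<in> carrier R" "x \<in> carrier M" for r x
    using that one_not_zero by (intro actI[where r = r and s = "\<one>\<^bsub>R\<^esub>"]) (auto simp: rep_def \<iota>_one)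
  moreover have "act \<one>\<^bsub>D\<^esub> x = x" if "x \<in> carrier M" for x
    using \<iota>_act[of "\<one>\<^bsub>R\<^esub>" x] that by (simp add: \<iota>_one)
  ultimately have "right_module D V"
    using F.D.ring_axioms act(1)
    by (intro right_module.intro right_module_axioms.intro) (auto simp: V)
  then show ?thesis
    unfolding is_vector_space_over_def using \<iota>_act V by (intro exI[of _ V]) simp
qed

end

section \<open>Valued modules over skew polynomials\<close>

context tau_chain
begin

lemma pos_iff: "\<gamma> \<in> chain_pos \<Delta> \<omega> \<tau> \<longleftrightarrow> \<gamma> \<in> \<Delta> \<and> (\<gamma> < \<tau> \<gamma> \<or> \<gamma> = \<omega>)"
  using omega_mem by (auto simp: chain_pos_def)

lemma neg_iff: "\<gamma> \<in> chain_neg \<Delta> \<tau> \<longleftrightarrow> \<gamma> \<in> \<Delta> \<and> \<tau> \<gamma> < \<gamma>"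
  by (auto simp: chain_neg_def)

lemma tau_mem [simp]: "\<gamma> \<in> \<Delta> \<Longrightarrow> \<tau> \<gamma> \<in> \<Delta>"
  using tau_closed by blast

lemma funpow_tau_mem [simp]: "\<gamma> \<in> \<Delta> \<Longrightarrow> (\<tau> ^^ i) \<gamma> \<in> \<Delta>"
  by (induction i) auto

lemma tau_less_iff: "\<lbrakk>\<gamma> \<in> \<Delta>; \<delta> \<in> \<Delta>\<rbrakk> \<Longrightarrow> \<tau> \<gamma> < \<tau> \<delta> \<longleftrightarrow> \<gamma> < \<delta>"
  using tau_strict_mono by (metis linorder_neqE not_less_iff_gr_or_eq strict_mono_onD)

lemma tau_eq_iff: "\<lbrakk>\<gamma> \<in> \<Delta>; \<delta> \<in> \<Delta>\<rbrakk> \<Longrightarrow> \<tau> \<gamma> = \<tau> \<delta> \<longleftrightarrow> \<gamma> = \<delta>"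
  using tau_less_iff[of \<gamma> \<delta>] tau_less_iff[of \<delta> \<gamma>] by (cases \<gamma> \<delta> rule: linorder_cases) auto

lemma funpow_tau_omega [simp]: "(\<tau> ^^ i) \<omega> = \<omega>"
  by (induction i) (auto simp: tau_omega)

lemma funpow_tau_eq_omega_iff: "\<gamma> \<in> \<Delta> \<Longrightarrow> (\<tau> ^^ i) \<gamma> = \<omega> \<longleftrightarrow> \<gamma> = \<omega>"
proof (induction i)
  case (Suc i)
  then show ?case using tau_eq_iff[of "(\<tau> ^^ i) \<gamma>" \<omega>] omega_mem by (simp add: tau_omega)
qed simp

lemma pos_not_neg: "\<gamma> \<in> chain_pos \<Delta> \<omega> \<tau> \<Longrightarrow> \<gamma> \<notin> chain_neg \<Delta> \<tau>"
  by (auto simp: pos_iff neg_iff tau_omega)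

text \<open>Together with \<open>pos_upward\<close> this cuts the chain into an initial segment on
  which \<tau> decreases values and a final segment, ending in \<omega>, on which it increases them.
  Between the two there is room for \<theta> alone.\<close>

lemma neg_downward:
  assumes "\<gamma> \<in> chain_neg \<Delta> \<tau>" "\<delta> \<in> \<Delta>" "\<delta> \<le> \<gamma>"
  shows "\<delta> \<in> chain_neg \<Delta> \<tau>"
proof (cases "\<delta> = \<gamma>")
  case False
  have "\<gamma> \<noteq> \<omega>" using assms(1) by (auto simp: neg_iff tau_omega)
  then show ?thesis
    using tau_below[of \<gamma> \<delta>] assms False by (simp add: neg_iff order.strict_iff_order)
qed (use assms in simp)

lemma pos_upward:
  assumes "\<gamma> \<in> chain_pos \<Delta> \<omega> \<tau>" "\<delta> \<in> \<Delta>" "\<gamma> \<le> \<delta>"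
  shows "\<delta> \<in> chain_pos \<Delta> \<omega> \<tau>"
proof (rule ccontr)
  assume \<delta>: "\<delta> \<notin> chain_pos \<Delta> \<omega> \<tau>"
  then have "\<tau> \<delta> \<le> \<delta>" "\<delta> \<noteq> \<omega>" "\<gamma> < \<delta>" using assms by (auto simp: pos_iff order.strict_iff_order)
  then have "\<tau> \<gamma> < \<gamma>" using tau_below[of \<delta> \<gamma>] assms by (simp add: pos_iff)
  then show False using assms(1) by (auto simp: pos_iff tau_omega)
qed

lemma neg_less:
  assumes "\<gamma> \<in> chain_neg \<Delta> \<tau>" "\<delta> \<in> \<Delta>" "\<delta> \<notin> chain_neg \<Delta> \<tau>"
  shows "\<gamma> < \<delta>"
  using neg_downward[OF assms(1,2)] assms(3) by (meson not_le)

lemma less_pos: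
  assumes "\<gamma> \<in> \<Delta>" "\<gamma> \<notin> chain_pos \<Delta> \<omega> \<tau>" "\<delta> \<in> chain_pos \<Delta> \<omega> \<tau>"
  shows "\<gamma> < \<delta>"
  using pos_upward[OF assms(3,1)] assms(2) by (meson not_le)

lemma tau_fixed:
  assumes "\<gamma> \<in> \<Delta>" "\<gamma> \<notin> chain_pos \<Delta> \<omega> \<tau>" "\<gamma> \<notin> chain_neg \<Delta> \<tau>"
  shows "\<tau> \<gamma> = \<gamma>"
  using assms by (auto simp: pos_iff neg_iff)

text \<open>The value \<open>\<theta>\<close> of the paper is the fixed point of \<open>\<tau>\<close> below \<open>\<omega>\<close>, if there is one.\<close>

lemma tau_fixed_unique:
  assumes "\<gamma> \<in> \<Delta>" "\<gamma> \<notin> chain_pos \<Delta> \<omega> \<tau>" "\<gamma> \<notin> chain_neg \<Delta> \<tau>"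
    and "\<delta> \<in> \<Delta>" "\<delta> \<notin> chain_pos \<Delta> \<omega> \<tau>" "\<delta> \<notin> chain_neg \<Delta> \<tau>"
  shows "\<gamma> = \<delta>"
proof (rule ccontr)
  assume "\<gamma> \<noteq> \<delta>"
  moreover have "\<gamma> \<noteq> \<omega>" "\<delta> \<noteq> \<omega>" using assms by (auto simp: pos_iff)
  ultimately show False
    using tau_below[of \<gamma> \<delta>] tau_below[of \<delta> \<gamma>] tau_fixed[OF assms(1-3)] tau_fixed[OF assms(4-6)]
      assms(1,4) by (cases \<gamma> \<delta> rule: linorder_cases) auto
qed

text \<open>The forward direction is what keeps division by t inside \<open>val_gt\<close>; see
  \<open>gt_divisible\<close>.\<close>

lemma tau_pos_iff: "\<gamma> \<in> \<Delta> \<Longrightarrow> \<tau> \<gamma> \<in> chain_pos \<Delta> \<omega> \<tau> \<longleftrightarrow> \<gamma> \<in> chain_pos \<Delta> \<omega> \<tau>"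
  using tau_less_iff[of \<gamma> "\<tau> \<gamma>"] funpow_tau_eq_omega_iff[of \<gamma> 1] by (simp add: pos_iff)

lemma tau_neg_iff: "\<gamma> \<in> \<Delta> \<Longrightarrow> \<tau> \<gamma> \<in> chain_neg \<Delta> \<tau> \<longleftrightarrow> \<gamma> \<in> chain_neg \<Delta> \<tau>"
  using tau_less_iff[of "\<tau> \<gamma>" \<gamma>] by (simp add: neg_iff)

lemma funpow_tau_neg: "\<gamma> \<in> chain_neg \<Delta> \<tau> \<Longrightarrow> (\<tau> ^^ i) \<gamma> \<in> chain_neg \<Delta> \<tau>"
proof (induction i)
  case (Suc i)
  then show ?case using tau_neg_iff[of "(\<tau> ^^ i) \<gamma>"] by (simp add: neg_iff)
qed simp

text \<open>As \<tau> is strictly increasing, all later steps of the orbit go in the direction of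
  the first one, so the orbit never returns to its start.\<close>

lemma funpow_tau_neq:
  assumes "\<gamma> \<in> \<Delta>" "\<tau> \<gamma> \<noteq> \<gamma>"
  shows "(\<tau> ^^ Suc i) \<gamma> \<noteq> \<gamma>"
proof (cases "\<gamma> < \<tau> \<gamma>")
  case True
  have "\<gamma> < (\<tau> ^^ Suc i) \<gamma>"
  proof (induction i)
    case (Suc i)
    then have "\<tau> \<gamma> < \<tau> ((\<tau> ^^ Suc i) \<gamma>)" using tau_less_iff funpow_tau_mem assms(1) by blast
    then show ?case using True by simp
  qed (use True in simp)
  then show ?thesis by simp
next
  case False
  have "(\<tau> ^^ Suc i) \<gamma> < \<gamma>"
  proof (induction i)
    case (Suc i)
    then have "\<tau> ((\<tau> ^^ Suc i) \<gamma>) < \<tau> \<gamma>" using tau_less_iff funpow_tau_mem assms(1) by blast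
    then show ?case using False by simp
  qed (use False assms in simp)
  then show ?thesis by simp
qed

end

section \<open>The value of x.f in a valued module\<close>

locale skew_valued_module = valued_module K \<phi> M \<Delta> \<omega> \<tau> v + S: skew_polynomials K \<phi>
  for K \<phi> M \<Delta> \<omega> \<tau> v

sublocale skew_valued_module \<subseteq> right_pid_module "skew_poly_ring K \<phi>" M
  by (intro right_pid_module.intro right_module_axioms S.P.right_pid_axioms)

context skew_valued_module
begin

abbreviation "T \<equiv> skew_monom K \<one>\<^bsub>K\<^esub> 1"
abbreviation "gt \<equiv> val_gt M \<Delta> \<omega> \<tau> v"
abbreviation "ge \<equiv> val_ge M \<Delta> \<tau> v"
abbreviation "tor \<equiv> torsion S.P M"

lemma carrier_P [simp]: "carrier S.P = up K"
  by (rule S.P_simps)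

lemma smult_up_closed [simp]: "\<lbrakk>f \<in> up K; x \<in> carrier M\<rbrakk> \<Longrightarrow> f \<odot>\<^bsub>M\<^esub> x \<in> carrier M"
  using smult_closed by simp

lemma v_closed [simp]: "x \<in> carrier M \<Longrightarrow> v x \<in> \<Delta>"
  using v_surj by blast

lemma v_zero [simp]: "v \<zero>\<^bsub>M\<^esub> = \<omega>"
  using v_eq_omega by simp

lemma v_le_omega: "x \<in> carrier M \<Longrightarrow> v x \<le> \<omega>"
  using le_omega by simp

lemma v_add_less:
  assumes "x \<in> carrier M" "y \<in> carrier M" "v x < v y"
  shows "v (x \<oplus>\<^bsub>M\<^esub> y) = v x"
proof -
  have "v x \<ge> min (v (x \<oplus>\<^bsub>M\<^esub> y)) (v y)"
    using v_diff[of "x \<oplus>\<^bsub>M\<^esub> y" y] assms by (simp add: M.add_diff_cancel)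
  then have "v x \<ge> v (x \<oplus>\<^bsub>M\<^esub> y)" using assms(3) by (auto simp: min_def split: if_splits)
  moreover have "v (x \<oplus>\<^bsub>M\<^esub> y) \<ge> v x" using v_add[of x y] assms by (simp add: min_def split: if_splits)
  ultimately show ?thesis by simp
qed

lemma v_add_neq:
  assumes "x \<in> carrier M" "y \<in> carrier M" "v x \<noteq> v y"
  shows "v (x \<oplus>\<^bsub>M\<^esub> y) = min (v x) (v y)"
  using v_add_less[of x y] v_add_less[of y x] assms M.a_comm[of x y]
  by (cases "v x < v y") (auto simp: min_def)

text \<open>Complements \<open>v_add_neq\<close>, which leaves out the case of two zero summands
  since their values are equal.\<close>

lemma v_add_zero:
  assumes "x \<in> carrier M" "y \<in> carrier M" "x = \<zero>\<^bsub>M\<^esub> \<or> y = \<zero>\<^bsub>M\<^esub>"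
  shows "v (x \<oplus>\<^bsub>M\<^esub> y) = min (v x) (v y)"
  using assms v_le_omega[of x] v_le_omega[of y] by (auto simp: min_def)

lemma skew_monom_zero [simp]: "skew_monom K \<zero>\<^bsub>K\<^esub> n = \<zero>\<^bsub>S.P\<^esub>"
  by (auto simp: S.P_simps skew_monom_def)

lemma smult_split:
  assumes "f \<in> up K" "x \<in> carrier M"
  shows "f \<odot>\<^bsub>M\<^esub> x = skew_monom K (f 0) 0 \<odot>\<^bsub>M\<^esub> x \<oplus>\<^bsub>M\<^esub> (\<lambda>n. f (Suc n)) \<odot>\<^bsub>M\<^esub> (T \<odot>\<^bsub>M\<^esub> x)"
proof -
  have "f \<odot>\<^bsub>M\<^esub> x = (skew_monom K (f 0) 0 \<oplus>\<^bsub>S.P\<^esub> (T \<otimes>\<^bsub>S.P\<^esub> (\<lambda>n. f (Suc n)))) \<odot>\<^bsub>M\<^esub> x"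
    using S.split_constant_coeff[OF assms(1)] by simp
  also have "\<dots> = skew_monom K (f 0) 0 \<odot>\<^bsub>M\<^esub> x \<oplus>\<^bsub>M\<^esub> (T \<otimes>\<^bsub>S.P\<^esub> (\<lambda>n. f (Suc n))) \<odot>\<^bsub>M\<^esub> x"
    using assms S.shift_closed[OF assms(1)] R.m_closed by (intro smult_add_scalar) auto
  also have "(T \<otimes>\<^bsub>S.P\<^esub> (\<lambda>n. f (Suc n))) \<odot>\<^bsub>M\<^esub> x = (\<lambda>n. f (Suc n)) \<odot>\<^bsub>M\<^esub> (T \<odot>\<^bsub>M\<^esub> x)"
    using assms S.shift_closed[OF assms(1)] by (intro smult_assoc) auto
  finally show ?thesis .
qed

text \<open>Constants and t generate all scalars by x.f = x.f_0 + (x.t).g. The constants are taken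
  non-zero because \<open>v_scalar\<close> speaks of those; f_0 = 0 is absorbed by the zero of
  N.\<close>

lemma smult_induct_closed:
  assumes "x \<in> N" "f \<in> up K" and sub: "N \<subseteq> carrier M" and zero: "\<zero>\<^bsub>M\<^esub> \<in> N"
    and add: "\<And>x y. \<lbrakk>x \<in> N; y \<in> N\<rbrakk> \<Longrightarrow> x \<oplus>\<^bsub>M\<^esub> y \<in> N"
    and scalar: "\<And>a x. \<lbrakk>a \<in> carrier K - {\<zero>\<^bsub>K\<^esub>}; x \<in> N\<rbrakk> \<Longrightarrow> skew_monom K a 0 \<odot>\<^bsub>M\<^esub> x \<in> N"
    and t: "\<And>x. x \<in> N \<Longrightarrow> T \<odot>\<^bsub>M\<^esub> x \<in> N"
  shows "f \<odot>\<^bsub>M\<^esub> x \<in> N"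
proof -
  obtain n where "\<And>i. i \<ge> n \<Longrightarrow> f i = \<zero>\<^bsub>K\<^esub>" using S.up_obtain_bound[OF \<open>f \<in> up K\<close>] by blast
  then show ?thesis using \<open>x \<in> N\<close> \<open>f \<in> up K\<close>
  proof (induction n arbitrary: f x)
    case 0
    then have f: "f = \<zero>\<^bsub>S.P\<^esub>" by (auto simp: S.P_simps)
    have "x \<in> carrier M" using 0 sub by blast
    then show ?case unfolding f using zero by simp
  next
    case (Suc n)
    have "(\<lambda>n. f (Suc n)) \<odot>\<^bsub>M\<^esub> (T \<odot>\<^bsub>M\<^esub> x) \<in> N"
      using Suc.prems S.shift_closed t by (intro Suc.IH[of "\<lambda>n. f (Suc n)" "T \<odot>\<^bsub>M\<^esub> x"]) simp_all
    moreover have "skew_monom K (f 0) 0 \<odot>\<^bsub>M\<^esub> x \<in> N"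
      using Suc.prems scalar[of "f 0" x] zero sub by (cases "f 0 = \<zero>\<^bsub>K\<^esub>") auto
    ultimately show ?case using smult_split[of f x] Suc.prems sub add by auto
  qed
qed

lemma finite_support: "f \<in> up K \<Longrightarrow> finite {i. f i \<noteq> \<zero>\<^bsub>K\<^esub>}"
proof -
  assume "f \<in> up K"
  then obtain n where "\<And>i. i \<ge> n \<Longrightarrow> f i = \<zero>\<^bsub>K\<^esub>" using S.up_obtain_bound by blast
  then have "{i. f i \<noteq> \<zero>\<^bsub>K\<^esub>} \<subseteq> {..<n}" using not_le by auto
  then show ?thesis using finite_subset by blast
qed

lemma support_nonempty: "f \<noteq> \<zero>\<^bsub>S.P\<^esub> \<Longrightarrow> {i. f i \<noteq> \<zero>\<^bsub>K\<^esub>} \<noteq> {}"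
  by (auto simp: S.P_simps)

text \<open>The value \<omega> of 0 is fixed by \<tau>, so \<open>v_smult_nonfixed\<close> does not
  reach this instance of regularity.\<close>

lemma v_smult_zero:
  assumes "f \<in> up K" "f \<noteq> \<zero>\<^bsub>S.P\<^esub>"
  shows "v (f \<odot>\<^bsub>M\<^esub> \<zero>\<^bsub>M\<^esub>) = Min ((\<lambda>i. (\<tau> ^^ i) (v \<zero>\<^bsub>M\<^esub>)) ` {i. f i \<noteq> \<zero>\<^bsub>K\<^esub>})"
proof -
  have "(\<lambda>i. (\<tau> ^^ i) (v \<zero>\<^bsub>M\<^esub>)) ` {i. f i \<noteq> \<zero>\<^bsub>K\<^esub>} = {\<omega>}"
    using support_nonempty[OF assms(2)] by auto
  then show ?thesis using assms by simp
qed

text \<open>In x.f = x.f_0 + (x.t).g the first term is 0 or has value v x, while the value of the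
  second, if g is non-zero, is some \<tau>^(i+1)(v x), which differs from v x. Hence nothing
  cancels. The induction is on the length of f and varies x, as g acts on x.t.\<close>

lemma v_smult_nonfixed:
  assumes "f \<in> up K" "f \<noteq> \<zero>\<^bsub>S.P\<^esub>" "x \<in> carrier M" "\<tau> (v x) \<noteq> v x"
  shows "v (f \<odot>\<^bsub>M\<^esub> x) = Min ((\<lambda>i. (\<tau> ^^ i) (v x)) ` {i. f i \<noteq> \<zero>\<^bsub>K\<^esub>})"
proof -
  obtain n where "\<And>i. i \<ge> n \<Longrightarrow> f i = \<zero>\<^bsub>K\<^esub>" using S.up_obtain_bound[OF \<open>f \<in> up K\<close>] by blast
  then show ?thesis using assms
  proof (induction n arbitrary: f x)
    case 0
    then show ?case by (auto simp: S.P_simps)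
  next
    case (Suc n)
    define g where "g = (\<lambda>n. f (Suc n))"
    define S where "S = {i. g i \<noteq> \<zero>\<^bsub>K\<^esub>}"
    have g: "g \<in> up K" unfolding g_def using Suc.prems S.shift_closed by blast
    have split: "f \<odot>\<^bsub>M\<^esub> x = skew_monom K (f 0) 0 \<odot>\<^bsub>M\<^esub> x \<oplus>\<^bsub>M\<^esub> g \<odot>\<^bsub>M\<^esub> (T \<odot>\<^bsub>M\<^esub> x)"
      unfolding g_def using smult_split Suc.prems by blast
    have supp: "{i. f i \<noteq> \<zero>\<^bsub>K\<^esub>} = (if f 0 = \<zero>\<^bsub>K\<^esub> then {} else {0}) \<union> Suc ` S" (is "?F = _")
    proof (rule Set.set_eqI)
      show "i \<in> ?F \<longleftrightarrow> i \<in> (if f 0 = \<zero>\<^bsub>K\<^esub> then {} else {0}) \<union> Suc ` S" for i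
        by (cases i) (auto simp: S_def g_def)
    qed
    have f0: "f 0 \<in> carrier K" using Suc.prems by simp
    have fin: "finite S" unfolding S_def using finite_support[OF g] .
    show ?case
    proof (cases "g = \<zero>\<^bsub>S.P\<^esub>")
      case True
      then have "S = {}" by (auto simp: S_def S.P_simps)
      moreover have "f 0 \<noteq> \<zero>\<^bsub>K\<^esub>" using support_nonempty[OF Suc.prems(3)] unfolding supp \<open>S = {}\<close> by (simp split: if_splits)
      ultimately show ?thesis
        unfolding split supp using True Suc.prems v_scalar[of x "f 0"] f0 by simp
    next
      case False
      then have ne: "S \<noteq> {}" unfolding S_def using support_nonempty by blast
      \<comment> \<open>By injectivity of \<tau> the value of x.t is again not fixed, so the
        induction hypothesis applies to x.t.\<close>
      have "\<tau> (\<tau> (v x)) \<noteq> \<tau> (v x)" using tau_eq_iff Suc.prems by simp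
      then have "v (g \<odot>\<^bsub>M\<^esub> (T \<odot>\<^bsub>M\<^esub> x)) = Min ((\<lambda>i. (\<tau> ^^ i) (v (T \<odot>\<^bsub>M\<^esub> x))) ` S)"
        unfolding S_def using g False Suc.prems by (intro Suc.IH) (auto simp: v_t[unfolded One_nat_def] g_def)
      also have "(\<lambda>i. (\<tau> ^^ i) (v (T \<odot>\<^bsub>M\<^esub> x))) ` S = (\<lambda>i. (\<tau> ^^ i) (v x)) ` Suc ` S"
        unfolding image_image using Suc.prems by (simp add: v_t[unfolded One_nat_def] funpow_swap1)
      finally have vg: "v (g \<odot>\<^bsub>M\<^esub> (T \<odot>\<^bsub>M\<^esub> x)) = Min ((\<lambda>i. (\<tau> ^^ i) (v x)) ` Suc ` S)" .
      show ?thesis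
      proof (cases "f 0 = \<zero>\<^bsub>K\<^esub>")
        case True
        then show ?thesis unfolding split supp using vg Suc.prems g by simp
      next
        case False
        have v0: "v (skew_monom K (f 0) 0 \<odot>\<^bsub>M\<^esub> x) = v x" using v_scalar Suc.prems False f0 by simp
        have "Min ((\<lambda>i. (\<tau> ^^ i) (v x)) ` Suc ` S) \<in> (\<lambda>i. (\<tau> ^^ i) (v x)) ` Suc ` S"
          using fin ne by (intro Min_in) auto
        then have "Min ((\<lambda>i. (\<tau> ^^ i) (v x)) ` Suc ` S) \<noteq> v x"
          using funpow_tau_neq[OF v_closed[OF Suc.prems(4)] Suc.prems(5)]
          by (metis (no_types, lifting) imageE)
        then have "v (f \<odot>\<^bsub>M\<^esub> x) = min (v x) (Min ((\<lambda>i. (\<tau> ^^ i) (v x)) ` Suc ` S))"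
          unfolding split using v_add_neq vg v0 Suc.prems f0 g by simp
        also have "\<dots> = Min ((\<lambda>i. (\<tau> ^^ i) (v x)) ` ({0} \<union> Suc ` S))"
          using fin ne by simp
        finally show ?thesis unfolding supp using False by simp
      qed
    qed
  qed
qed

text \<open>Often it is enough that the value of x.f lies on the \<tau>-orbit of v x, because an
  orbit stays on its side of \<theta> and reaches \<omega> only from \<omega>.\<close>

lemma v_smult_in:
  assumes "f \<in> up K" "f \<noteq> \<zero>\<^bsub>S.P\<^esub>" "x \<in> carrier M" "\<tau> (v x) \<noteq> v x"
  obtains i where "v (f \<odot>\<^bsub>M\<^esub> x) = (\<tau> ^^ i) (v x)"
proof -
  have "v (f \<odot>\<^bsub>M\<^esub> x) \<in> (\<lambda>i. (\<tau> ^^ i) (v x)) ` {i. f i \<noteq> \<zero>\<^bsub>K\<^esub>}"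
    unfolding v_smult_nonfixed[OF assms]
    using finite_support[OF assms(1)] support_nonempty[OF assms(2)] by (intro Min_in) auto
  then show thesis using that by blast
qed

section \<open>The submodules above \<theta> and from \<theta> on\<close>

lemma gt_iff: "x \<in> gt \<longleftrightarrow> x \<in> carrier M \<and> v x \<in> chain_pos \<Delta> \<omega> \<tau>"
  by (simp add: val_gt_def)

lemma ge_iff: "x \<in> ge \<longleftrightarrow> x \<in> carrier M \<and> v x \<notin> chain_neg \<Delta> \<tau>"
  by (simp add: val_ge_def)

lemma gt_subset_ge: "gt \<subseteq> ge"
  using pos_not_neg by (auto simp: gt_iff ge_iff)

lemma gt_submodule: "submodule gt S.P M"
proof (rule submoduleI)
  show "gt \<subseteq> carrier M" by (auto simp: gt_iff)
  show zero: "\<zero>\<^bsub>M\<^esub> \<in> gt" by (simp add: gt_iff pos_iff omega_mem)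
  show add: "x \<oplus>\<^bsub>M\<^esub> y \<in> gt" if "x \<in> gt" "y \<in> gt" for x y
    using that v_add[of x y] pos_upward[of "min (v x) (v y)" "v (x \<oplus>\<^bsub>M\<^esub> y)"]
    by (auto simp: gt_iff min_def split: if_splits)
  fix f x assume "f \<in> carrier S.P" "x \<in> gt"
  then show "f \<odot>\<^bsub>M\<^esub> x \<in> gt"
    using \<open>gt \<subseteq> carrier M\<close> zero add
    by (intro smult_induct_closed[of x gt f]) (simp_all add: gt_iff v_scalar v_t[unfolded One_nat_def] tau_pos_iff)
qed

lemma ge_submodule: "submodule ge S.P M"
proof (rule submoduleI)
  show "ge \<subseteq> carrier M" by (auto simp: ge_iff)
  show zero: "\<zero>\<^bsub>M\<^esub> \<in> ge" by (simp add: ge_iff neg_iff tau_omega)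
  show add: "x \<oplus>\<^bsub>M\<^esub> y \<in> ge" if "x \<in> ge" "y \<in> ge" for x y
    using that v_add[of x y] neg_downward[of "v (x \<oplus>\<^bsub>M\<^esub> y)" "min (v x) (v y)"]
    by (auto simp: ge_iff min_def split: if_splits)
  fix f x assume "f \<in> carrier S.P" "x \<in> ge"
  then show "f \<odot>\<^bsub>M\<^esub> x \<in> ge"
    using \<open>ge \<subseteq> carrier M\<close> zero add
    by (intro smult_induct_closed[of x ge f]) (simp_all add: ge_iff v_scalar v_t[unfolded One_nat_def] tau_neg_iff)
qed

text \<open>An element of value below \<theta> keeps such a value under every non-zero scalar. This
  places the torsion in \<open>ge\<close> and also makes \<open>ge\<close> closed under
  division.\<close>

lemma smult_mem_ge_iff:
  assumes "f \<in> up K" "f \<noteq> \<zero>\<^bsub>S.P\<^esub>" "x \<in> carrier M"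
  shows "f \<odot>\<^bsub>M\<^esub> x \<in> ge \<longleftrightarrow> x \<in> ge"
proof
  assume ge: "f \<odot>\<^bsub>M\<^esub> x \<in> ge"
  show "x \<in> ge"
  proof (rule ccontr)
    assume "x \<notin> ge"
    then have neg: "v x \<in> chain_neg \<Delta> \<tau>" using assms by (simp add: ge_iff)
    then have "\<tau> (v x) \<noteq> v x" by (auto simp: neg_iff)
    then obtain i where "v (f \<odot>\<^bsub>M\<^esub> x) = (\<tau> ^^ i) (v x)" by (rule v_smult_in[OF assms])
    then show False using ge funpow_tau_neg[OF neg] by (simp add: ge_iff)
  qed
qed (use assms submoduleD(7)[OF ge_submodule] in simp)

text \<open>Values above \<theta> other than \<omega> are not fixed, and no iterate of \<tau> sends
  them to \<omega>.\<close>

lemma smult_gt_eq_zero: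
  assumes "f \<in> up K" "f \<noteq> \<zero>\<^bsub>S.P\<^esub>" "x \<in> gt" "f \<odot>\<^bsub>M\<^esub> x = \<zero>\<^bsub>M\<^esub>"
  shows "x = \<zero>\<^bsub>M\<^esub>"
proof (rule ccontr)
  assume "x \<noteq> \<zero>\<^bsub>M\<^esub>"
  then have x: "x \<in> carrier M" "v x \<noteq> \<omega>" "\<tau> (v x) \<noteq> v x"
    using assms(3) v_eq_omega by (auto simp: gt_iff pos_iff)
  then obtain i where "v (f \<odot>\<^bsub>M\<^esub> x) = (\<tau> ^^ i) (v x)" using v_smult_in[OF assms(1,2)] by blast
  then show False using assms(4) x(1,2) funpow_tau_eq_omega_iff[of "v x" i] by simp
qed

lemma gt_inter_tor: "gt \<inter> tor \<subseteq> {\<zero>\<^bsub>M\<^esub>}"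
proof
  fix x assume "x \<in> gt \<inter> tor"
  then show "x \<in> {\<zero>\<^bsub>M\<^esub>}" using smult_gt_eq_zero[of _ x] by (auto simp: torsion_def)
qed

lemma tor_subset_ge: "tor \<subseteq> ge"
proof
  fix x assume "x \<in> tor"
  then obtain f where f: "f \<in> up K" "f \<noteq> \<zero>\<^bsub>S.P\<^esub>" "x \<in> carrier M" "f \<odot>\<^bsub>M\<^esub> x = \<zero>\<^bsub>M\<^esub>"
    by (auto simp: torsion_def)
  then show "x \<in> ge" using smult_mem_ge_iff[OF f(1-3)] submoduleD(3)[OF ge_submodule] by simp
qed

text \<open>For x outside \<open>ge\<close>, v x lies strictly below every value on
  \<open>ge\<close>, so adding an element of \<open>ge\<close> does not change it. The image of the
  coset under v is therefore a singleton and \<open>the_elem\<close> is meaningful.\<close>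

lemma quotient_val_coset:
  assumes x: "x \<in> carrier M"
  shows "quotient_val ge \<omega> v (ge +>\<^bsub>M\<^esub> x) = (if x \<in> ge then \<omega> else v x)"
proof (cases "x \<in> ge")
  case False
  have "v (g \<oplus>\<^bsub>M\<^esub> x) = v x" if "g \<in> ge" for g
    using that False x neg_less[of "v x" "v g"] v_add_less[of x g] M.a_comm[of g x] by (simp add: ge_iff)
  then have "v ` (ge +>\<^bsub>M\<^esub> x) = {v x}"
    using submoduleD(3)[OF ge_submodule] by (auto simp: a_r_coset_def' image_UN)
  then show ?thesis
    using False coset_eq_zero_iff[OF ge_submodule x] by (simp add: quotient_val_def)
qed (use coset_eq_zero_iff[OF ge_submodule x] in \<open>simp add: quotient_val_def\<close>)

text \<open>The chain shrinks to the values taken on N. It is closed under \<tau> because N is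
  closed under t, and the order conditions pass to subsets.\<close>

lemma restrict_valued_module:
  assumes N: "submodule N S.P M"
  shows "valued_module K \<phi> (restrict_module M N) (v ` N) \<omega> \<tau> v"
proof -
  note D = submoduleD[OF N]
  interpret N: right_module S.P "restrict_module M N" by (rule restrict_right_module) fact
  have "tau_chain (v ` N) \<omega> \<tau>"
  proof
    show "\<omega> \<in> v ` N" using D(3) v_zero by (metis image_eqI)
    show "\<gamma> \<le> \<omega>" if "\<gamma> \<in> v ` N" for \<gamma> using that D(2) v_le_omega by blast
    show "\<tau> \<in> v ` N \<rightarrow> v ` N"
    proof
      fix \<gamma> assume "\<gamma> \<in> v ` N"
      then obtain x where x: "x \<in> N" "\<gamma> = v x" by blast
      then have "\<tau> \<gamma> = v (T \<odot>\<^bsub>M\<^esub> x)" using v_t D(2) by simp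
      then show "\<tau> \<gamma> \<in> v ` N" using D(7)[of T x] x by simp
    qed
    have sub: "v ` N \<subseteq> \<Delta>" using D(2) by auto
    show "strict_mono_on (v ` N) \<tau>" using tau_strict_mono sub by (rule monotone_on_subset)
    show "\<tau> \<delta> < \<delta>" if "\<gamma> \<in> v ` N" "\<gamma> \<noteq> \<omega>" "\<delta> \<in> v ` N" "\<tau> \<gamma> \<le> \<gamma>" "\<delta> < \<gamma>" for \<gamma> \<delta>
      using that sub tau_below by blast
  qed (rule tau_omega)
  moreover have "valued_module_axioms K (restrict_module M N) (v ` N) \<omega> \<tau> v"
  proof
    show "inj_on (\<lambda>x. T \<odot>\<^bsub>restrict_module M N\<^esub> x) (carrier (restrict_module M N))"
      using t_inj D(1) by (simp add: inj_on_subset)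
  qed (use D(2) v_eq_omega v_add v_diff v_scalar v_t a_minus_restrict[OF N] in auto)
  ultimately show ?thesis using N.right_module_axioms by (intro valued_module.intro)
qed

lemma regular_submoduleI:
  assumes N: "submodule N S.P M"
    and reg: "\<And>f x. \<lbrakk>f \<in> up K; f \<noteq> \<zero>\<^bsub>S.P\<^esub>; x \<in> N; x \<noteq> \<zero>\<^bsub>M\<^esub>\<rbrakk> \<Longrightarrow>
      v (f \<odot>\<^bsub>M\<^esub> x) = Min ((\<lambda>i. (\<tau> ^^ i) (v x)) ` {i. f i \<noteq> \<zero>\<^bsub>K\<^esub>})"
  shows "regular_submodule K \<phi> M \<omega> \<tau> v N"
proof -
  have "v (f \<odot>\<^bsub>M\<^esub> x) = Min ((\<lambda>i. (\<tau> ^^ i) (v x)) ` {i. f i \<noteq> \<zero>\<^bsub>K\<^esub>})"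
    if "f \<in> up K" "f \<noteq> \<zero>\<^bsub>S.P\<^esub>" "x \<in> N" for f x
    using reg[OF that] v_smult_zero[OF that(1,2)] by (cases "x = \<zero>\<^bsub>M\<^esub>") auto
  then have "regular_valued_module K \<phi> (restrict_module M N) (v ` N) \<omega> \<tau> v"
    by (intro regular_valued_module.intro regular_valued_module_axioms.intro restrict_valued_module N)
      simp
  then show ?thesis using N unfolding regular_submodule_def by blast
qed

end

section \<open>The decomposition of a divisible henselian module\<close>

locale divisible_henselian_module = henselian_valued_module K \<phi> M \<Delta> \<omega> \<tau> v + S: skew_polynomials K \<phi> +
    divisible_module "skew_poly_ring K \<phi>" M
  for K \<phi> M \<Delta> \<omega> \<tau> v

sublocale divisible_henselian_module \<subseteq> skew_valued_module
  by (intro skew_valued_module.intro valued_module_axioms S.skew_polynomials_axioms)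

context divisible_henselian_module
begin

text \<open>Induction on the length of f. If f_0 = 0, then f = t g and x.f = (x.t).g, so z.g = y is
  solved in \<open>gt\<close> first and z is then divided by t in M; \<open>tau_pos_iff\<close>
  shows that the result is back in \<open>gt\<close>.\<close>

lemma gt_divisible: "divisible_module S.P (restrict_module M gt)"
proof (rule divisible_submoduleI[OF gt_submodule])
  fix f y assume "f \<in> carrier S.P" "f \<noteq> \<zero>\<^bsub>S.P\<^esub>" and y: "y \<in> gt"
  then have f: "f \<in> up K" "f \<noteq> \<zero>\<^bsub>S.P\<^esub>" by auto
  obtain n where "\<And>i. i \<ge> n \<Longrightarrow> f i = \<zero>\<^bsub>K\<^esub>" using S.up_obtain_bound[OF f(1)] by blast
  then show "\<exists>x\<in>gt. f \<odot>\<^bsub>M\<^esub> x = y" using f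
  proof (induction n arbitrary: f)
    case 0
    then show ?case by (auto simp: S.P_simps)
  next
    case (Suc n)
    show ?case
    proof (cases "f 0 = \<zero>\<^bsub>K\<^esub>")
      case False
      then show ?thesis using henselian[of f y] Suc.prems(2) y by (simp add: separable_def)
    next
      case True
      define g where "g = (\<lambda>n. f (Suc n))"
      have g: "g \<in> up K" unfolding g_def using S.shift_closed Suc.prems(2) by blast
      have "g \<noteq> \<zero>\<^bsub>S.P\<^esub>"
      proof
        assume "g = \<zero>\<^bsub>S.P\<^esub>"
        then have "f i = \<zero>\<^bsub>K\<^esub>" for i using True by (cases i) (auto simp: g_def S.P_simps fun_eq_iff)
        then show False using Suc.prems(3) by (auto simp: S.P_simps)
      qed
      then obtain z where z: "z \<in> gt" "g \<odot>\<^bsub>M\<^esub> z = y"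
        using Suc.IH[OF _ g] Suc.prems(1) by (auto simp: g_def)
      have zM: "z \<in> carrier M" using z by (simp add: gt_iff)
      have "T \<noteq> \<zero>\<^bsub>S.P\<^esub>" by (auto simp: S.P_simps skew_monom_def fun_eq_iff)
      then obtain x where x: "x \<in> carrier M" "T \<odot>\<^bsub>M\<^esub> x = z" using divisibleE[of T z] zM by auto
      have "v z = \<tau> (v x)" using v_t[OF x(1)] x(2) by simp
      then have "x \<in> gt" using z x(1) tau_pos_iff by (simp add: gt_iff)
      moreover have "f \<odot>\<^bsub>M\<^esub> x = y"
        unfolding smult_split[OF Suc.prems(2) x(1)] x(2) using True z(2) x(1) submoduleD(2)[OF gt_submodule y]
        by (simp add: g_def)
      ultimately show ?thesis by blast
    qed
  qed
qed

text \<open>A solution found in M lies in \<open>ge\<close> by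
  \<open>smult_mem_ge_iff\<close>.\<close>

lemma ge_divisible: "divisible_module S.P (restrict_module M ge)"
proof (rule divisible_submoduleI[OF ge_submodule])
  fix f y assume f: "f \<in> carrier S.P" "f \<noteq> \<zero>\<^bsub>S.P\<^esub>" and y: "y \<in> ge"
  obtain x where "x \<in> carrier M" "f \<odot>\<^bsub>M\<^esub> x = y"
    using divisibleE[OF f submoduleD(2)[OF ge_submodule y]] .
  then show "\<exists>x\<in>ge. f \<odot>\<^bsub>M\<^esub> x = y" using smult_mem_ge_iff f y by auto
qed

lemma tor_divisible: "divisible_module S.P (restrict_module M tor)"
  using divisible_module_axioms by (rule torsion_divisible)

lemma tor_gt_submodule: "submodule (tor <+>\<^bsub>M\<^esub> gt) S.P M"
  using torsion_submodule gt_submodule by (rule submodule_sum)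

lemma tor_gt_divisible: "divisible_module S.P (restrict_module M (tor <+>\<^bsub>M\<^esub> gt))"
  by (intro divisible_sum torsion_submodule gt_submodule tor_divisible gt_divisible)

lemma tor_gt_subset_ge: "tor <+>\<^bsub>M\<^esub> gt \<subseteq> ge"
proof
  fix x assume "x \<in> tor <+>\<^bsub>M\<^esub> gt"
  then obtain a b where "a \<in> tor" "b \<in> gt" "x = a \<oplus>\<^bsub>M\<^esub> b" unfolding set_add_iff by blast
  then show "x \<in> ge"
    using tor_subset_ge gt_subset_ge submoduleD(4)[OF ge_submodule, of a b] by auto
qed

text \<open>The sum of \<open>tor\<close> and \<open>gt\<close> must be split off inside
  \<open>ge\<close>, so the general results on modules are made available for \<open>ge\<close> as a
  module of its own.\<close>

sublocale ge: right_pid_module S.P "restrict_module M ge"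
  by (rule restrict_right_pid_module[OF ge_submodule])

sublocale ge: divisible_module S.P "restrict_module M ge"
  by (rule ge_divisible)

lemma ge_torsion: "torsion S.P (restrict_module M ge) = tor"
  using tor_subset_ge by (auto simp: torsion_def dest: submoduleD(2)[OF ge_submodule])

lemma gt_submodule_ge: "submodule gt S.P (restrict_module M ge)"
  and tor_submodule_ge: "submodule tor S.P (restrict_module M ge)"
  and tor_gt_submodule_ge: "submodule (tor <+>\<^bsub>M\<^esub> gt) S.P (restrict_module M ge)"
  by (intro submodule_restrict ge_submodule gt_submodule gt_subset_ge torsion_submodule tor_subset_ge
      tor_gt_submodule tor_gt_subset_ge)+

lemma tor_embedding:
  "(\<lambda>x. gt +>\<^bsub>M\<^esub> x) \<in> right_module_embedding S.P (restrict_module M tor)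
     (quotient_module (restrict_module M ge) gt)"
  using ge.coset_map_embedding[OF gt_submodule_ge tor_submodule_ge] gt_inter_tor by auto

text \<open>Whatever the embedding, it carries the divisible module \<open>tor\<close> onto a
  divisible submodule, and such a submodule splits off.\<close>

lemma tor_embedding_direct_summand:
  assumes "f \<in> right_module_embedding S.P (restrict_module M tor)
     (quotient_module (restrict_module M ge) gt)"
  shows "direct_summand S.P (quotient_module (restrict_module M ge) gt) (f ` tor)"
proof -
  interpret Q: right_pid_module S.P "quotient_module (restrict_module M ge) gt"
    by (rule ge.quotient_right_pid_module[OF gt_submodule_ge])
  interpret tor: divisible_module S.P "restrict_module M tor" by (rule tor_divisible)
  show ?thesis
    using tor.divisible_image[OF Q.right_module_axioms, of f] assms
    by (intro Q.divisible_direct_summand) (auto simp: right_module_embedding_def)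
qed

lemma gt_torsion_free: "torsion_free_module S.P (restrict_module M gt)"
  using gt_submodule gt_inter_tor by (rule torsion_free_submodule)

lemma quotient_ge_torsion_free: "torsion_free_module S.P (quotient_module M ge)"
  using ge_submodule ge_divisible tor_subset_ge by (rule torsion_free_quotient_by_divisible)

lemma quotient_tor_gt_torsion_free:
  "torsion_free_module S.P (quotient_module (restrict_module M ge) (tor <+>\<^bsub>M\<^esub> gt))"
  using subset_sum(1)[OF torsion_submodule gt_submodule] tor_gt_divisible
  by (intro ge.torsion_free_quotient_by_divisible[OF tor_gt_submodule_ge]) (simp_all add: ge_torsion)

text \<open>Both values are \<theta>, the only value between the two segments of the chain.\<close>

lemma ge_not_gt_value:
  assumes "x \<in> ge" "x \<notin> gt" "y \<in> ge" "y \<notin> gt"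
  shows "v x = v y"
  using assms by (intro tau_fixed_unique) (auto simp: gt_iff ge_iff)

end

text \<open>The two complements are arbitrary: everything claimed about them follows from the six
  conditions below. \<open>M_theta\<close> complements the whole of \<open>tor\<close> plus
  \<open>gt\<close> within \<open>ge\<close>, which is more than avoiding \<open>tor\<close> and
  \<open>gt\<close> separately; \<open>v_decomposition\<close> relies on this.\<close>

locale henselian_decomposition = divisible_henselian_module K \<phi> M \<Delta> \<omega> \<tau> v
  for K \<phi> M \<Delta> \<omega> \<tau> v +
  fixes M_theta M_minus
  assumes theta_sub: "submodule M_theta (skew_poly_ring K \<phi>) (restrict_module M ge)"
    and theta_sum: "(tor <+>\<^bsub>M\<^esub> gt) <+>\<^bsub>M\<^esub> M_theta = ge"
    and theta_int: "(tor <+>\<^bsub>M\<^esub> gt) \<inter> M_theta = {\<zero>\<^bsub>M\<^esub>}"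
    and minus_sub: "submodule M_minus (skew_poly_ring K \<phi>) M"
    and minus_sum: "ge <+>\<^bsub>M\<^esub> M_minus = carrier M"
    and minus_int: "ge \<inter> M_minus = {\<zero>\<^bsub>M\<^esub>}"

lemma (in divisible_henselian_module) henselian_decomposition_exists:
  obtains M_theta M_minus where "henselian_decomposition K \<phi> M \<Delta> \<omega> \<tau> v M_theta M_minus"
proof -
  have "direct_summand S.P (restrict_module M ge) (tor <+>\<^bsub>M\<^esub> gt)"
    using tor_gt_divisible by (intro ge.divisible_direct_summand tor_gt_submodule_ge) simp
  moreover have "direct_summand S.P M ge"
    using ge_divisible by (intro divisible_direct_summand ge_submodule)
  ultimately show thesis
    using that divisible_henselian_module_axioms
    unfolding direct_summand_def henselian_decomposition_def henselian_decomposition_axioms_def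
    by auto
qed

section \<open>Regularity and independence of the four summands\<close>

context henselian_decomposition
begin

lemma theta_submodule: "submodule M_theta S.P M" and theta_subset_ge: "M_theta \<subseteq> ge"
  using submodule_of_restrict[OF ge_submodule theta_sub] by blast+

lemma tor_carrier: "x \<in> tor \<Longrightarrow> x \<in> carrier M"
  and theta_carrier: "x \<in> M_theta \<Longrightarrow> x \<in> carrier M"
  and gt_carrier: "x \<in> gt \<Longrightarrow> x \<in> carrier M"
  and minus_carrier: "x \<in> M_minus \<Longrightarrow> x \<in> carrier M"
  using submoduleD(2)[OF torsion_submodule] submoduleD(2)[OF theta_submodule]
    submoduleD(2)[OF gt_submodule] submoduleD(2)[OF minus_sub] by blast+

lemma theta_divisible: "divisible_module S.P (restrict_module M M_theta)"
  using ge.divisible_complement[OF tor_gt_submodule_ge theta_sub] theta_sum theta_int by simp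

lemma minus_divisible: "divisible_module S.P (restrict_module M M_minus)"
  using divisible_complement[OF ge_submodule minus_sub] minus_sum minus_int by simp

lemma theta_inter_tor: "M_theta \<inter> tor \<subseteq> {\<zero>\<^bsub>M\<^esub>}"
  using theta_int subset_sum(1)[OF torsion_submodule gt_submodule] by blast

lemma theta_inter_gt: "M_theta \<inter> gt \<subseteq> {\<zero>\<^bsub>M\<^esub>}"
  using theta_int subset_sum(2)[OF torsion_submodule gt_submodule] by blast

lemma minus_inter_tor: "M_minus \<inter> tor \<subseteq> {\<zero>\<^bsub>M\<^esub>}"
  using minus_int tor_subset_ge by blast

lemma theta_torsion_free: "torsion_free_module S.P (restrict_module M M_theta)"
  using theta_submodule theta_inter_tor by (rule torsion_free_submodule)

lemma minus_torsion_free: "torsion_free_module S.P (restrict_module M M_minus)"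
  using minus_sub minus_inter_tor by (rule torsion_free_submodule)

lemma gt_regular: "regular_submodule K \<phi> M \<omega> \<tau> v gt"
proof (rule regular_submoduleI[OF gt_submodule])
  fix f x assume f: "f \<in> up K" "f \<noteq> \<zero>\<^bsub>S.P\<^esub>" and x: "x \<in> gt" "x \<noteq> \<zero>\<^bsub>M\<^esub>"
  then show "v (f \<odot>\<^bsub>M\<^esub> x) = Min ((\<lambda>i. (\<tau> ^^ i) (v x)) ` {i. f i \<noteq> \<zero>\<^bsub>K\<^esub>})"
    using v_eq_omega[of x] by (intro v_smult_nonfixed) (auto simp: gt_iff pos_iff)
qed

lemma minus_regular: "regular_submodule K \<phi> M \<omega> \<tau> v M_minus"
proof (rule regular_submoduleI[OF minus_sub])
  fix f x assume f: "f \<in> up K" "f \<noteq> \<zero>\<^bsub>S.P\<^esub>" and x: "x \<in> M_minus" "x \<noteq> \<zero>\<^bsub>M\<^esub>"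
  then have "x \<notin> ge" using minus_int by blast
  then show "v (f \<odot>\<^bsub>M\<^esub> x) = Min ((\<lambda>i. (\<tau> ^^ i) (v x)) ` {i. f i \<noteq> \<zero>\<^bsub>K\<^esub>})"
    using f x minus_carrier by (intro v_smult_nonfixed) (auto simp: ge_iff neg_iff)
qed

text \<open>For non-zero x here v x = \<theta>, so all \<tau>^i(v x) equal \<theta> and the claim is
  that x.f has value \<theta> too. It does: x.f is non-zero as \<open>M_theta\<close> contains no
  torsion, and \<open>M_theta\<close> meets \<open>gt\<close> in 0 only.\<close>

lemma theta_regular: "regular_submodule K \<phi> M \<omega> \<tau> v M_theta"
proof (rule regular_submoduleI[OF theta_submodule])
  fix f x assume f: "f \<in> up K" "f \<noteq> \<zero>\<^bsub>S.P\<^esub>" and x: "x \<in> M_theta" "x \<noteq> \<zero>\<^bsub>M\<^esub>"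
  have c: "x \<in> carrier M" using x theta_carrier by blast
  have fx: "f \<odot>\<^bsub>M\<^esub> x \<in> M_theta" using submoduleD(7)[OF theta_submodule] f x by simp
  have "f \<odot>\<^bsub>M\<^esub> x \<noteq> \<zero>\<^bsub>M\<^esub>"
    using torsionI[OF c, of f] f x theta_inter_tor by auto
  then have mem: "x \<in> ge" "x \<notin> gt" "f \<odot>\<^bsub>M\<^esub> x \<in> ge" "f \<odot>\<^bsub>M\<^esub> x \<notin> gt"
    using x fx theta_inter_gt theta_subset_ge by blast+
  then have "v (f \<odot>\<^bsub>M\<^esub> x) = v x" by (intro ge_not_gt_value)
  moreover have "\<tau> (v x) = v x" using mem c by (intro tau_fixed) (auto simp: gt_iff ge_iff)
  then have "(\<tau> ^^ i) (v x) = v x" for i by (induction i) auto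
  then have "(\<lambda>i. (\<tau> ^^ i) (v x)) ` {i. f i \<noteq> \<zero>\<^bsub>K\<^esub>} = {v x}"
    using support_nonempty[OF f(2)] by auto
  ultimately show "v (f \<odot>\<^bsub>M\<^esub> x) = Min ((\<lambda>i. (\<tau> ^^ i) (v x)) ` {i. f i \<noteq> \<zero>\<^bsub>K\<^esub>})" by simp
qed

lemma theta_iso:
  "(\<lambda>x. (tor <+>\<^bsub>M\<^esub> gt) +>\<^bsub>M\<^esub> x) \<in> right_module_iso S.P (restrict_module M M_theta)
     (quotient_module (restrict_module M ge) (tor <+>\<^bsub>M\<^esub> gt))"
  using ge.coset_map_iso[OF tor_gt_submodule_ge theta_sub] theta_sum theta_int by simp

text \<open>The only element of \<open>M_minus\<close> in \<open>ge\<close> is 0, where both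
  valuations give \<omega>; every other element has the value of its coset.\<close>

lemma minus_iso:
  "(\<lambda>x. ge +>\<^bsub>M\<^esub> x) \<in> valued_module_iso S.P (restrict_module M M_minus) v
     (quotient_module M ge) (quotient_val ge \<omega> v)"
proof -
  have "quotient_val ge \<omega> v (ge +>\<^bsub>M\<^esub> x) = v x" if "x \<in> M_minus" for x
  proof (cases "x \<in> ge")
    case True
    then have "x = \<zero>\<^bsub>M\<^esub>" using that minus_int by blast
    then show ?thesis using True quotient_val_coset[of x] by simp
  qed (use that quotient_val_coset minus_carrier in simp)
  then show ?thesis
    using coset_map_iso[OF ge_submodule minus_sub minus_sum] minus_int
    by (simp add: valued_module_iso_def)
qed

text \<open>The summands are added one at a time. Non-zero a and b both have value \<theta>, and so
  has a + b because it stays outside \<open>gt\<close>; c then has a larger value unless a + b = 0,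
  and d a smaller one unless d = 0.\<close>

lemma v_decomposition:
  assumes a: "a \<in> tor" and b: "b \<in> M_theta" and c: "c \<in> gt" and d: "d \<in> M_minus"
  shows "v (a \<oplus>\<^bsub>M\<^esub> (b \<oplus>\<^bsub>M\<^esub> (c \<oplus>\<^bsub>M\<^esub> d))) = min (v a) (min (v b) (min (v c) (v d)))"
proof -
  have M: "a \<in> carrier M" "b \<in> carrier M" "c \<in> carrier M" "d \<in> carrier M"
    using a b c d tor_carrier theta_carrier gt_carrier minus_carrier by auto
  have ge: "a \<in> ge" "b \<in> ge" "c \<in> ge" using a b c tor_subset_ge theta_subset_ge gt_subset_ge by auto
  then have ab_ge: "a \<oplus>\<^bsub>M\<^esub> b \<in> ge" and abc_ge: "(a \<oplus>\<^bsub>M\<^esub> b) \<oplus>\<^bsub>M\<^esub> c \<in> ge"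
    using submoduleD(4)[OF ge_submodule] by blast+
  \<comment> \<open>If a + b lies in \<open>gt\<close>, then b = (a + b) - a lies in
    \<open>tor\<close> plus \<open>gt\<close> and so is 0, which leaves a in both \<open>gt\<close>
    and \<open>tor\<close>.\<close>
  have ab_gt: "a = \<zero>\<^bsub>M\<^esub> \<and> b = \<zero>\<^bsub>M\<^esub>" if ab: "a \<oplus>\<^bsub>M\<^esub> b \<in> gt"
  proof -
    have "b = (a \<oplus>\<^bsub>M\<^esub> b) \<ominus>\<^bsub>M\<^esub> a" using M by (simp add: M.a_comm[of a] M.add_diff_cancel)
    moreover have "\<dots> \<in> tor <+>\<^bsub>M\<^esub> gt"
      using ab a subset_sum[OF torsion_submodule gt_submodule] submoduleD(6)[OF tor_gt_submodule] by blast
    ultimately have "b = \<zero>\<^bsub>M\<^esub>" using b theta_int by auto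
    then show ?thesis using ab a M gt_inter_tor by auto
  qed
  have "v (a \<oplus>\<^bsub>M\<^esub> b) = min (v a) (v b)"
  proof (cases "a = \<zero>\<^bsub>M\<^esub> \<or> b = \<zero>\<^bsub>M\<^esub>")
    case False
    then have "a \<notin> gt" "b \<notin> gt" "a \<oplus>\<^bsub>M\<^esub> b \<notin> gt"
      using a b gt_inter_tor theta_inter_gt ab_gt by auto
    then have "v a = v b" "v (a \<oplus>\<^bsub>M\<^esub> b) = v b" using ge ab_ge ge_not_gt_value by blast+
    then show ?thesis by simp
  qed (use M in \<open>simp add: v_add_zero\<close>)
  moreover have "v ((a \<oplus>\<^bsub>M\<^esub> b) \<oplus>\<^bsub>M\<^esub> c) = min (v (a \<oplus>\<^bsub>M\<^esub> b)) (v c)"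
  proof (cases "a \<oplus>\<^bsub>M\<^esub> b \<in> gt")
    case True
    then show ?thesis using ab_gt M v_add_zero[of "a \<oplus>\<^bsub>M\<^esub> b" c] by auto
  next
    case False
    then have "v (a \<oplus>\<^bsub>M\<^esub> b) < v c" using less_pos c M by (auto simp: gt_iff)
    then show ?thesis using M v_add_neq by auto
  qed
  moreover have "v (((a \<oplus>\<^bsub>M\<^esub> b) \<oplus>\<^bsub>M\<^esub> c) \<oplus>\<^bsub>M\<^esub> d) = min (v ((a \<oplus>\<^bsub>M\<^esub> b) \<oplus>\<^bsub>M\<^esub> c)) (v d)"
  proof (cases "d \<in> ge")
    case True
    then show ?thesis using d minus_int M v_add_zero[of "(a \<oplus>\<^bsub>M\<^esub> b) \<oplus>\<^bsub>M\<^esub> c" d] by auto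
  next
    case False
    then have "v d < v ((a \<oplus>\<^bsub>M\<^esub> b) \<oplus>\<^bsub>M\<^esub> c)"
      using neg_less abc_ge M by (auto simp: ge_iff)
    then show ?thesis using M v_add_neq by auto
  qed
  ultimately show ?thesis using M by (simp add: M.a_assoc min.assoc)
qed

abbreviation "summands \<equiv> [tor, M_theta, gt, M_minus]"

lemma finsum_lessThan_4:
  assumes "\<And>i. i < 4 \<Longrightarrow> x i \<in> carrier M"
  shows "(\<Oplus>\<^bsub>M\<^esub>i\<in>{..<4::nat}. x i) = x 0 \<oplus>\<^bsub>M\<^esub> (x 1 \<oplus>\<^bsub>M\<^esub> (x 2 \<oplus>\<^bsub>M\<^esub> x 3))"
proof -
  have "{..<4::nat} = {0, 1, 2, 3}" by auto
  then show ?thesis using assms by (simp add: M.finsum_insert)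
qed

lemma summands_iff:
  "(\<forall>i\<in>{..<4}. x i \<in> summands ! i) \<longleftrightarrow> x 0 \<in> tor \<and> x 1 \<in> M_theta \<and> x 2 \<in> gt \<and> x 3 \<in> M_minus"
proof -
  have "{..<4::nat} = {0, 1, 2, 3}" by auto
  then show ?thesis by simp
qed

lemma summands_carrier:
  assumes "\<forall>i\<in>{..<4}. x i \<in> summands ! i" "i < 4"
  shows "x i \<in> carrier M"
proof -
  have "i = 0 \<or> i = 1 \<or> i = 2 \<or> i = 3" using assms(2) by auto
  then show ?thesis
    using assms(1) tor_carrier theta_carrier gt_carrier minus_carrier unfolding summands_iff by blast
qed

lemma summands_submodule: "i < 4 \<Longrightarrow> submodule (summands ! i) S.P M"
  using torsion_submodule theta_submodule gt_submodule minus_sub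
  by (auto simp: less_Suc_eq numeral_eq_Suc)

lemma summands_valuation_independent: "valuation_independent M v {..<4} ((!) summands)"
  unfolding valuation_independent_def
proof (intro allI impI)
  fix J x assume "finite J \<and> J \<noteq> {} \<and> J \<subseteq> {..<4::nat} \<and> (\<forall>i\<in>J. x i \<in> summands ! i)"
  then have J: "finite J" "J \<noteq> {}" "J \<subseteq> {..<4}" and x: "\<And>i. i \<in> J \<Longrightarrow> x i \<in> summands ! i" by auto
  \<comment> \<open>The subfamily is padded with zeros to all four indices. A zero has value
    \<omega>, the maximum, so it lowers neither side, and the minimum over the non-empty J is
    unchanged.\<close>
  define y where "y i = (if i \<in> J then x i else \<zero>\<^bsub>M\<^esub>)" for i
  have y: "\<forall>i\<in>{..<4}. y i \<in> summands ! i"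
    using x submoduleD(3)[OF summands_submodule] by (auto simp: y_def)
  have "(\<Oplus>\<^bsub>M\<^esub>i\<in>J. x i) = (\<Oplus>\<^bsub>M\<^esub>i\<in>{..<4}. y i)"
    using J(3) summands_carrier[OF y] by (intro M.add.finprod_mono_neutral_cong_left) (auto simp: y_def)
  also have "\<dots> = y 0 \<oplus>\<^bsub>M\<^esub> (y 1 \<oplus>\<^bsub>M\<^esub> (y 2 \<oplus>\<^bsub>M\<^esub> y 3))"
    using summands_carrier[OF y] by (rule finsum_lessThan_4)
  also have "v \<dots> = min (v (y 0)) (min (v (y 1)) (min (v (y 2)) (v (y 3))))"
    using v_decomposition y unfolding summands_iff by blast
  also have "\<dots> = Min ((\<lambda>i. v (y i)) ` {..<4})"
  proof -
    have "{..<4::nat} = {0, 1, 2, 3}" by auto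
    then show ?thesis by simp
  qed
  also have "\<dots> = Min ((\<lambda>i. v (x i)) ` J)"
  proof (rule Min_eqI)
    have "Min ((\<lambda>i. v (x i)) ` J) \<in> (\<lambda>i. v (x i)) ` J" using J by (intro Min_in) auto
    then obtain j where j: "j \<in> J" "Min ((\<lambda>i. v (x i)) ` J) = v (x j)" by blast
    then show "Min ((\<lambda>i. v (x i)) ` J) \<in> (\<lambda>i. v (y i)) ` {..<4}"
      using J(3) by (auto simp: y_def intro!: image_eqI[of _ _ j])
    fix \<gamma> assume "\<gamma> \<in> (\<lambda>i. v (y i)) ` {..<4}"
    then obtain i where i: "i < 4" "\<gamma> = v (y i)" by auto
    show "Min ((\<lambda>i. v (x i)) ` J) \<le> \<gamma>"
    proof (cases "i \<in> J")
      case True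
      then show ?thesis using i J by (simp add: y_def)
    next
      case False
      have "x j \<in> carrier M" using summands_carrier[OF y, of j] j J(3) by (auto simp: y_def)
      then show ?thesis using False i j v_le_omega by (simp add: y_def)
    qed
  qed simp
  finally show "v (\<Oplus>\<^bsub>M\<^esub>i\<in>J. x i) = Min ((\<lambda>i. v (x i)) ` J)" .
qed

text \<open>Independence of the values gives linear independence: the minimum of the four values is
  v 0 = \<omega>, so each of them is \<omega>.\<close>

lemma decomposition_zero:
  assumes "a \<in> tor" "b \<in> M_theta" "c \<in> gt" "d \<in> M_minus"
    and "a \<oplus>\<^bsub>M\<^esub> (b \<oplus>\<^bsub>M\<^esub> (c \<oplus>\<^bsub>M\<^esub> d)) = \<zero>\<^bsub>M\<^esub>"
  shows "a = \<zero>\<^bsub>M\<^esub> \<and> b = \<zero>\<^bsub>M\<^esub> \<and> c = \<zero>\<^bsub>M\<^esub> \<and> d = \<zero>\<^bsub>M\<^esub>"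
proof -
  have M: "a \<in> carrier M" "b \<in> carrier M" "c \<in> carrier M" "d \<in> carrier M"
    using assms tor_carrier theta_carrier gt_carrier minus_carrier by auto
  have "min (v a) (min (v b) (min (v c) (v d))) = \<omega>"
    using v_decomposition[OF assms(1-4)] assms(5) by simp
  then have "v a \<ge> \<omega>" "v b \<ge> \<omega>" "v c \<ge> \<omega>" "v d \<ge> \<omega>" by (metis min.cobounded1 min.coboundedI2 order_refl)+
  then show ?thesis using M v_le_omega v_eq_omega by (metis order.antisym)
qed

lemma summands_internal_direct_sum: "internal_direct_sum S.P M {..<4} ((!) summands)"
  unfolding internal_direct_sum_def
proof (intro conjI ballI)
  show "submodule (summands ! i) S.P M" if "i \<in> {..<4}" for i using summands_submodule that by simp
  fix y assume y: "y \<in> carrier M"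
  have "y \<in> ge <+>\<^bsub>M\<^esub> M_minus" using y minus_sum by simp
  then obtain g d where gd: "g \<in> ge" "d \<in> M_minus" "y = g \<oplus>\<^bsub>M\<^esub> d" unfolding set_add_iff by blast
  have "g \<in> (tor <+>\<^bsub>M\<^esub> gt) <+>\<^bsub>M\<^esub> M_theta" using gd theta_sum by simp
  then obtain e b where eb: "e \<in> tor <+>\<^bsub>M\<^esub> gt" "b \<in> M_theta" "g = e \<oplus>\<^bsub>M\<^esub> b"
    using set_add_iff by metis
  then obtain a c where "a \<in> tor" "c \<in> gt" "e = a \<oplus>\<^bsub>M\<^esub> c"
    using set_add_iff by metis
  with eb have abc: "a \<in> tor" "c \<in> gt" "b \<in> M_theta" "g = (a \<oplus>\<^bsub>M\<^esub> c) \<oplus>\<^bsub>M\<^esub> b"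
    by simp_all
  \<comment> \<open>The function is restricted to the four indices because membership in an
    extensional product fixes its values elsewhere. The components are reordered as in
    \<open>summands\<close>, since the splitting yields a and c before b.\<close>
  define x where "x = (\<lambda>i\<in>{..<4::nat}. [a, b, c, d] ! i)"
  have x: "\<forall>i\<in>{..<4}. x i \<in> summands ! i"
    unfolding summands_iff using abc gd by (simp add: x_def)
  have sum: "(\<Oplus>\<^bsub>M\<^esub>i\<in>{..<4}. z i) = z 0 \<oplus>\<^bsub>M\<^esub> (z 1 \<oplus>\<^bsub>M\<^esub> (z 2 \<oplus>\<^bsub>M\<^esub> z 3))"
    if "\<forall>i\<in>{..<4}. z i \<in> summands ! i" for z
    using summands_carrier[OF that] by (rule finsum_lessThan_4)
  have y_sum: "y = (\<Oplus>\<^bsub>M\<^esub>i\<in>{..<4}. x i)"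
    unfolding sum[OF x] gd(3) abc(4)
    using abc(1-3) gd(2) tor_carrier theta_carrier gt_carrier minus_carrier
    by (simp add: x_def M.a_ac)
  show "\<exists>!x. x \<in> (\<Pi>\<^sub>E i\<in>{..<4}. summands ! i) \<and> y = (\<Oplus>\<^bsub>M\<^esub>i\<in>{..<4}. x i)"
  proof (rule ex1I[of _ x])
    show "x \<in> (\<Pi>\<^sub>E i\<in>{..<4}. summands ! i) \<and> y = (\<Oplus>\<^bsub>M\<^esub>i\<in>{..<4}. x i)"
      using x y_sum by (auto simp: x_def)
    fix z assume z: "z \<in> (\<Pi>\<^sub>E i\<in>{..<4}. summands ! i) \<and> y = (\<Oplus>\<^bsub>M\<^esub>i\<in>{..<4}. z i)"
    then have z': "\<forall>i\<in>{..<4}. z i \<in> summands ! i" by auto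
    \<comment> \<open>Uniqueness: the componentwise differences of two decompositions lie in the
      summands and add up to 0.\<close>
    define u where "u i = z i \<ominus>\<^bsub>M\<^esub> x i" for i
    have u: "\<forall>i\<in>{..<4}. u i \<in> summands ! i"
      using z' x submoduleD(6)[OF summands_submodule] by (simp add: u_def)
    have M: "\<And>i. i < 4 \<Longrightarrow> z i \<in> carrier M" "\<And>i. i < 4 \<Longrightarrow> x i \<in> carrier M"
      using summands_carrier z' x by blast+
    have "(\<Oplus>\<^bsub>M\<^esub>i\<in>{..<4}. x i) \<oplus>\<^bsub>M\<^esub> (\<Oplus>\<^bsub>M\<^esub>i\<in>{..<4}. u i) = (\<Oplus>\<^bsub>M\<^esub>i\<in>{..<4}. x i \<oplus>\<^bsub>M\<^esub> u i)"
      using M by (intro M.finsum_addf[symmetric]) (auto simp: u_def)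
    also have "\<dots> = (\<Oplus>\<^bsub>M\<^esub>i\<in>{..<4}. z i)"
      using M by (intro M.finsum_cong') (auto simp: u_def M.a_comm[of "x _"] M.diff_add_cancel)
    also have "\<dots> = (\<Oplus>\<^bsub>M\<^esub>i\<in>{..<4}. x i)" using z y_sum by simp
    finally have "(\<Oplus>\<^bsub>M\<^esub>i\<in>{..<4}. x i) \<oplus>\<^bsub>M\<^esub> (\<Oplus>\<^bsub>M\<^esub>i\<in>{..<4}. u i) = (\<Oplus>\<^bsub>M\<^esub>i\<in>{..<4}. x i)" .
    moreover have "(\<Oplus>\<^bsub>M\<^esub>i\<in>{..<4}. x i) \<in> carrier M" "(\<Oplus>\<^bsub>M\<^esub>i\<in>{..<4}. u i) \<in> carrier M"
      using M by (auto intro!: M.finsum_closed simp: u_def)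
    ultimately have "(\<Oplus>\<^bsub>M\<^esub>i\<in>{..<4}. u i) = \<zero>\<^bsub>M\<^esub>"
      by (simp add: M.add.l_cancel_one)
    then have "u 0 = \<zero>\<^bsub>M\<^esub> \<and> u 1 = \<zero>\<^bsub>M\<^esub> \<and> u 2 = \<zero>\<^bsub>M\<^esub> \<and> u 3 = \<zero>\<^bsub>M\<^esub>"
      unfolding sum[OF u] using decomposition_zero u unfolding summands_iff by blast
    then have "z i = x i" if "i < 4" for i
      using M that M.diff_eq_zero_iff[of "z i" "x i"] by (auto simp: u_def less_Suc_eq numeral_eq_Suc)
    then show "z = x" using z by (intro PiE_ext[of _ "{..<4}" "\<lambda>i. summands ! i"]) (use x in \<open>auto simp: x_def\<close>)
  qed
qed simp

lemma summand_vector_space: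
  assumes "N \<in> {M_theta, gt, M_minus}" "skew_field_of_fractions S.P D \<iota>"
  shows "is_vector_space_over D \<iota> S.P (restrict_module M N)"
proof -
  have N: "submodule N S.P M" "torsion_free_module S.P (restrict_module M N)"
    "divisible_module S.P (restrict_module M N)"
    using assms(1) theta_submodule gt_submodule minus_sub
      theta_torsion_free gt_torsion_free minus_torsion_free
      theta_divisible gt_divisible minus_divisible by auto
  interpret N: right_pid_module S.P "restrict_module M N"
    by (rule restrict_right_pid_module[OF N(1)])
  show ?thesis using N(2,3) assms(2) by (rule N.torsion_free_divisible_vector_space)
qed

end

theorem mainTheorem9:
  fixes K :: "'k ring" and \<phi> :: "'k \<Rightarrow> 'k"
    and M :: "(nat \<Rightarrow> 'k, 'm) module"
    and \<Delta> :: "'v::linorder set" and \<omega> :: 'v and \<tau> :: "'v \<Rightarrow> 'v" and v :: "'m \<Rightarrow> 'v"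
  defines "R \<equiv> skew_poly_ring K \<phi>"
    and "M_tor \<equiv> torsion (skew_poly_ring K \<phi>) M"
    and "M_gt \<equiv> val_gt M \<Delta> \<omega> \<tau> v"
    and "M_ge \<equiv> val_ge M \<Delta> \<tau> v"
  assumes "field K" and "\<phi> \<in> ring_hom K K"
    and "henselian_valued_module K \<phi> M \<Delta> \<omega> \<tau> v"
    and "divisible_module R M"
  shows
    "((\<exists>f. f \<in> right_module_embedding R (restrict_module M M_tor)
               (quotient_module (restrict_module M M_ge) M_gt)) \<and>
      (\<forall>f \<in> right_module_embedding R (restrict_module M M_tor)
               (quotient_module (restrict_module M M_ge) M_gt).
         direct_summand R (quotient_module (restrict_module M M_ge) M_gt) (f ` M_tor))) \<and>
     (torsion_free_module R (quotient_module (restrict_module M M_ge) (M_tor <+>\<^bsub>M\<^esub> M_gt)) \<and>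
      divisible_module R (quotient_module (restrict_module M M_ge) (M_tor <+>\<^bsub>M\<^esub> M_gt)) \<and>
      torsion_free_module R (restrict_module M M_gt) \<and>
      divisible_module R (restrict_module M M_gt) \<and>
      torsion_free_module R (quotient_module M M_ge) \<and>
      divisible_module R (quotient_module M M_ge)) \<and>
     (\<exists>M_theta M_minus.
        internal_direct_sum R M {..<4::nat} ((!) [M_tor, M_theta, M_gt, M_minus]) \<and>
        (\<exists>f. f \<in> right_module_iso R (restrict_module M M_theta)
                  (quotient_module (restrict_module M M_ge) (M_tor <+>\<^bsub>M\<^esub> M_gt))) \<and>
        (\<exists>f. f \<in> valued_module_iso R (restrict_module M M_minus) v
                  (quotient_module M M_ge) (quotient_val M_ge \<omega> v)) \<and>
        valuation_independent M v {..<4::nat} ((!) [M_tor, M_theta, M_gt, M_minus]) \<and>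
        (\<forall>N \<in> {M_theta, M_gt, M_minus}.
           regular_submodule K \<phi> M \<omega> \<tau> v N \<and>
           (\<forall>(D :: 'd ring) \<iota>. skew_field_of_fractions R D \<iota> \<longrightarrow>
              is_vector_space_over D \<iota> R (restrict_module M N))))"
proof -
  interpret divisible_henselian_module K \<phi> M \<Delta> \<omega> \<tau> v
    using assms(5-8) unfolding R_def
    by (intro divisible_henselian_module.intro skew_polynomials.intro skew_polynomials_axioms.intro)
  obtain M_theta M_minus where "henselian_decomposition K \<phi> M \<Delta> \<omega> \<tau> v M_theta M_minus"
    using henselian_decomposition_exists .
  then interpret henselian_decomposition K \<phi> M \<Delta> \<omega> \<tau> v M_theta M_minus .
  show ?thesis
    unfolding R_def M_tor_def M_gt_def M_ge_def
  proof (intro conjI ballI allI impI exI)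
    show "(\<lambda>x. gt +>\<^bsub>M\<^esub> x) \<in> right_module_embedding S.P (restrict_module M tor)
        (quotient_module (restrict_module M ge) gt)"
      by (rule tor_embedding)
    show "direct_summand S.P (quotient_module (restrict_module M ge) gt) (f ` tor)"
      if "f \<in> right_module_embedding S.P (restrict_module M tor)
        (quotient_module (restrict_module M ge) gt)" for f
      using that by (rule tor_embedding_direct_summand)
    show "torsion_free_module S.P (quotient_module (restrict_module M ge) (tor <+>\<^bsub>M\<^esub> gt))"
      by (rule quotient_tor_gt_torsion_free)
    show "divisible_module S.P (quotient_module (restrict_module M ge) (tor <+>\<^bsub>M\<^esub> gt))"
      by (rule ge.divisible_quotient[OF tor_gt_submodule_ge])
    show "torsion_free_module S.P (restrict_module M gt)" by (rule gt_torsion_free)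
    show "divisible_module S.P (restrict_module M gt)" by (rule gt_divisible)
    show "torsion_free_module S.P (quotient_module M ge)" by (rule quotient_ge_torsion_free)
    show "divisible_module S.P (quotient_module M ge)" by (rule divisible_quotient[OF ge_submodule])
    show "internal_direct_sum S.P M {..<4} ((!) summands)" by (rule summands_internal_direct_sum)
    show "(\<lambda>x. (tor <+>\<^bsub>M\<^esub> gt) +>\<^bsub>M\<^esub> x) \<in> right_module_iso S.P (restrict_module M M_theta)
        (quotient_module (restrict_module M ge) (tor <+>\<^bsub>M\<^esub> gt))"
      by (rule theta_iso)
    show "(\<lambda>x. ge +>\<^bsub>M\<^esub> x) \<in> valued_module_iso S.P (restrict_module M M_minus) v
        (quotient_module M ge) (quotient_val ge \<omega> v)"
      by (rule minus_iso)
    show "valuation_independent M v {..<4} ((!) summands)" by (rule summands_valuation_independent)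
    fix N assume N: "N \<in> {M_theta, gt, M_minus}"
    then show "regular_submodule K \<phi> M \<omega> \<tau> v N"
      using theta_regular gt_regular minus_regular by blast
    show "is_vector_space_over D \<iota> S.P (restrict_module M N)"
      if "skew_field_of_fractions S.P D \<iota>" for D :: "'d ring" and \<iota>
      using N that by (rule summand_vector_space)
  qed
qed

end
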